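(* Let $R,\tau,\gamma>0$, $\sigma\ge 0$, $q>1$, $0<r\le1$, and let $(M_n)_n$ be a sequence of numbers of local nodes. For each $n$, let $d=\big(\frac n{M_n}\big)^q$ and $\tilde d=\big(\frac n{M_n}\big)^r<d$, let $\mathcal{H}=\mathbb{R}^d$, and suppose the spectrum of $\mathbf{H}\in\mathbb{R}^{d\times d}$ is $$\lambda_j=\begin{cases}\frac1{\tilde d}, & j\le\tilde d,\\[2pt]\frac1{d-\tilde d}, & \tilde d+1\le j\le d.\end{cases}$$ Assume that: $\mathbb{E}[y^2\mid x]<\infty$ almost surely; $\mathbf{M}(\mathbf{A})\preceq\tau\,\mathrm{tr}[\mathbf{H}\mathbf{A}]\,\mathbf{H}$ for every PSD operator $\mathbf{A}$; $\sigma^2=\|\mathbf{H}^{-1/2}\boldsymbol{\Sigma}\mathbf{H}^{-1/2}\|<\infty$; $\gamma<\frac1{\tau\,\mathrm{tr}[\mathbf{H}]}$; $w_1=0$; and $\|w^*\|\le R$. If $$M_n\le\sqrt{\frac{\gamma(1-2\gamma\tau)\,n}{R^2}},$$ then for all sufficiently large $n$, $$\mathbb{E}\big[L(\overline{\overline{w}}_{M_n})\big]-L(w^* )\ \le\ c\,\frac1{\gamma M_n}\Big(\frac{M_n}n\Big)^{\nu},\qquad \nu=\min\{1-r,\,q-1\},$$ for some constant $c<\infty$ (independent of $n$) depending on $\tau,\gamma,\sigma$.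
   Context: Model. $(x,y)\in\mathcal{H}\times\mathbb{R}$ is a random pair with $y=\langle w^*,x\rangle+\epsilon$. $L(w)=\frac12\mathbb{E}[(y-\langle w,x\rangle)^2]$, and $w^*$ is the minimum-norm minimizer of $L$ over $\mathcal{H}$. $\mathbf{H}=\mathbb{E}[x\otimes x]$; $\mathbf{M}(\mathbf{A})w=\mathbb{E}[\langle x,\mathbf{A}x\rangle\langle w,x\rangle x]$; $\boldsymbol{\Sigma}=\mathbb{E}[(\langle w^*,x\rangle-y)^2\,x\otimes x]$. Distributed SGD. $n$ i.i.d. copies of $(x,y)$ are split evenly into $M=M_n$ disjoint local data sets $(x^{(m)}_t,y^{(m)}_t)_{t=1}^{n/M}$, $m=1,\dots,M$. With stepsize $\gamma$ and $w^{(m)}_1=w_1$, $$w^{(m)}_{t+1}=w^{(m)}_t-\gamma\big(\langle w^{(m)}_t,x^{(m)}_t\rangle-y^{(m)}_t\big)x^{(m)}_t,$$ $\bar w^{(m)}=\frac Mn\sum_{t=1}^{n/M}w^{(m)}_t$ and $\overline{\overline{w}}_M=\frac1M\sum_{m=1}^M\bar w^{(m)}$. The quantities $n/M_n$, $d$ and $\tilde d$ are understood to be integers. The constants $R,\tau,\gamma,\sigma,q,r$ do not depend on $n$, whereas the data distribution may depend on $n$ (through $d$ and $\mathbf{H}$). *)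

theory Defs
  imports "HOL-Probability.Probability" "Jordan_Normal_Form.Char_Poly"
begin

text \<open>
  The dimension \<open>d\<close> of the Hilbert space varies with the sample size, so \<open>\<real>\<^sup>d\<close> is rendered as
  \<open>carrier_vec d\<close>. The law of the pair \<open>(x, y)\<close> is a probability measure \<open>D\<close> on
  \<open>carrier_vec d \<times> \<real>\<close>; under it \<open>x\<close> is \<open>fst\<close> and \<open>y\<close> is \<open>snd\<close>.
\<close>

type_synonym rvec = "real Matrix.vec"
type_synonym rmat = "real Matrix.mat"

definition euclid_norm :: "rvec \<Rightarrow> real" where
  "euclid_norm v = sqrt (scalar_prod v v)"

definition vec_borel :: "nat \<Rightarrow> rvec measure" where
  "vec_borel d = vimage_algebra (carrier_vec d)
     (\<lambda>v. restrict (vec_index v) {..<d}) (Pi\<^sub>M {..<d} (\<lambda>_. borel))"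

definition pair_borel :: "nat \<Rightarrow> (rvec \<times> real) measure" where
  "pair_borel d = vec_borel d \<Otimes>\<^sub>M borel"

definition psd :: "nat \<Rightarrow> rmat \<Rightarrow> bool" where
  "psd d A \<longleftrightarrow> A \<in> carrier_mat d d \<and> transpose_mat A = A \<and>
     (\<forall>v\<in>carrier_vec d. 0 \<le> scalar_prod v (A *\<^sub>v v))"

definition loewner_le :: "nat \<Rightarrow> rmat \<Rightarrow> rmat \<Rightarrow> bool" where
  "loewner_le d A B \<longleftrightarrow> psd d (B - A)"

definition mat_trace :: "rmat \<Rightarrow> real" where
  "mat_trace A = (\<Sum>i<dim_row A. A $$ (i, i))"

definition op_norm :: "nat \<Rightarrow> rmat \<Rightarrow> real" where
  "op_norm d A = (SUP v\<in>{v\<in>carrier_vec d. euclid_norm v \<le> 1}. euclid_norm (A *\<^sub>v v))"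

text \<open>\<open>A\<^sup>-\<^sup>1\<^sup>/\<^sup>2\<close> for a positive definite \<open>A\<close>; the matrix chosen here is then unique.\<close>

definition inv_sqrt_mat :: "nat \<Rightarrow> rmat \<Rightarrow> rmat" where
  "inv_sqrt_mat d A = (SOME T. psd d T \<and> T * T * A = 1\<^sub>m d)"

text \<open>The eigenvalues of \<open>A\<close>, listed with multiplicity, are \<open>l 1, \<dots>, l d\<close>.\<close>

definition has_spectrum :: "nat \<Rightarrow> rmat \<Rightarrow> (nat \<Rightarrow> real) \<Rightarrow> bool" where
  "has_spectrum d A l \<longleftrightarrow> char_poly A = (\<Prod>j\<in>{1..d}. [:- l j, 1:])"

text \<open>
  The risk takes values in \<open>[0, \<infinity>]\<close>, so that no integrability convention can make it vanish.
\<close>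

definition risk :: "(rvec \<times> real) measure \<Rightarrow> rvec \<Rightarrow> ennreal" where
  "risk D w = (1 / 2) * (\<integral>\<^sup>+ z. ennreal ((snd z - scalar_prod w (fst z))\<^sup>2) \<partial>D)"

definition min_norm_minimizer :: "nat \<Rightarrow> (rvec \<times> real) measure \<Rightarrow> rvec \<Rightarrow> bool" where
  "min_norm_minimizer d D w \<longleftrightarrow>
     is_arg_min euclid_norm (is_arg_min (risk D) (\<lambda>v. v \<in> carrier_vec d)) w"

definition second_moment :: "nat \<Rightarrow> (rvec \<times> real) measure \<Rightarrow> rmat" where
  "second_moment d D = Matrix.mat d d (\<lambda>(i, j). \<integral>z. fst z $ i * fst z $ j \<partial>D)"

text \<open>The matrix of \<open>w \<mapsto> E[\<langle>x, A x\<rangle> \<langle>w, x\<rangle> x]\<close>\<close>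

definition fourth_moment_op :: "nat \<Rightarrow> (rvec \<times> real) measure \<Rightarrow> rmat \<Rightarrow> rmat" where
  "fourth_moment_op d D A = Matrix.mat d d
     (\<lambda>(i, j). \<integral>z. scalar_prod (fst z) (A *\<^sub>v fst z) * fst z $ j * fst z $ i \<partial>D)"

definition noise_cov :: "nat \<Rightarrow> (rvec \<times> real) measure \<Rightarrow> rvec \<Rightarrow> rmat" where
  "noise_cov d D w = Matrix.mat d d
     (\<lambda>(i, j). \<integral>z. (scalar_prod w (fst z) - snd z)\<^sup>2 * (fst z $ i * fst z $ j) \<partial>D)"

definition cond_second_moment_finite :: "nat \<Rightarrow> (rvec \<times> real) measure \<Rightarrow> bool" where
  "cond_second_moment_finite d D \<longleftrightarrow>
     (AE z in D. nn_cond_exp D (vimage_algebra (space D) fst (vec_borel d))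
                   (\<lambda>z. ennreal ((snd z)\<^sup>2)) z < \<infinity>)"

text \<open>
  The fourth moment bound \<open>M(A) \<preceq> \<tau> tr[H A] H\<close> for all PSD \<open>A\<close>. The integrability of \<open>\<parallel>x\<parallel>\<^sup>4\<close>
  says that the operators \<open>M(A)\<close> (and hence \<open>H\<close>) exist; without it the Bochner integrals
  defining them could be zero by convention.
\<close>

definition fourth_moment_bound :: "nat \<Rightarrow> (rvec \<times> real) measure \<Rightarrow> real \<Rightarrow> bool" where
  "fourth_moment_bound d D \<tau> \<longleftrightarrow>
     integrable D (\<lambda>z. (euclid_norm (fst z)) ^ 4) \<and>
     (\<forall>A. psd d A \<longrightarrow>
        loewner_le d (fourth_moment_op d D A)
          ((\<tau> * mat_trace (second_moment d D * A)) \<cdot>\<^sub>m second_moment d D))"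

text \<open>
  \<open>\<sigma>\<^sup>2 = \<parallel>H\<^sup>-\<^sup>1\<^sup>/\<^sup>2 \<Sigma> H\<^sup>-\<^sup>1\<^sup>/\<^sup>2\<parallel> < \<infinity>\<close>. The integrability condition is equivalent to the
  existence of all entries of \<open>\<Sigma>\<close>, that is, to the finiteness of this norm.
\<close>

definition noise_level :: "nat \<Rightarrow> (rvec \<times> real) measure \<Rightarrow> rvec \<Rightarrow> real \<Rightarrow> bool" where
  "noise_level d D w \<sigma> \<longleftrightarrow>
     integrable D (\<lambda>z. (scalar_prod w (fst z) - snd z)\<^sup>2 * (euclid_norm (fst z))\<^sup>2) \<and>
     \<sigma>\<^sup>2 = op_norm d (inv_sqrt_mat d (second_moment d D) * noise_cov d D w
                        * inv_sqrt_mat d (second_moment d D))"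

text \<open>
  Nodes and local time steps are numbered from 0: \<open>z t\<close> is the observation used in step
  \<open>t + 1\<close>, and \<open>sgd \<gamma> w1 z t\<close> is the iterate \<open>w\<^sub>t\<^sub>+\<^sub>1\<close>.
\<close>

primrec sgd :: "real \<Rightarrow> rvec \<Rightarrow> (nat \<Rightarrow> rvec \<times> real) \<Rightarrow> nat \<Rightarrow> rvec" where
  "sgd \<gamma> w1 z 0 = w1"
| "sgd \<gamma> w1 z (Suc t) =
     sgd \<gamma> w1 z t
       - (\<gamma> * (scalar_prod (sgd \<gamma> w1 z t) (fst (z t)) - snd (z t))) \<cdot>\<^sub>v fst (z t)"

definition vec_average :: "nat \<Rightarrow> nat \<Rightarrow> (nat \<Rightarrow> rvec) \<Rightarrow> rvec" where
  "vec_average d k v = Matrix.vec d (\<lambda>i. (\<Sum>t<k. v t $ i) / real k)"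

definition dist_sgd ::
    "nat \<Rightarrow> nat \<Rightarrow> nat \<Rightarrow> real \<Rightarrow> rvec \<Rightarrow> (nat \<Rightarrow> nat \<Rightarrow> rvec \<times> real) \<Rightarrow> rvec" where
  "dist_sgd d m k \<gamma> w1 z = vec_average d m (\<lambda>j. vec_average d k (sgd \<gamma> w1 (z j)))"

definition iid_samples ::
    "nat \<Rightarrow> nat \<Rightarrow> nat \<Rightarrow> (rvec \<times> real) measure \<Rightarrow> 'w measure
      \<Rightarrow> (nat \<Rightarrow> nat \<Rightarrow> 'w \<Rightarrow> rvec \<times> real) \<Rightarrow> bool" where
  "iid_samples d m k D P Z \<longleftrightarrow>
     prob_space P \<and>
     prob_space.indep_vars P (\<lambda>_. pair_borel d) (\<lambda>(j, t). Z j t) ({..<m} \<times> {..<k}) \<and>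
     (\<forall>j<m. \<forall>t<k. distr P (pair_borel d) (Z j t) = D)"

definition two_level_spectrum :: "nat \<Rightarrow> nat \<Rightarrow> nat \<Rightarrow> real" where
  "two_level_spectrum d d' j = (if j \<le> d' then 1 / real d' else 1 / (real d - real d'))"

end

theory Submission
  imports Defs
begin

text \<open>
  In an eigenbasis of \<open>H\<close> with eigenvalues \<open>\<mu>\<^sub>i\<close>, the \<open>i\<close>-th coordinate of the error \<open>w\<^sub>t - w\<^sup>*\<close> of a
  node is multiplied by \<open>1 - \<gamma> \<mu>\<^sub>i\<close> in each step, up to a martingale difference whose variance
  is at most \<open>2 \<mu>\<^sub>i (\<tau> q\<^sub>t + \<sigma>\<^sup>2)\<close>, where \<open>q\<^sub>t = E[\<langle>w\<^sub>t - w\<^sup>*, H (w\<^sub>t - w\<^sup>*)\<rangle>]\<close>. The recursion for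
  \<open>E[\<parallel>w\<^sub>t - w\<^sup>*\<parallel>\<^sup>2]\<close> bounds the sum of the \<open>q\<^sub>t\<close>, so no separate treatment of the bias and
  the variance iterates is needed. After averaging over the \<open>k = n/M\<close> steps, the mean of the
  \<open>i\<close>-th coordinate shrinks by a factor \<open>min 1 (1/(\<gamma> \<mu>\<^sub>i k))\<close> and its variance is at most
  \<open>min (4/\<mu>\<^sub>i\<^sup>2) (\<gamma>\<^sup>2 k\<^sup>2)/k\<^sup>2\<close> times the accumulated noise; averaging over the nodes divides
  the variance by \<open>M\<close>. For the two-level spectrum the first term of each minimum is used on one
  block of eigenvalues and the second term on the other, and \<open>M R\<^sup>2 \<le> \<gamma> (1 - 2 \<gamma> \<tau>) k\<close> makes the bias
  comparable to the variance. The same restriction forces \<open>k\<close> to tend to infinity.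
\<close>

text \<open>The difficulty is uniformity: dimension and distribution change with n, while c may
  depend only on tau, gamma and sigma. The excess risk is diagonal in the eigenbasis, so the final
  estimate needs only second moments of single coordinates, in which the dimension is invisible; the
  coordinates are coupled through q_t alone. That coupling is closed globally: in the recursion for
  the squared error, the noise feeds back at most 2 gamma^2 tau tr(H) q_t against a decrease of 2
  gamma q_t, and gamma tau tr(H) < 1 leaves a surplus. For the two-level spectrum tr(H) = 2 whatever
  n is, so the surplus is uniform, and since the squared norm of w* is at most a multiple of k, R
  drops out of the constant. The residual y - <w*,x> may depend on x; minimality of w* yields only
  that it is uncorrelated with x. The mixed term in the second moment of the gradient therefore need
  not vanish, and absorbing it costs the factor 2 in the variance bound. The node restriction makes
  M of order at most sqrt(n), hence k of order at least sqrt(n). A large k is needed only to make d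
  - d~ at least d/2.\<close>

no_notation Inner_Product.inner (infix \<open>\<bullet>\<close> 70)

section \<open>Orthogonal diagonalization of symmetric matrices\<close>

lemma scalar_prod_self_pos:
  fixes v :: rvec
  assumes "v \<in> carrier_vec n" "v \<noteq> 0\<^sub>v n"
  shows "0 < v \<bullet> v"
proof -
  obtain i where i: "i < n" "v $ i \<noteq> 0" using assms by (metis carrier_vecD eq_vecI index_zero_vec)
  have "0 < (v $ i)\<^sup>2" using i by simp
  also have "\<dots> \<le> (\<Sum>i\<in>{0..<n}. (v $ i)\<^sup>2)" using i by (intro member_le_sum) auto
  finally show ?thesis using assms by (simp add: scalar_prod_def power2_eq_square)
qed

text \<open>The reflection in the hyperplane orthogonal to \<open>u\<close>. It supplies an
  orthogonal matrix with a prescribed first column, so an eigenvector need not be completed to a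
  basis by hand.\<close>

definition householder :: "nat \<Rightarrow> rvec \<Rightarrow> rmat" where
  "householder n u = Matrix.mat n n (\<lambda>(i, j). (if i = j then 1 else 0) - 2 / (u \<bullet> u) * (u $ i * u $ j))"

lemma householder_carrier [simp]: "householder n u \<in> carrier_mat n n"
  by (simp add: householder_def)

lemma transpose_householder: "(householder n u)\<^sup>T = householder n u"
  by (rule eq_matI) (auto simp: householder_def)

text \<open>For \<open>u = 0\<close> this is still true: the division by zero makes the reflection the identity.\<close>

lemma householder_involution:
  assumes u: "u \<in> carrier_vec n"
  shows "householder n u * householder n u = 1\<^sub>m n"
proof (rule eq_matI)
  fix i j assume ij: "i < dim_row (1\<^sub>m n)" "j < dim_col (1\<^sub>m n)"
  define c where "c = 2 / (u \<bullet> u)"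
  have c: "c * c * (u \<bullet> u) = 2 * c" unfolding c_def by (cases "u \<bullet> u = 0") auto
  have uu: "u \<bullet> u = (\<Sum>l\<in>{0..<n}. u $ l * u $ l)" using u by (simp add: scalar_prod_def)
  have "(householder n u * householder n u) $$ (i, j) = (\<Sum>l\<in>{0..<n}.
      ((if i = l then 1 else 0) - c * (u $ i * u $ l)) * ((if l = j then 1 else 0) - c * (u $ l * u $ j)))"
    using ij by (simp add: householder_def scalar_prod_def c_def)
  also have "\<dots> = (\<Sum>l\<in>{0..<n}. (if l = i then (if i = j then 1 else 0) else 0)
      - (if l = i then c * (u $ i * u $ j) else 0) - (if l = j then c * (u $ i * u $ j) else 0)
      + c * c * (u $ l * u $ l) * (u $ i * u $ j))"
    by (intro sum.cong refl) (auto simp: algebra_simps)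
  also have "\<dots> = (if i = j then 1 else 0) - 2 * c * (u $ i * u $ j) + c * c * (u \<bullet> u) * (u $ i * u $ j)"
    using ij by (simp add: sum.distrib sum_subtractf uu flip: sum_distrib_left sum_distrib_right)
  also have "\<dots> = (if i = j then 1 else 0)" unfolding c by simp
  finally show "(householder n u * householder n u) $$ (i, j) = 1\<^sub>m n $$ (i, j)" using ij by simp
qed (auto simp: householder_def)

text \<open>Two unit vectors are mirror images of each other in the hyperplane orthogonal to their
  difference.\<close>

lemma householder_first_col:
  assumes v: "v \<in> carrier_vec n" "v \<bullet> v = 1" and n: "0 < n"
  shows "householder n (v - unit_vec n 0) *\<^sub>v unit_vec n 0 = v"
proof (rule eq_vecI)
  define u where "u = v - unit_vec n 0"
  have vv: "(\<Sum>l\<in>{0..<n}. v $ l * v $ l) = 1" using v by (simp add: scalar_prod_def)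
  have "u \<bullet> u = (\<Sum>l\<in>{0..<n}. v $ l * v $ l - (if l = 0 then 2 * v $ 0 - 1 else 0))"
    unfolding scalar_prod_def u_def using v n by (intro sum.cong) (auto simp: algebra_simps)
  also have "\<dots> = 2 - 2 * v $ 0" using n vv by (simp add: sum_subtractf)
  finally have uu: "u \<bullet> u = 2 - 2 * v $ 0" .
  fix i assume "i < dim_vec v"
  hence i: "i < n" using v by simp
  have "(householder n u *\<^sub>v unit_vec n 0) $ i = (if i = 0 then 1 else 0) - 2 / (u \<bullet> u) * (u $ i * u $ 0)"
    using i n by (simp add: householder_def)
  also have "\<dots> = v $ i"
  proof (cases "v $ 0 = 1")
    case False
    have "2 / (u \<bullet> u) * u $ 0 = -1" unfolding uu using False n v by (simp add: u_def field_simps)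
    hence "2 / (u \<bullet> u) * (u $ i * u $ 0) = - u $ i"
      by (metis mult.left_commute mult_minus1_right)
    thus ?thesis using i v n by (simp add: u_def)
  next
    \<comment> \<open>A unit vector with first entry 1 is the unit vector itself, so the reflection
      degenerates to the identity through division by zero.\<close>
    case True
    hence "u \<bullet> u = 0" using uu by simp
    moreover have "u \<in> carrier_vec n" using v by (simp add: u_def)
    ultimately have "u = 0\<^sub>v n" using scalar_prod_self_pos[of u n] by force
    hence "u $ i = 0" using i by simp
    hence "v $ i = (if i = 0 then 1 else 0)" using i v n by (simp add: u_def)
    thus ?thesis using \<open>u \<bullet> u = 0\<close> by simp
  qed
  finally show "(householder n (v - unit_vec n 0) *\<^sub>v unit_vec n 0) $ i = v $ i" by (simp add: u_def)
qed (use v in \<open>simp add: householder_def\<close>)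

text \<open>Deflation: a reflection moves an eigenvector for the first listed eigenvalue to the
  first axis, symmetry clears the rest of the first row, and the induction hypothesis handles the
  remaining block. The factored characteristic polynomial provides a real eigenvalue at each stage
  and fixes the order of the diagonal.\<close>

lemma symmetric_orthogonal_diagonalization:
  fixes A :: rmat
  assumes "A \<in> carrier_mat n n" "A\<^sup>T = A" "char_poly A = (\<Prod>e\<leftarrow>es. [:- e, 1:])"
  shows "\<exists>U\<in>carrier_mat n n. U\<^sup>T * U = 1\<^sub>m n \<and> U\<^sup>T * A * U = mat_diag n (\<lambda>i. es ! i)"
  using assms
proof (induction es arbitrary: n A)
  case Nil
  with degree_monic_char_poly[of A n] have n: "n = 0" by simp
  show ?case by (rule bexI[of _ "1\<^sub>m n"]) (use n Nil in \<open>auto intro!: eq_matI simp: mat_diag_def\<close>)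
next
  case (Cons e es n A)
  note A = Cons.prems(1) and sym = Cons.prems(2)
  have cp: "char_poly A = [:- e, 1:] * (\<Prod>e\<leftarrow>es. [:- e, 1:])" using Cons.prems(3) by simp
  have "eigenvalue A e" unfolding eigenvalue_root_char_poly[OF A] cp by simp
  then obtain v' where v': "v' \<in> carrier_vec n" "v' \<noteq> 0\<^sub>v n" "A *\<^sub>v v' = e \<cdot>\<^sub>v v'"
    using A unfolding eigenvalue_def eigenvector_def by auto
  define v where "v = (1 / sqrt (v' \<bullet> v')) \<cdot>\<^sub>v v'"
  have v'pos: "0 < v' \<bullet> v'" by (rule scalar_prod_self_pos[OF v'(1,2)])
  have v: "v \<in> carrier_vec n" using v' by (simp add: v_def)
  have vv: "v \<bullet> v = 1" using v' v'pos by (simp add: v_def)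
  have Av: "A *\<^sub>v v = e \<cdot>\<^sub>v v"
    using v' A by (simp add: v_def mult_mat_vec smult_smult_assoc mult.commute)
  have n: "0 < n" using v' by (cases n) auto
  then obtain n1 where n1: "n = 1 + n1" by (metis Suc_eq_plus1_left gr0_implies_Suc)
  define W where "W = householder n (v - unit_vec n 0)"
  have W: "W \<in> carrier_mat n n" and WT: "W\<^sup>T = W" by (simp_all add: W_def transpose_householder)
  have WW: "W * W = 1\<^sub>m n" unfolding W_def by (rule householder_involution) (use v in simp)
  have We: "W *\<^sub>v unit_vec n 0 = v" unfolding W_def by (rule householder_first_col[OF v vv n])
  have Wv: "W *\<^sub>v v = unit_vec n 0"
    using assoc_mult_mat_vec[OF W W, of "unit_vec n 0"] by (simp add: WW We)
  define B where "B = W * (A * W)"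
  have B: "B \<in> carrier_mat n n" using W A by (simp add: B_def)
  have B_sym: "B\<^sup>T = B"
    unfolding B_def using W A sym WT
    by (simp add: transpose_mult[of _ n n _ n] assoc_mult_mat[of _ n n _ n _ n])
  have "B *\<^sub>v unit_vec n 0 = W *\<^sub>v (A *\<^sub>v (W *\<^sub>v unit_vec n 0))"
    unfolding B_def using W A by (simp add: assoc_mult_mat_vec[of _ n n _ n])
  also have "\<dots> = e \<cdot>\<^sub>v unit_vec n 0" using W v by (simp add: We Av Wv mult_mat_vec)
  finally have Be: "B *\<^sub>v unit_vec n 0 = e \<cdot>\<^sub>v unit_vec n 0" .
  have B_col: "B $$ (i, 0) = (if i = 0 then e else 0)" if "i < n" for i
    using arg_cong[OF Be, of "\<lambda>w. w $ i"] that n B by simp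
  have B_row: "B $$ (0, i) = (if i = 0 then e else 0)" if "i < n" for i
    using B_col[OF that] B_sym B that n by (metis carrier_matD index_transpose_mat(1))
  define C where "C = Matrix.mat n1 n1 (\<lambda>(i, j). B $$ (Suc i, Suc j))"
  have C: "C \<in> carrier_mat n1 n1" by (simp add: C_def)
  have C_sym: "C\<^sup>T = C"
  proof (rule eq_matI)
    fix i j assume "i < dim_row C" "j < dim_col C"
    hence "i < n1" "j < n1" by (auto simp: C_def)
    moreover have "B $$ (Suc j, Suc i) = B $$ (Suc i, Suc j)" if "i < n1" "j < n1"
      using B_sym B that n1 by (metis Suc_eq_plus1_left carrier_matD index_transpose_mat(1) nat_add_left_cancel_less)
    ultimately show "C\<^sup>T $$ (i, j) = C $$ (i, j)" by (simp add: C_def)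
  qed (auto simp: C_def)
  let ?E = "Matrix.mat 1 1 (\<lambda>_. e)"
  have B_block: "B = four_block_mat ?E (0\<^sub>m 1 n1) (0\<^sub>m n1 1) C"
  proof (rule eq_matI)
    fix i j assume "i < dim_row (four_block_mat ?E (0\<^sub>m 1 n1) (0\<^sub>m n1 1) C)"
      "j < dim_col (four_block_mat ?E (0\<^sub>m 1 n1) (0\<^sub>m n1 1) C)"
    hence ij: "i < Suc n1" "j < Suc n1" using C by auto
    show "B $$ (i, j) = four_block_mat ?E (0\<^sub>m 1 n1) (0\<^sub>m n1 1) C $$ (i, j)"
      using ij B_col[of i] B_row[of j] n1 C by (cases i; cases j) (auto simp: C_def)
  qed (use B n1 C in auto)
  \<comment> \<open>Similarity keeps the characteristic polynomial and the block form factors it;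
    cancelling the linear factor of \<open>e\<close> leaves the product over \<open>es\<close> for
    \<open>C\<close>.\<close>
  have "similar_mat B A"
    unfolding similar_mat_def B_def
    by (rule exI[of _ W], rule exI[of _ W], rule similar_mat_witI[where n = n]) (use WW W A in \<open>auto simp: assoc_mult_mat[of _ n n _ n _ n]\<close>)
  hence "char_poly B = [:- e, 1:] * (\<Prod>e\<leftarrow>es. [:- e, 1:])" using char_poly_similar cp by metis
  moreover have "char_poly B = char_poly ?E * char_poly C"
    unfolding B_block by (rule char_poly_four_block_zeros_col) (use C in auto)
  moreover have "char_poly ?E = [:- e, 1:]"
    by (simp add: char_poly_defs det_def sign_def)
  ultimately have "char_poly C = (\<Prod>e\<leftarrow>es. [:- e, 1:])"
    by (metis mult_cancel_left pCons_eq_0_iff zero_neq_one)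
  from Cons.IH[OF C C_sym this] obtain V where V: "V \<in> carrier_mat n1 n1" "V\<^sup>T * V = 1\<^sub>m n1"
    and VCV: "V\<^sup>T * C * V = mat_diag n1 (\<lambda>i. es ! i)" by blast
  define V' where "V' = four_block_mat (1\<^sub>m 1) (0\<^sub>m 1 n1) (0\<^sub>m n1 1) V"
  have V': "V' \<in> carrier_mat n n" unfolding V'_def n1 using V by (intro four_block_carrier_mat) auto
  have V't: "V'\<^sup>T = four_block_mat (1\<^sub>m 1) (0\<^sub>m 1 n1) (0\<^sub>m n1 1) (V\<^sup>T)"
    unfolding V'_def using V by (subst transpose_four_block_mat) auto
  have V'V': "V'\<^sup>T * V' = 1\<^sub>m n"
    unfolding V't unfolding V'_def using V n1
    by (subst mult_four_block_mat[of _ 1 1 _ n1 _ n1]) auto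
  have BV': "V'\<^sup>T * (B * V') = mat_diag n (\<lambda>i. (e # es) ! i)"
  proof -
    have "B * V' = four_block_mat ?E (0\<^sub>m 1 n1) (0\<^sub>m n1 1) (C * V)"
      unfolding B_block V'_def using V C
      by (subst mult_four_block_mat[of _ 1 1 _ n1 _ n1]) auto
    hence "V'\<^sup>T * (B * V') = four_block_mat ?E (0\<^sub>m 1 n1) (0\<^sub>m n1 1) (V\<^sup>T * (C * V))"
      unfolding V't using V C
      by (simp, subst mult_four_block_mat[of _ 1 1 _ n1 _ n1]) auto
    also have "V\<^sup>T * (C * V) = mat_diag n1 (\<lambda>i. es ! i)"
      using VCV V C by (simp add: assoc_mult_mat[of _ n1 n1 _ n1 _ n1])
    also have "four_block_mat ?E (0\<^sub>m 1 n1) (0\<^sub>m n1 1) (mat_diag n1 (\<lambda>i. es ! i)) = mat_diag n (\<lambda>i. (e # es) ! i)"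
      by (rule eq_matI) (auto simp: n1 mat_diag_def nth_Cons')
    finally show ?thesis .
  qed
  have Ut: "(W * V')\<^sup>T = V'\<^sup>T * W" using transpose_mult[OF W V'] by (simp add: WT)
  note assoc = assoc_mult_mat[of _ n n _ n _ n]
  show ?case
  proof (rule bexI[of _ "W * V'"], intro conjI)
    have "(W * V')\<^sup>T * (W * V') = V'\<^sup>T * ((W * W) * V')"
      unfolding Ut using W V' by (simp add: assoc del: assoc_mult_mat)
    thus "(W * V')\<^sup>T * (W * V') = 1\<^sub>m n" using V' V'V' by (simp add: WW)
    have "(W * V')\<^sup>T * A * (W * V') = V'\<^sup>T * (B * V')"
      unfolding Ut B_def using W V' A by (simp add: assoc)
    thus "(W * V')\<^sup>T * A * (W * V') = mat_diag n (\<lambda>i. (e # es) ! i)" by (simp add: BV')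
  qed (use W V' in simp)
qed

section \<open>Euclidean norm and operator norm\<close>

lemma scalar_prod_lessThan: "(v :: rvec) \<bullet> w = (\<Sum>l<dim_vec w. v $ l * w $ l)"
  by (simp add: scalar_prod_def atLeast0LessThan)

lemma scalar_prod_self_nonneg: "0 \<le> (v :: rvec) \<bullet> v"
  by (simp add: scalar_prod_lessThan sum_nonneg)

lemma euclid_norm_power2: "(euclid_norm v)\<^sup>2 = v \<bullet> v"
  by (simp add: euclid_norm_def scalar_prod_lessThan sum_nonneg)

lemma euclid_norm_nonneg: "0 \<le> euclid_norm v"
  by (simp add: euclid_norm_def scalar_prod_lessThan sum_nonneg)

lemma scalar_prod_Cauchy_Schwarz_power2:
  assumes "v \<in> carrier_vec n" "w \<in> carrier_vec n"
  shows "((v :: rvec) \<bullet> w)\<^sup>2 \<le> (v \<bullet> v) * (w \<bullet> w)"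
  using Cauchy_Schwarz_ineq_sum[of "\<lambda>i. v $ i" "\<lambda>i. w $ i" "{..<n}"] assms
  by (simp add: scalar_prod_lessThan power2_eq_square)

lemma scalar_prod_Cauchy_Schwarz:
  assumes "v \<in> carrier_vec n" "w \<in> carrier_vec n"
  shows "v \<bullet> w \<le> euclid_norm v * euclid_norm w"
proof -
  have "(v \<bullet> w)\<^sup>2 \<le> (v \<bullet> v) * (w \<bullet> w)" by (rule scalar_prod_Cauchy_Schwarz_power2[OF assms])
  also have "\<dots> = (euclid_norm v * euclid_norm w)\<^sup>2" by (simp add: euclid_norm_power2 power_mult_distrib)
  finally show ?thesis
    by (rule power2_le_imp_le) (simp add: euclid_norm_nonneg)
qed

lemma quadratic_form_le_op_norm:
  assumes B: "B \<in> carrier_mat n n" and v: "v \<in> carrier_vec n"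
  shows "v \<bullet> (B *\<^sub>v v) \<le> op_norm n B * (v \<bullet> v)"
proof (cases "v = 0\<^sub>v n")
  case False
  let ?S = "{v \<in> carrier_vec n. euclid_norm v \<le> 1}"
  \<comment> \<open>A real \<open>SUP\<close> bounds its members only over a bounded set; the
    Frobenius norm of \<open>B\<close> is the bound.\<close>
  have bdd: "bdd_above ((\<lambda>v. euclid_norm (B *\<^sub>v v)) ` ?S)"
  proof (rule bdd_aboveI2)
    fix w assume w: "w \<in> ?S"
    have ww: "w \<bullet> w \<le> 1"
      unfolding euclid_norm_power2[symmetric] using w euclid_norm_nonneg by (intro power_le_one) auto
    have "(euclid_norm (B *\<^sub>v w))\<^sup>2 = (\<Sum>i<n. (row B i \<bullet> w)\<^sup>2)"
      unfolding euclid_norm_power2 unfolding power2_eq_square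
      using B w by (simp add: scalar_prod_lessThan[of "B *\<^sub>v w"])
    also have "\<dots> \<le> (\<Sum>i<n. row B i \<bullet> row B i)"
    proof (rule sum_mono)
      fix i assume "i \<in> {..<n}"
      hence r: "row B i \<in> carrier_vec n" using B by simp
      have "(row B i \<bullet> w)\<^sup>2 \<le> (row B i \<bullet> row B i) * (w \<bullet> w)"
        using w by (intro scalar_prod_Cauchy_Schwarz_power2[OF r]) simp
      also have "\<dots> \<le> (row B i \<bullet> row B i) * 1"
        by (intro mult_left_mono ww scalar_prod_self_nonneg)
      finally show "(row B i \<bullet> w)\<^sup>2 \<le> row B i \<bullet> row B i" by simp
    qed
    finally show "euclid_norm (B *\<^sub>v w) \<le> sqrt (\<Sum>i<n. row B i \<bullet> row B i)" by (rule real_le_rsqrt)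
  qed
  have pos: "0 < v \<bullet> v" by (rule scalar_prod_self_pos[OF v False])
  hence nz: "euclid_norm v \<noteq> 0" by (simp add: euclid_norm_def)
  define w where "w = (1 / euclid_norm v) \<cdot>\<^sub>v v"
  have w: "w \<in> carrier_vec n" using v by (simp add: w_def)
  have vw: "v = euclid_norm v \<cdot>\<^sub>v w" using nz by (simp add: w_def smult_smult_assoc)
  have "v \<bullet> v = (euclid_norm v)\<^sup>2 * (w \<bullet> w)"
    using arg_cong[OF vw, of "\<lambda>x. x \<bullet> x"] w by (simp add: power2_eq_square mult.assoc)
  hence "(euclid_norm v)\<^sup>2 * (w \<bullet> w) = (euclid_norm v)\<^sup>2" using euclid_norm_power2[of v] by linarith
  hence "w \<bullet> w = 1" using nz by simp
  hence "euclid_norm w = 1" by (simp add: euclid_norm_def)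
  have "w \<bullet> (B *\<^sub>v w) \<le> euclid_norm w * euclid_norm (B *\<^sub>v w)"
    by (rule scalar_prod_Cauchy_Schwarz[of _ n]) (use B w in auto)
  also have "\<dots> \<le> op_norm n B"
    unfolding \<open>euclid_norm w = 1\<close> op_norm_def mult_1
    by (rule cSUP_upper[OF _ bdd]) (use w \<open>euclid_norm w = 1\<close> in simp)
  finally have "(euclid_norm v)\<^sup>2 * (w \<bullet> (B *\<^sub>v w)) \<le> (euclid_norm v)\<^sup>2 * op_norm n B"
    by (intro mult_left_mono) auto
  moreover have "v \<bullet> (B *\<^sub>v v) = (euclid_norm v)\<^sup>2 * (w \<bullet> (B *\<^sub>v w))"
    using B w by (subst (1 2) vw) (simp add: mult_mat_vec power2_eq_square)
  ultimately show ?thesis by (simp add: euclid_norm_power2 mult.commute)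
qed (use B in \<open>simp add: scalar_prod_lessThan\<close>)

section \<open>Coordinates in an orthonormal eigenbasis\<close>

locale eigenbasis =
  fixes d :: nat and H U :: rmat and \<mu> :: "nat \<Rightarrow> real"
  assumes H: "H \<in> carrier_mat d d" and U: "U \<in> carrier_mat d d"
    and UtU: "U\<^sup>T * U = 1\<^sub>m d" and UtHU: "U\<^sup>T * H * U = mat_diag d \<mu>"
begin

abbreviation coord :: "nat \<Rightarrow> rvec \<Rightarrow> real" where
  "coord i v \<equiv> (U\<^sup>T *\<^sub>v v) $ i"

lemma UUt: "U * U\<^sup>T = 1\<^sub>m d"
  using mat_mult_left_right_inverse[OF _ U UtU] U by simp

lemma U_Ut_vec: "v \<in> carrier_vec d \<Longrightarrow> U *\<^sub>v (U\<^sup>T *\<^sub>v v) = v"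
  using assoc_mult_mat_vec[of U d d "U\<^sup>T" d v] U by (simp add: UUt)

lemma H_eq: "H = U * mat_diag d \<mu> * U\<^sup>T"
proof -
  have "U * mat_diag d \<mu> * U\<^sup>T = (U * U\<^sup>T) * H * (U * U\<^sup>T)"
    unfolding UtHU[symmetric] using U H by (simp add: assoc_mult_mat[of _ d d _ d _ d])
  thus ?thesis using H by (simp add: UUt)
qed

lemma parseval:
  assumes "v \<in> carrier_vec d" "w \<in> carrier_vec d"
  shows "v \<bullet> w = (\<Sum>i<d. coord i v * coord i w)"
proof -
  have "v \<bullet> w = v \<bullet> (U *\<^sub>v (U\<^sup>T *\<^sub>v w))" using assms by (simp add: U_Ut_vec)
  also have "\<dots> = (U\<^sup>T *\<^sub>v v) \<bullet> (U\<^sup>T *\<^sub>v w)"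
    using assms U by (subst transpose_vec_mult_scalar[of _ d d]) auto
  finally show ?thesis using U by (simp add: scalar_prod_lessThan)
qed

text \<open>Stated for an arbitrary diagonal \<open>f\<close> because it serves both
  \<open>H\<close> itself and its inverse square root.\<close>

lemma diagonal_form:
  assumes "v \<in> carrier_vec d" "w \<in> carrier_vec d"
  shows "v \<bullet> (U * mat_diag d f * U\<^sup>T *\<^sub>v w) = (\<Sum>i<d. f i * (coord i v * coord i w))"
proof -
  have "coord i (U * mat_diag d f * U\<^sup>T *\<^sub>v w) = f i * coord i w" if i: "i < d" for i
  proof -
    have "U\<^sup>T *\<^sub>v (U * mat_diag d f * U\<^sup>T *\<^sub>v w) = mat_diag d f *\<^sub>v (U\<^sup>T *\<^sub>v w)"
    proof -
      have "U\<^sup>T *\<^sub>v (U * mat_diag d f * U\<^sup>T *\<^sub>v w) = (U\<^sup>T * U) * mat_diag d f *\<^sub>v (U\<^sup>T *\<^sub>v w)"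
        using U assms by (simp add: assoc_mult_mat[of _ d d _ d _ d] assoc_mult_mat_vec[of _ d d _ d]
            mult_carrier_mat[of _ d d _ d])
      thus ?thesis by (simp add: UtU left_mult_one_mat[of _ d d])
    qed
    moreover have "(mat_diag d f *\<^sub>v x) $ i = f i * x $ i" if "x \<in> carrier_vec d" for x
    proof -
      have "(mat_diag d f *\<^sub>v x) $ i = (\<Sum>l<d. (if i = l then f l else 0) * x $ l)"
        using i that by (simp add: mat_diag_def scalar_prod_lessThan)
      also have "\<dots> = (\<Sum>l<d. if l = i then f i * x $ i else 0)" by (intro sum.cong) auto
      finally show ?thesis using i by simp
    qed
    ultimately show ?thesis using U assms by simp
  qed
  moreover have "U * mat_diag d f * U\<^sup>T *\<^sub>v w \<in> carrier_vec d"
    using U assms by (intro mult_mat_vec_carrier[of _ d d] mult_carrier_mat[of _ d d]) auto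
  ultimately show ?thesis using assms by (simp add: parseval ac_simps)
qed

lemma quadratic_form_H:
  "v \<in> carrier_vec d \<Longrightarrow> w \<in> carrier_vec d \<Longrightarrow> v \<bullet> (H *\<^sub>v w) = (\<Sum>i<d. \<mu> i * (coord i v * coord i w))"
  by (subst H_eq) (rule diagonal_form)

lemma col_U: "i < d \<Longrightarrow> col U i \<in> carrier_vec d"
  using U by auto

lemma coord_eq: "i < d \<Longrightarrow> coord i v = col U i \<bullet> v"
  using U by simp

lemma coord_col: "i < d \<Longrightarrow> j < d \<Longrightarrow> coord i (col U j) = (if i = j then 1 else 0)"
  using arg_cong[OF UtU, of "\<lambda>A. A $$ (i, j)"] U by simp

lemma coord_linear:
  assumes "\<alpha> \<in> carrier_vec d" "i < d"
  shows "coord i (U *\<^sub>v \<alpha>) = \<alpha> $ i"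
  using assoc_mult_mat_vec[of "U\<^sup>T" d d U d \<alpha>] assms U by (simp add: UtU)

text \<open>Each diagonal entry is expanded in the eigenbasis and the sums are swapped; the columns
  of \<open>U\<close> have length 1. This turns the stepsize condition into one on the
  eigenvalues.\<close>

lemma mat_trace_H: "mat_trace H = (\<Sum>i<d. \<mu> i)"
proof -
  have "H $$ (l, l) = (\<Sum>i<d. \<mu> i * (U $$ (l, i) * U $$ (l, i)))" if l: "l < d" for l
  proof -
    have "H $$ (l, l) = unit_vec d l \<bullet> (H *\<^sub>v unit_vec d l)" using H l by simp
    also have "\<dots> = (\<Sum>i<d. \<mu> i * (coord i (unit_vec d l) * coord i (unit_vec d l)))"
      by (rule quadratic_form_H) auto
    finally show ?thesis using U l by simp
  qed
  hence "mat_trace H = (\<Sum>l<d. \<Sum>i<d. \<mu> i * (U $$ (l, i) * U $$ (l, i)))"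
    using H by (simp add: mat_trace_def)
  also have "\<dots> = (\<Sum>i<d. \<mu> i * (\<Sum>l<d. U $$ (l, i) * U $$ (l, i)))"
    unfolding sum_distrib_left by (rule sum.swap)
  also have "\<dots> = (\<Sum>i<d. \<mu> i)"
  proof (intro sum.cong refl)
    fix i assume "i \<in> {..<d}"
    hence "(\<Sum>l<d. U $$ (l, i) * U $$ (l, i)) = 1"
      using coord_col[of i i] coord_eq[of i "col U i"] U by (simp add: scalar_prod_lessThan)
    thus "\<mu> i * (\<Sum>l<d. U $$ (l, i) * U $$ (l, i)) = \<mu> i" by simp
  qed
  finally show ?thesis .
qed

text \<open>With \<open>T\<close> the inverse square root of \<open>H\<close>, substitute \<open>v = T u\<close>, so that \<open>u \<bullet> u = v \<bullet> H v\<close>.\<close>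

lemma quadratic_form_le_op_norm_whitened:
  assumes pos: "\<And>i. i < d \<Longrightarrow> 0 < \<mu> i" and S: "S \<in> carrier_mat d d" and v: "v \<in> carrier_vec d"
  shows "v \<bullet> (S *\<^sub>v v) \<le> op_norm d (inv_sqrt_mat d H * S * inv_sqrt_mat d H) * (v \<bullet> (H *\<^sub>v v))"
proof -
  define T where "T = inv_sqrt_mat d H"
  \<comment> \<open>An explicit witness that the choice in \<open>inv_sqrt_mat\<close> is
    satisfiable. From there on \<open>T\<close> is known only through its defining
    properties.\<close>
  define T0 where "T0 = U * mat_diag d (\<lambda>i. 1 / sqrt (\<mu> i)) * U\<^sup>T"
  note assoc = assoc_mult_mat[of _ d d _ d _ d] assoc_mult_mat_vec[of _ d d _ d]
  have T0: "T0 \<in> carrier_mat d d" unfolding T0_def using U by (intro mult_carrier_mat[of _ d d]) auto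
  have cancel: "U\<^sup>T * (U * A) = A" if "A \<in> carrier_mat d d" for A
    using that U assoc(1)[of "U\<^sup>T" U A] by (simp add: UtU)
  have "psd d T0"
    unfolding psd_def
  proof (intro conjI ballI T0)
    have "(mat_diag d f)\<^sup>T = mat_diag d f" for f :: "nat \<Rightarrow> real"
      by (rule eq_matI) (auto simp: mat_diag_def)
    thus "T0\<^sup>T = T0" unfolding T0_def using U
      by (simp add: transpose_mult[of _ d d _ d] assoc mult_carrier_mat[of _ d d _ d])
    fix v :: rvec assume "v \<in> carrier_vec d"
    thus "0 \<le> v \<bullet> (T0 *\<^sub>v v)"
      unfolding T0_def using pos by (subst diagonal_form) (auto intro!: sum_nonneg simp: less_imp_le)
  qed
  moreover have "T0 * T0 * H = 1\<^sub>m d"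
  proof -
    have "T0 * T0 * H = U * (mat_diag d (\<lambda>i. 1 / sqrt (\<mu> i)) * (mat_diag d (\<lambda>i. 1 / sqrt (\<mu> i)) * (mat_diag d \<mu> * U\<^sup>T)))"
      unfolding T0_def H_eq using U by (simp add: assoc cancel mult_carrier_mat[of _ d d _ d])
    also have "\<dots> = U * (mat_diag d (\<lambda>i. 1 / sqrt (\<mu> i) * (1 / sqrt (\<mu> i) * \<mu> i)) * U\<^sup>T)"
      using U by (simp flip: assoc(1))
    also have "mat_diag d (\<lambda>i. 1 / sqrt (\<mu> i) * (1 / sqrt (\<mu> i) * \<mu> i)) = 1\<^sub>m d"
    proof (rule eq_matI)
      have "1 / sqrt (\<mu> i) * (1 / sqrt (\<mu> i) * \<mu> i) = 1" if "i < d" for i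
        using pos[OF that] by (simp add: field_simps)
      thus "mat_diag d (\<lambda>i. 1 / sqrt (\<mu> i) * (1 / sqrt (\<mu> i) * \<mu> i)) $$ (i, j) = 1\<^sub>m d $$ (i, j)"
        if "i < dim_row (1\<^sub>m d)" "j < dim_col (1\<^sub>m d)" for i j
        using that by (simp add: mat_diag_def)
    qed (auto simp: mat_diag_def)
    finally show ?thesis using U UUt by simp
  qed
  ultimately have "psd d T \<and> T * T * H = 1\<^sub>m d"
    unfolding T_def inv_sqrt_mat_def by (intro someI[of "\<lambda>T. psd d T \<and> T * T * H = 1\<^sub>m d"]) simp
  hence T: "T \<in> carrier_mat d d" "T\<^sup>T = T" "T * T * H = 1\<^sub>m d" by (auto simp: psd_def)
  define u where "u = T *\<^sub>v (H *\<^sub>v v)"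
  have u: "u \<in> carrier_vec d" using T H v by (simp add: u_def)
  have Tu: "T *\<^sub>v u = v"
    using T H v assoc(2)[of "T * T" H v] by (simp add: u_def assoc_mult_mat_vec[of _ d d _ d])
  have sym: "(T *\<^sub>v x) \<bullet> y = x \<bullet> (T *\<^sub>v y)" if "x \<in> carrier_vec d" "y \<in> carrier_vec d" for x y
    using transpose_vec_mult_scalar[OF T(1) that(2) that(1)] T by simp
  have "v \<bullet> (S *\<^sub>v v) = u \<bullet> (T * S * T *\<^sub>v u)"
    using T S u v sym[of u "S *\<^sub>v v"] by (simp add: assoc Tu)
  also have "\<dots> \<le> op_norm d (T * S * T) * (u \<bullet> u)"
    by (rule quadratic_form_le_op_norm[OF _ u]) (use T S in simp)
  also have "u \<bullet> u = v \<bullet> (H *\<^sub>v v)"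
    using sym[of u "H *\<^sub>v v"] T H u v by (simp add: Tu flip: u_def)
  finally show ?thesis by (simp add: T_def)
qed

end

text \<open>The spectrum is listed from 1 and coordinates are numbered from 0, hence the shift
  \<open>Suc i\<close>.\<close>

lemma eigenbasis_exists:
  assumes A: "A \<in> carrier_mat d d" "A\<^sup>T = A" and spec: "has_spectrum d A l"
  shows "\<exists>U. eigenbasis d A U (\<lambda>i. l (Suc i))"
proof -
  have "char_poly A = (\<Prod>j\<in>set [1..<Suc d]. [:- l j, 1:])"
    using spec unfolding has_spectrum_def by (simp only: set_upt atLeastLessThanSuc_atLeastAtMost)
  also have "\<dots> = (\<Prod>e\<leftarrow>map l [1..<Suc d]. [:- e, 1:])"
    by (subst prod.distinct_set_conv_list) (auto simp: o_def simp del: upt_Suc)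
  finally obtain U where "U \<in> carrier_mat d d" "U\<^sup>T * U = 1\<^sub>m d"
    "U\<^sup>T * A * U = mat_diag d (\<lambda>i. map l [1..<Suc d] ! i)"
    using symmetric_orthogonal_diagonalization[OF A] by blast
  moreover have "mat_diag d (\<lambda>i. map l [1..<Suc d] ! i) = mat_diag d (\<lambda>i. l (Suc i))"
    by (rule eq_matI) (auto simp: mat_diag_def simp del: upt_Suc)
  ultimately show ?thesis using A by (intro exI[of _ U]) (simp add: eigenbasis_def)
qed

section \<open>Square-integrable functions of independent samples\<close>

text \<open>Membership in L2. Measurability is demanded separately, since it does not follow from
  that of the square.\<close>

definition square_integrable :: "'a measure \<Rightarrow> ('a \<Rightarrow> real) \<Rightarrow> bool" where
  "square_integrable M X \<longleftrightarrow> X \<in> borel_measurable M \<and> integrable M (\<lambda>x. (X x)\<^sup>2)"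

lemma square_integrable_mult:
  assumes "square_integrable M X" "square_integrable M Y"
  shows "integrable M (\<lambda>x. X x * Y x)"
proof (rule Bochner_Integration.integrable_bound[where f="\<lambda>x. (X x)\<^sup>2 + (Y x)\<^sup>2"])
  have "\<bar>a * b\<bar> \<le> a\<^sup>2 + b\<^sup>2" for a b :: real
  proof -
    have "0 \<le> (\<bar>a\<bar> - \<bar>b\<bar>)\<^sup>2" by simp
    hence "2 * (\<bar>a\<bar> * \<bar>b\<bar>) \<le> a\<^sup>2 + b\<^sup>2" by (simp add: power2_diff)
    moreover have "0 \<le> \<bar>a\<bar> * \<bar>b\<bar>" by simp
    ultimately show ?thesis unfolding abs_mult by linarith
  qed
  thus "AE x in M. norm (X x * Y x) \<le> norm ((X x)\<^sup>2 + (Y x)\<^sup>2)" by simp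
qed (use assms in \<open>auto simp: square_integrable_def\<close>)

lemma square_integrable_add:
  assumes X: "square_integrable M X" and Y: "square_integrable M Y"
  shows "square_integrable M (\<lambda>x. X x + Y x)"
  using assms square_integrable_mult[OF X Y]
  by (auto simp: square_integrable_def power2_sum mult.assoc)

lemma square_integrable_cmult:
  "square_integrable M X \<Longrightarrow> square_integrable M (\<lambda>x. c * X x)"
  by (auto simp: square_integrable_def power_mult_distrib)

lemma square_integrable_diff:
  assumes X: "square_integrable M X" and Y: "square_integrable M Y"
  shows "square_integrable M (\<lambda>x. X x - Y x)"
  using square_integrable_add[OF X square_integrable_cmult[OF Y, of "-1"]] by simp

lemma square_integrable_sum:
  "(\<And>i. i \<in> A \<Longrightarrow> square_integrable M (X i)) \<Longrightarrow> square_integrable M (\<lambda>x. \<Sum>i\<in>A. X i x)"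
  by (induction A rule: infinite_finite_induct)
     (auto intro: square_integrable_add simp: square_integrable_def[of M "\<lambda>_. 0"])

lemma (in finite_measure) square_integrable_const: "square_integrable M (\<lambda>_. c)"
  by (simp add: square_integrable_def)

lemma (in finite_measure) square_integrable_integrable:
  "square_integrable M X \<Longrightarrow> integrable M X"
  using square_integrable_mult[OF _ square_integrable_const[of 1]] by simp

lemma
  fixes f :: "nat \<Rightarrow> nat \<Rightarrow> 'a \<Rightarrow> real"
  assumes "\<And>l l'. l < n \<Longrightarrow> l' < n \<Longrightarrow> integrable M (f l l')"
  shows integral_double_sum:
      "(\<integral>x. (\<Sum>l<n. \<Sum>l'<n. c l l' * f l l' x) \<partial>M) = (\<Sum>l<n. \<Sum>l'<n. c l l' * (\<integral>x. f l l' x \<partial>M))"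
    and integrable_double_sum: "integrable M (\<lambda>x. \<Sum>l<n. \<Sum>l'<n. c l l' * f l l' x)"
proof -
  show "integrable M (\<lambda>x. \<Sum>l<n. \<Sum>l'<n. c l l' * f l l' x)"
    by (intro Bochner_Integration.integrable_sum integrable_mult_right) (auto intro: assms)
  have "(\<integral>x. (\<Sum>l<n. \<Sum>l'<n. c l l' * f l l' x) \<partial>M) = (\<Sum>l<n. \<integral>x. (\<Sum>l'<n. c l l' * f l l' x) \<partial>M)"
    by (intro Bochner_Integration.integral_sum Bochner_Integration.integrable_sum integrable_mult_right)
       (auto intro: assms)
  also have "\<dots> = (\<Sum>l<n. \<Sum>l'<n. \<integral>x. c l l' * f l l' x \<partial>M)"
    by (intro sum.cong refl Bochner_Integration.integral_sum Bochner_Integration.integrable_sum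
          integrable_mult_right) (auto intro: assms)
  finally show "(\<integral>x. (\<Sum>l<n. \<Sum>l'<n. c l l' * f l l' x) \<partial>M) = (\<Sum>l<n. \<Sum>l'<n. c l l' * (\<integral>x. f l l' x \<partial>M))"
    by simp
qed

lemma power2_sum_le: "(x + y)\<^sup>2 \<le> 2 * x\<^sup>2 + 2 * (y::real)\<^sup>2"
  using zero_le_power2[of "x - y"] by (simp add: power2_eq_square algebra_simps)

lemma power2_diff_le: "(x - y)\<^sup>2 \<le> 2 * x\<^sup>2 + 2 * (y::real)\<^sup>2"
  using power2_sum_le[of x "-y"] by simp

section \<open>Functions of disjoint groups of independent samples\<close>

locale iid_family = prob_space +
  fixes D :: "'z measure" and Z :: "'i \<Rightarrow> 'a \<Rightarrow> 'z" and I :: "'i set"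
  assumes indep: "indep_vars (\<lambda>_. D) Z I"
    and distr_Z: "p \<in> I \<Longrightarrow> distr M D (Z p) = D"
begin

lemma Z_measurable: "p \<in> I \<Longrightarrow> Z p \<in> measurable M D"
  using indep by (auto simp: indep_vars_def)

text \<open>Measurability with respect to the samples indexed by \<open>A\<close>, in factored form.
  It takes the place of a filtration: with \<open>A = {j} \<times> {..<t}\<close> it means
  dependence on the past of node \<open>j\<close> only.\<close>

definition determined :: "'i set \<Rightarrow> ('a \<Rightarrow> real) \<Rightarrow> bool" where
  "determined A X \<longleftrightarrow> (\<exists>f\<in>borel_measurable (Pi\<^sub>M A (\<lambda>_. D)).
     \<forall>\<omega>\<in>space M. X \<omega> = f (\<lambda>p\<in>A. Z p \<omega>))"

lemma determined_const [simp]: "determined A (\<lambda>_. c)"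
  unfolding determined_def by (rule bexI[of _ "\<lambda>_. c"]) auto

lemma determined_compose2:
  assumes "determined A X" "determined A Y"
    and h: "(\<lambda>z. h (fst z) (snd z)) \<in> borel_measurable (borel \<Otimes>\<^sub>M borel)"
  shows "determined A (\<lambda>\<omega>. h (X \<omega>) (Y \<omega>) :: real)"
proof -
  obtain f g where f: "f \<in> borel_measurable (Pi\<^sub>M A (\<lambda>_. D))" "\<forall>\<omega>\<in>space M. X \<omega> = f (\<lambda>p\<in>A. Z p \<omega>)"
    and g: "g \<in> borel_measurable (Pi\<^sub>M A (\<lambda>_. D))" "\<forall>\<omega>\<in>space M. Y \<omega> = g (\<lambda>p\<in>A. Z p \<omega>)"
    using assms(1,2) unfolding determined_def by blast
  have "(\<lambda>x. h (f x) (g x)) \<in> borel_measurable (Pi\<^sub>M A (\<lambda>_. D))"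
    using measurable_compose[OF measurable_Pair[OF f(1) g(1)] h] by simp
  thus ?thesis unfolding determined_def using f(2) g(2) by (intro bexI[of _ "\<lambda>x. h (f x) (g x)"]) auto
qed

lemma determined_add: "determined A X \<Longrightarrow> determined A Y \<Longrightarrow> determined A (\<lambda>\<omega>. X \<omega> + Y \<omega>)"
  and determined_diff: "determined A X \<Longrightarrow> determined A Y \<Longrightarrow> determined A (\<lambda>\<omega>. X \<omega> - Y \<omega>)"
  and determined_mult: "determined A X \<Longrightarrow> determined A Y \<Longrightarrow> determined A (\<lambda>\<omega>. X \<omega> * Y \<omega>)"
  by (rule determined_compose2; simp)+

lemma determined_sum:
  "(\<And>l. l \<in> L \<Longrightarrow> determined A (X l)) \<Longrightarrow> determined A (\<lambda>\<omega>. \<Sum>l\<in>L. X l \<omega>)"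
  by (induction L rule: infinite_finite_induct) (auto intro: determined_add)

lemma determined_sample:
  assumes "p \<in> A" "g \<in> borel_measurable D"
  shows "determined A (\<lambda>\<omega>. g (Z p \<omega>))"
  unfolding determined_def
  by (rule bexI[of _ "\<lambda>z. g (z p)"])
     (use assms in \<open>auto intro: measurable_compose[OF measurable_component_singleton]\<close>)

lemma determined_mono:
  assumes "determined A X" "A \<subseteq> B"
  shows "determined B X"
proof -
  obtain f where f: "f \<in> borel_measurable (Pi\<^sub>M A (\<lambda>_. D))" "\<forall>\<omega>\<in>space M. X \<omega> = f (\<lambda>p\<in>A. Z p \<omega>)"
    using assms(1) unfolding determined_def by blast
  have "(\<lambda>z. f (restrict z A)) \<in> borel_measurable (Pi\<^sub>M B (\<lambda>_. D))"
    by (rule measurable_compose[OF measurable_restrict_subset[OF assms(2)] f(1)])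
  moreover have "restrict (restrict z B) A = restrict z A" for z :: "'i \<Rightarrow> 'z"
    using assms(2) by (simp add: Int_absorb1)
  ultimately show ?thesis unfolding determined_def
    using f(2) by (intro bexI[of _ "\<lambda>z. f (restrict z A)"]) auto
qed

text \<open>Disjoint groups of independent samples are independent as families. This is used twice:
  for the past of a node against its current sample, and for two different nodes.\<close>

lemma determined_indep:
  assumes "determined A X" "determined B Y" "A \<inter> B = {}" "A \<subseteq> I" "B \<subseteq> I"
    and "integrable M X" "integrable M Y"
  shows "integrable M (\<lambda>\<omega>. X \<omega> * Y \<omega>)"
    and "expectation (\<lambda>\<omega>. X \<omega> * Y \<omega>) = expectation X * expectation Y"
proof -
  obtain f where f: "f \<in> borel_measurable (Pi\<^sub>M A (\<lambda>_. D))" "\<forall>\<omega>\<in>space M. X \<omega> = f (\<lambda>p\<in>A. Z p \<omega>)"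
    using assms(1) unfolding determined_def by blast
  obtain g where g: "g \<in> borel_measurable (Pi\<^sub>M B (\<lambda>_. D))" "\<forall>\<omega>\<in>space M. Y \<omega> = g (\<lambda>p\<in>B. Z p \<omega>)"
    using assms(2) unfolding determined_def by blast
  \<comment> \<open>\<open>X\<close> and \<open>Y\<close> agree with these compositions only on
    \<open>space M\<close>, so independence is obtained for the compositions and then
    transferred.\<close>
  define X' Y' where "X' = f \<circ> (\<lambda>\<omega>. \<lambda>p\<in>A. Z p \<omega>)" and "Y' = g \<circ> (\<lambda>\<omega>. \<lambda>p\<in>B. Z p \<omega>)"
  have iv: "indep_var borel X' borel Y'"
    unfolding X'_def Y'_def
    using indep_var_compose[OF indep_var_restrict[OF indep assms(3-5)] f(1) g(1)] .
  have eqX: "\<omega> \<in> space M \<Longrightarrow> X' \<omega> = X \<omega>" and eqY: "\<omega> \<in> space M \<Longrightarrow> Y' \<omega> = Y \<omega>" for \<omega>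
    using f(2) g(2) by (auto simp: X'_def Y'_def)
  have "integrable M X'" "integrable M Y'"
    using assms(6,7) eqX eqY by (simp_all cong: Bochner_Integration.integrable_cong)
  from indep_var_integrable[OF iv this] indep_var_lebesgue_integral[OF iv this]
  show "integrable M (\<lambda>\<omega>. X \<omega> * Y \<omega>)"
    and "expectation (\<lambda>\<omega>. X \<omega> * Y \<omega>) = expectation X * expectation Y"
    using eqX eqY
    by (simp_all cong: Bochner_Integration.integrable_cong Bochner_Integration.integral_cong)
qed

lemma sample_integrable:
  assumes "p \<in> I" "integrable D g"
  shows "integrable M (\<lambda>\<omega>. g (Z p \<omega>) :: real)"
  using assms integrable_distr[OF Z_measurable[OF assms(1)], of g] by (simp add: distr_Z)

lemma sample_expectation:
  assumes "p \<in> I" "g \<in> borel_measurable D"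
  shows "expectation (\<lambda>\<omega>. g (Z p \<omega>) :: real) = (\<integral>z. g z \<partial>D)"
  using assms integral_distr[OF Z_measurable[OF assms(1)], of g] by (simp add: distr_Z)

end

section \<open>Stochastic gradient descent in an eigenbasis\<close>

text \<open>\<open>u i\<close> stands for the \<open>i\<close>-th eigen-coordinate of x,
  \<open>\<xi>\<close> for the residual y - <w*,x>, \<open>a0\<close> for the initial error and
  \<open>s\<close> for the noise level. \<open>\<xi>u_mean\<close> is the first-order optimality of
  w*, and \<open>fourth_moment_u\<close> is the operator bound for a rank-one A, tested on one
  eigenvector.\<close>

locale sgd_coordinates =
  iid_family M D Z "{..<m} \<times> {..<k}"
  for M :: "'a measure" and D :: "'z measure" and Z :: "nat \<times> nat \<Rightarrow> 'a \<Rightarrow> 'z"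
    and m k :: nat +
  fixes d :: nat and u :: "nat \<Rightarrow> 'z \<Rightarrow> real" and \<xi> :: "'z \<Rightarrow> real"
    and \<mu> a0 :: "nat \<Rightarrow> real" and \<gamma> \<tau> s :: real
  assumes prob_D: "prob_space D"
    and u_measurable [measurable]: "\<And>i. i < d \<Longrightarrow> u i \<in> borel_measurable D"
    and \<xi>_measurable [measurable]: "\<xi> \<in> borel_measurable D"
    and u4_integrable: "\<And>i. i < d \<Longrightarrow> integrable D (\<lambda>z. u i z ^ 4)"
    and \<xi>u2_integrable: "\<And>i. i < d \<Longrightarrow> integrable D (\<lambda>z. (\<xi> z * u i z)\<^sup>2)"
    and second_moment_u: "\<And>i j. i < d \<Longrightarrow> j < d \<Longrightarrow>
          (\<integral>z. u i z * u j z \<partial>D) = (if i = j then \<mu> i else 0)"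
    and \<xi>u_mean: "\<And>i. i < d \<Longrightarrow> (\<integral>z. \<xi> z * u i z \<partial>D) = 0"
    and \<xi>u_second_moment: "\<And>i. i < d \<Longrightarrow> (\<integral>z. (\<xi> z * u i z)\<^sup>2 \<partial>D) \<le> s * \<mu> i"
    and fourth_moment_u: "\<And>\<alpha> i. i < d \<Longrightarrow>
          (\<integral>z. ((\<Sum>l<d. \<alpha> l * u l z) * u i z)\<^sup>2 \<partial>D) \<le> \<tau> * (\<Sum>l<d. \<mu> l * (\<alpha> l)\<^sup>2) * \<mu> i"
    and \<mu>_pos: "\<And>i. i < d \<Longrightarrow> 0 < \<mu> i"
    and \<gamma>_pos: "0 < \<gamma>" and \<tau>_pos: "0 < \<tau>"
    and stepsize: "\<gamma> * \<tau> * (\<Sum>i<d. \<mu> i) < 1"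
begin

lemma \<mu>_nonneg: "i < d \<Longrightarrow> 0 \<le> \<mu> i"
  using \<mu>_pos by force

lemma u_square_integrable:
  assumes "i < d" "l < d"
  shows "square_integrable D (\<lambda>z. u i z * u l z)"
proof -
  have 1: "square_integrable D (\<lambda>z. (u i z)\<^sup>2)" if "i < d" for i
    using that u4_integrable[OF that] by (simp add: square_integrable_def flip: power_mult)
  show ?thesis
    using square_integrable_mult[OF 1 1, OF assms] assms
    by (simp add: square_integrable_def power_mult_distrib)
qed

lemma \<xi>u_square_integrable: "i < d \<Longrightarrow> square_integrable D (\<lambda>z. \<xi> z * u i z)"
  using \<xi>u2_integrable by (simp add: square_integrable_def)

text \<open>The stepsize condition contains \<open>\<tau>\<close>, so \<open>1 \<le> \<tau>\<close>
  is what is missing. Nonnegativity of the variance of the squared coordinate and the fourth moment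
  bound squeeze it out: the square of \<open>\<mu> i\<close> is at most \<open>\<tau>\<close> times
  itself.\<close>

lemma \<gamma>\<mu>_le_1:
  assumes i: "i < d"
  shows "\<gamma> * \<mu> i \<le> 1"
proof -
  interpret D: prob_space D by (rule prob_D)
  have sq: "square_integrable D (\<lambda>z. u i z * u i z)" by (rule u_square_integrable[OF i i])
  have int: "integrable D (\<lambda>z. u i z * u i z)" by (rule D.square_integrable_integrable[OF sq])
  have "0 \<le> D.variance (\<lambda>z. u i z * u i z)" by (rule Bochner_Integration.integral_nonneg) simp
  also have "\<dots> = (\<integral>z. (u i z * u i z)\<^sup>2 \<partial>D) - (\<mu> i)\<^sup>2"
    using sq int second_moment_u[OF i i] by (subst D.variance_eq) (auto simp: square_integrable_def)
  finally have "(\<mu> i)\<^sup>2 \<le> (\<integral>z. (u i z * u i z)\<^sup>2 \<partial>D)" by simp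
  also have "\<dots> \<le> \<tau> * \<mu> i * \<mu> i"
    using fourth_moment_u[OF i, of "\<lambda>l. if l = i then 1 else 0"] i
    by (simp add: if_distrib if_distribR cong: if_cong)
  finally have "\<mu> i * \<mu> i \<le> \<tau> * (\<mu> i * \<mu> i)" by (simp add: power2_eq_square mult.assoc)
  hence \<tau>: "1 \<le> \<tau>" using \<mu>_pos[OF i] by simp
  have "\<gamma> * \<mu> i \<le> \<gamma> * (\<Sum>i<d. \<mu> i)"
    using \<gamma>_pos i \<mu>_nonneg by (intro mult_left_mono member_le_sum) auto
  also have "\<dots> \<le> \<gamma> * (\<Sum>i<d. \<mu> i) * \<tau>"
    using mult_left_mono[OF \<tau>, of "\<gamma> * (\<Sum>i<d. \<mu> i)"]
      mult_nonneg_nonneg[of \<gamma> "\<Sum>i<d. \<mu> i"] \<gamma>_pos sum_nonneg[of "{..<d}" \<mu>] \<mu>_nonneg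
    by (auto simp del: mult_le_cancel_left_pos mult_le_cancel_left1)
  finally show ?thesis using stepsize by (simp add: mult.assoc mult.left_commute mult.commute)
qed

text \<open>
  \<open>err j t \<omega> i\<close> is the \<open>i\<close>-th coordinate, in an eigenbasis of \<open>H\<close>, of the error \<open>w - w\<^sup>*\<close> of
  node \<open>j\<close> after \<open>t\<close> steps, and \<open>grad j t \<omega> i\<close> that of the stochastic gradient there.
\<close>

primrec err :: "nat \<Rightarrow> nat \<Rightarrow> 'a \<Rightarrow> nat \<Rightarrow> real" where
  "err j 0 \<omega> i = a0 i"
| "err j (Suc t) \<omega> i =
     err j t \<omega> i - \<gamma> * (((\<Sum>l<d. err j t \<omega> l * u l (Z (j, t) \<omega>)) - \<xi> (Z (j, t) \<omega>)) * u i (Z (j, t) \<omega>))"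

definition grad :: "nat \<Rightarrow> nat \<Rightarrow> 'a \<Rightarrow> nat \<Rightarrow> real" where
  "grad j t \<omega> i =
     ((\<Sum>l<d. err j t \<omega> l * u l (Z (j, t) \<omega>)) - \<xi> (Z (j, t) \<omega>)) * u i (Z (j, t) \<omega>)"

lemma err_Suc: "err j (Suc t) \<omega> i = err j t \<omega> i - \<gamma> * grad j t \<omega> i"
  by (simp add: grad_def)

text \<open>Written as past coefficients times functions of the current sample, so that independence
  applies term by term.\<close>

lemma grad_eq:
  "grad j t \<omega> i = (\<Sum>l<d. err j t \<omega> l * (u l (Z (j, t) \<omega>) * u i (Z (j, t) \<omega>)))
     - \<xi> (Z (j, t) \<omega>) * u i (Z (j, t) \<omega>)"
  by (simp add: grad_def left_diff_distrib sum_distrib_right mult.assoc)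

text \<open>The error after \<open>t\<close> steps has used the samples before \<open>t\<close>; the
  gradient taken there also uses sample \<open>t\<close>, hence \<open>Suc t\<close>.\<close>

lemma determined_err_grad:
  assumes "i < d"
  shows "determined ({j} \<times> {..<t}) (\<lambda>\<omega>. err j t \<omega> i)"
    and "determined ({j} \<times> {..<Suc t}) (\<lambda>\<omega>. grad j t \<omega> i)"
proof -
  have step: "determined ({j} \<times> {..<Suc t}) (\<lambda>\<omega>. grad j t \<omega> i)"
    if "\<And>l. l < d \<Longrightarrow> determined ({j} \<times> {..<t}) (\<lambda>\<omega>. err j t \<omega> l)" "i < d" for t i
  proof -
    have "determined ({j} \<times> {..<Suc t}) (\<lambda>\<omega>. err j t \<omega> l)" if "l < d" for l
      by (rule determined_mono[OF \<open>\<And>l. l < d \<Longrightarrow> determined ({j} \<times> {..<t}) (\<lambda>\<omega>. err j t \<omega> l)\<close>])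
         (use that in auto)
    thus ?thesis unfolding grad_def using that(2)
      by (intro determined_mult determined_diff determined_sum
            determined_sample[of "(j, t)" _ "u _"] determined_sample[of "(j, t)" _ "\<xi>"]) auto
  qed
  have err: "determined ({j} \<times> {..<t}) (\<lambda>\<omega>. err j t \<omega> i)" if "i < d" for t i
    using that
  proof (induction t arbitrary: i)
    case (Suc t)
    have "determined ({j} \<times> {..<Suc t}) (\<lambda>\<omega>. err j t \<omega> i)"
      by (rule determined_mono[OF Suc.IH[OF Suc.prems]]) auto
    thus ?case unfolding err_Suc
      by (intro determined_diff determined_mult step) (use Suc in auto)
  qed simp
  show "determined ({j} \<times> {..<t}) (\<lambda>\<omega>. err j t \<omega> i)"
    and "determined ({j} \<times> {..<Suc t}) (\<lambda>\<omega>. grad j t \<omega> i)"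
    using err step assms by auto
qed

context
  fixes j t :: nat
  assumes j: "j < m" and t: "t < k"
begin

text \<open>Stands in for conditioning on the past: the current sample is independent of everything
  the node has seen.\<close>

lemma past_indep_sample:
  assumes X: "determined ({j} \<times> {..<t}) X" "integrable M X" and g: "integrable D g"
  shows "integrable M (\<lambda>\<omega>. X \<omega> * g (Z (j, t) \<omega>))"
    and "expectation (\<lambda>\<omega>. X \<omega> * g (Z (j, t) \<omega>)) = expectation X * (\<integral>z. g z \<partial>D)"
proof -
  have p: "(j, t) \<in> {..<m} \<times> {..<k}" using j t by auto
  have sub: "{j} \<times> {..<t} \<subseteq> {..<m} \<times> {..<k}" using j t by auto
  note * = determined_indep[OF X(1) determined_sample[of "(j, t)" "{(j, t)}" g] _ sub _ X(2)
      sample_integrable[OF p g]]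
  show "integrable M (\<lambda>\<omega>. X \<omega> * g (Z (j, t) \<omega>))"
    using *(1) g p by auto
  show "expectation (\<lambda>\<omega>. X \<omega> * g (Z (j, t) \<omega>)) = expectation X * (\<integral>z. g z \<partial>D)"
    using *(2) g p by (auto simp: sample_expectation)
qed

text \<open>In general a product of L2 functions is only integrable; independence keeps it in L2.
  Thus fourth moments are asked of the data but never of the iterates.\<close>

lemma square_integrable_past_times_sample:
  assumes X: "determined ({j} \<times> {..<t}) X" "square_integrable M X" and g: "square_integrable D g"
  shows "square_integrable M (\<lambda>\<omega>. X \<omega> * g (Z (j, t) \<omega>))"
proof -
  have p: "(j, t) \<in> {..<m} \<times> {..<k}" using j t by auto
  have "determined ({j} \<times> {..<t}) (\<lambda>\<omega>. (X \<omega>)\<^sup>2)"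
    using determined_mult[OF X(1) X(1)] by (simp add: power2_eq_square)
  from past_indep_sample(1)[OF this, of "\<lambda>z. (g z)\<^sup>2"]
  show ?thesis
    using X(2) g measurable_compose[OF Z_measurable[OF p], of g borel]
    by (auto simp: square_integrable_def power_mult_distrib)
qed

lemma square_integrable_\<xi>u_sample:
  assumes "i < d"
  shows "square_integrable M (\<lambda>\<omega>. \<xi> (Z (j, t) \<omega>) * u i (Z (j, t) \<omega>))"
  using square_integrable_past_times_sample[of "\<lambda>_. 1", OF _ _ \<xi>u_square_integrable[OF assms]]
    square_integrable_const[of 1]
  by simp

lemma square_integrable_grad:
  assumes "\<And>l. l < d \<Longrightarrow> square_integrable M (\<lambda>\<omega>. err j t \<omega> l)" "i < d"
  shows "square_integrable M (\<lambda>\<omega>. grad j t \<omega> i)"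
  unfolding grad_eq
  by (intro square_integrable_diff square_integrable_sum square_integrable_\<xi>u_sample
        square_integrable_past_times_sample determined_err_grad u_square_integrable)
     (use assms in auto)

end

lemma square_integrable_err:
  assumes j: "j < m" and "t \<le> k" "i < d"
  shows "square_integrable M (\<lambda>\<omega>. err j t \<omega> i)"
  using assms(2,3)
proof (induction t arbitrary: i)
  case (Suc t)
  show ?case unfolding err_Suc
    by (intro square_integrable_diff square_integrable_cmult square_integrable_grad)
       (use Suc j in auto)
qed (simp add: square_integrable_const)

text \<open>The overview's q_t, expanded in the eigenbasis.\<close>

definition energy :: "nat \<Rightarrow> nat \<Rightarrow> real" where
  "energy j t = (\<Sum>i<d. \<mu> i * expectation (\<lambda>\<omega>. (err j t \<omega> i)\<^sup>2))"

context
  fixes j t :: nat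
  assumes j: "j < m" and t: "t < k"
begin

lemma square_integrable_err_grad:
  assumes "i < d"
  shows "square_integrable M (\<lambda>\<omega>. err j t \<omega> i)" "square_integrable M (\<lambda>\<omega>. grad j t \<omega> i)"
  by (intro square_integrable_err square_integrable_grad; use assms j t in simp)+

text \<open>Given the past, the gradient has mean \<open>\<mu> i\<close> times the error coordinate:
  distinct eigen-coordinates of x are uncorrelated, and the residual is uncorrelated with each of
  them.\<close>

lemma expectation_past_mult_grad:
  assumes X: "determined ({j} \<times> {..<t}) X" "square_integrable M X" and i: "i < d"
  shows "expectation (\<lambda>\<omega>. X \<omega> * grad j t \<omega> i) = \<mu> i * expectation (\<lambda>\<omega>. X \<omega> * err j t \<omega> i)"
proof -
  interpret D: prob_space D by (rule prob_D)
  let ?u = "\<lambda>l \<omega>. u l (Z (j, t) \<omega>)"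
  have XE: "determined ({j} \<times> {..<t}) (\<lambda>\<omega>. X \<omega> * err j t \<omega> l)"
    "integrable M (\<lambda>\<omega>. X \<omega> * err j t \<omega> l)" if "l < d" for l
    using determined_mult[OF X(1) determined_err_grad(1)[OF that]]
      square_integrable_mult[OF X(2) square_integrable_err_grad(1)[OF that]] by auto
  note u_int = D.square_integrable_integrable[OF u_square_integrable]
  note \<xi>_int = D.square_integrable_integrable[OF \<xi>u_square_integrable]
  have 1: "integrable M (\<lambda>\<omega>. X \<omega> * err j t \<omega> l * (?u l \<omega> * ?u i \<omega>))"
    "expectation (\<lambda>\<omega>. X \<omega> * err j t \<omega> l * (?u l \<omega> * ?u i \<omega>)) =
       expectation (\<lambda>\<omega>. X \<omega> * err j t \<omega> l) * (\<integral>z. u l z * u i z \<partial>D)" if "l < d" for l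
    using past_indep_sample[OF j t XE[OF that] u_int[OF that i]] .
  note 2 = past_indep_sample[OF j t X(1) square_integrable_integrable[OF X(2)] \<xi>_int[OF i]]
  have eq: "X \<omega> * grad j t \<omega> i = (\<Sum>l<d. X \<omega> * err j t \<omega> l * (?u l \<omega> * ?u i \<omega>))
      - X \<omega> * (\<xi> (Z (j, t) \<omega>) * ?u i \<omega>)" for \<omega>
    by (simp add: grad_eq right_diff_distrib sum_distrib_left mult.assoc)
  have "expectation (\<lambda>\<omega>. X \<omega> * grad j t \<omega> i) =
      (\<Sum>l<d. expectation (\<lambda>\<omega>. X \<omega> * err j t \<omega> l) * (\<integral>z. u l z * u i z \<partial>D))
        - expectation X * (\<integral>z. \<xi> z * u i z \<partial>D)"
    by (simp only: eq,
        subst Bochner_Integration.integral_diff, force intro!: 1, force intro!: 2,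
        subst Bochner_Integration.integral_sum, force intro!: 1)
       (simp add: 1 2)
  also have "\<dots> = (\<Sum>l<d. if l = i then \<mu> i * expectation (\<lambda>\<omega>. X \<omega> * err j t \<omega> i) else 0)"
    unfolding \<xi>u_mean[OF i] mult_zero_right diff_zero
    by (rule sum.cong[OF refl]) (use i in \<open>auto simp: second_moment_u\<close>)
  finally show ?thesis using i by simp
qed

text \<open>The gradient is split into the part linear in the error and the part from the residual;
  their correlation is not evaluated but absorbed by the factor 2.\<close>

lemma grad_second_moment:
  assumes i: "i < d"
  shows "expectation (\<lambda>\<omega>. (grad j t \<omega> i)\<^sup>2) \<le> 2 * \<mu> i * (\<tau> * energy j t + s)"
proof -
  interpret D: prob_space D by (rule prob_D)
  let ?u = "\<lambda>l \<omega>. u l (Z (j, t) \<omega>)" and ?e = "err j t"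
  have p: "(j, t) \<in> {..<m} \<times> {..<k}" using j t by auto
  \<comment> \<open>Fourth moments of one sample. Integrating the sample out first leaves a
    deterministic quadratic form in the past error, to which \<open>fourth_moment_u\<close> applies
    for every outcome with the error as coefficient vector.\<close>
  define C where "C l l' = (\<integral>z. (u l z * u i z) * (u l' z * u i z) \<partial>D)" for l l'
  have C_int: "integrable D (\<lambda>z. (u l z * u i z) * (u l' z * u i z))" if "l < d" "l' < d" for l l'
    using that i by (intro square_integrable_mult u_square_integrable)
  have sq_eq: "((\<Sum>l<d. \<alpha> l * v l) * c)\<^sup>2 = (\<Sum>l<d. \<Sum>l'<d. \<alpha> l * \<alpha> l' * ((v l * c) * (v l' * c)))"
    for \<alpha> v :: "nat \<Rightarrow> real" and c
  proof -
    have "((\<Sum>l<d. \<alpha> l * v l) * c)\<^sup>2 = (\<Sum>l<d. (\<alpha> l * v l) * c) * (\<Sum>l<d. (\<alpha> l * v l) * c)"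
      by (simp add: power2_eq_square sum_distrib_right)
    also have "\<dots> = (\<Sum>l<d. \<Sum>l'<d. ((\<alpha> l * v l) * c) * ((\<alpha> l' * v l') * c))"
      by (rule sum_product)
    finally show ?thesis by (simp add: ac_simps)
  qed
  have C_le: "(\<Sum>l<d. \<Sum>l'<d. \<alpha> l * \<alpha> l' * C l l') \<le> \<tau> * \<mu> i * (\<Sum>l<d. \<mu> l * (\<alpha> l)\<^sup>2)" for \<alpha>
  proof -
    have "(\<integral>z. ((\<Sum>l<d. \<alpha> l * u l z) * u i z)\<^sup>2 \<partial>D) = (\<Sum>l<d. \<Sum>l'<d. \<alpha> l * \<alpha> l' * C l l')"
      unfolding sq_eq C_def by (rule integral_double_sum) (rule C_int)
    thus ?thesis using fourth_moment_u[OF i, of \<alpha>] by (simp add: ac_simps)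
  qed
  have ee: "determined ({j} \<times> {..<t}) (\<lambda>\<omega>. ?e \<omega> l * ?e \<omega> l')" "integrable M (\<lambda>\<omega>. ?e \<omega> l * ?e \<omega> l')"
    if "l < d" "l' < d" for l l'
    using that by (auto intro: determined_mult determined_err_grad square_integrable_mult
        square_integrable_err_grad)
  have eC: "integrable M (\<lambda>\<omega>. ?e \<omega> l * ?e \<omega> l' * ((?u l \<omega> * ?u i \<omega>) * (?u l' \<omega> * ?u i \<omega>)))"
    "expectation (\<lambda>\<omega>. ?e \<omega> l * ?e \<omega> l' * ((?u l \<omega> * ?u i \<omega>) * (?u l' \<omega> * ?u i \<omega>)))
       = C l l' * expectation (\<lambda>\<omega>. ?e \<omega> l * ?e \<omega> l')" if "l < d" "l' < d" for l l'
    using past_indep_sample[OF j t ee[OF that] C_int[OF that]] by (simp_all add: C_def)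
  have S_sq: "square_integrable M (\<lambda>\<omega>. (\<Sum>l<d. ?e \<omega> l * ?u l \<omega>) * ?u i \<omega>)"
  proof -
    have "(\<lambda>\<omega>. (\<Sum>l<d. ?e \<omega> l * ?u l \<omega>) * ?u i \<omega>) = (\<lambda>\<omega>. grad j t \<omega> i + \<xi> (Z (j, t) \<omega>) * ?u i \<omega>)"
      by (simp add: grad_def algebra_simps)
    thus ?thesis
      using square_integrable_add[OF square_integrable_err_grad(2)[OF i] square_integrable_\<xi>u_sample[OF j t i]]
      by simp
  qed
  have N_sq: "square_integrable M (\<lambda>\<omega>. \<xi> (Z (j, t) \<omega>) * ?u i \<omega>)"
    by (rule square_integrable_\<xi>u_sample[OF j t i])
  have "expectation (\<lambda>\<omega>. ((\<Sum>l<d. ?e \<omega> l * ?u l \<omega>) * ?u i \<omega>)\<^sup>2)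
      = (\<Sum>l<d. \<Sum>l'<d. C l l' * expectation (\<lambda>\<omega>. ?e \<omega> l * ?e \<omega> l'))"
    unfolding sq_eq using integral_double_sum[OF eC(1), where c="\<lambda>_ _. 1"] eC(2) by simp
  also have "\<dots> = expectation (\<lambda>\<omega>. \<Sum>l<d. \<Sum>l'<d. C l l' * (?e \<omega> l * ?e \<omega> l'))"
    by (rule integral_double_sum[symmetric]) (rule ee(2))
  also have "\<dots> \<le> expectation (\<lambda>\<omega>. \<tau> * \<mu> i * (\<Sum>l<d. \<mu> l * (?e \<omega> l)\<^sup>2))"
  proof (rule integral_mono)
    show "integrable M (\<lambda>\<omega>. \<Sum>l<d. \<Sum>l'<d. C l l' * (?e \<omega> l * ?e \<omega> l'))"
      by (rule integrable_double_sum) (rule ee(2))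
    show "integrable M (\<lambda>\<omega>. \<tau> * \<mu> i * (\<Sum>l<d. \<mu> l * (?e \<omega> l)\<^sup>2))"
      by (intro integrable_mult_right Bochner_Integration.integrable_sum)
         (use ee(2) in \<open>auto simp: power2_eq_square\<close>)
    show "(\<Sum>l<d. \<Sum>l'<d. C l l' * (?e \<omega> l * ?e \<omega> l')) \<le> \<tau> * \<mu> i * (\<Sum>l<d. \<mu> l * (?e \<omega> l)\<^sup>2)" for \<omega>
      using C_le[of "?e \<omega>"] by (simp add: mult.commute)
  qed
  also have "\<dots> = \<tau> * \<mu> i * energy j t"
    unfolding energy_def
    by (subst Bochner_Integration.integral_mult_right, force intro!: Bochner_Integration.integrable_sum
          integrable_mult_right ee(2) simp: power2_eq_square,
        subst Bochner_Integration.integral_sum) (auto intro!: ee(2) simp: power2_eq_square)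
  finally have S: "expectation (\<lambda>\<omega>. ((\<Sum>l<d. ?e \<omega> l * ?u l \<omega>) * ?u i \<omega>)\<^sup>2) \<le> \<tau> * \<mu> i * energy j t" .
  have N: "expectation (\<lambda>\<omega>. (\<xi> (Z (j, t) \<omega>) * ?u i \<omega>)\<^sup>2) \<le> s * \<mu> i"
    using sample_expectation[OF p, of "\<lambda>z. (\<xi> z * u i z)\<^sup>2"] \<xi>u_second_moment[OF i] i by simp
  have "expectation (\<lambda>\<omega>. (grad j t \<omega> i)\<^sup>2)
      \<le> expectation (\<lambda>\<omega>. 2 * ((\<Sum>l<d. ?e \<omega> l * ?u l \<omega>) * ?u i \<omega>)\<^sup>2 + 2 * (\<xi> (Z (j, t) \<omega>) * ?u i \<omega>)\<^sup>2)"
  proof (rule integral_mono)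
    show "integrable M (\<lambda>\<omega>. (grad j t \<omega> i)\<^sup>2)"
      using square_integrable_err_grad(2)[OF i] by (simp add: square_integrable_def)
    show "integrable M (\<lambda>\<omega>. 2 * ((\<Sum>l<d. ?e \<omega> l * ?u l \<omega>) * ?u i \<omega>)\<^sup>2 + 2 * (\<xi> (Z (j, t) \<omega>) * ?u i \<omega>)\<^sup>2)"
      using S_sq N_sq by (simp add: square_integrable_def)
    show "(grad j t \<omega> i)\<^sup>2 \<le> 2 * ((\<Sum>l<d. ?e \<omega> l * ?u l \<omega>) * ?u i \<omega>)\<^sup>2 + 2 * (\<xi> (Z (j, t) \<omega>) * ?u i \<omega>)\<^sup>2" for \<omega>
      unfolding grad_def left_diff_distrib by (rule power2_diff_le)
  qed
  also have "\<dots> = 2 * expectation (\<lambda>\<omega>. ((\<Sum>l<d. ?e \<omega> l * ?u l \<omega>) * ?u i \<omega>)\<^sup>2)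
      + 2 * expectation (\<lambda>\<omega>. (\<xi> (Z (j, t) \<omega>) * ?u i \<omega>)\<^sup>2)"
    using S_sq N_sq by (simp add: square_integrable_def)
  finally show ?thesis using S N by (simp add: algebra_simps)
qed

end

section \<open>Bounding the accumulated energy\<close>

text \<open>Expanding the squared step, the mixed term yields
  \<open>- 2 * \<gamma> * energy j t\<close>, and summing \<open>grad_second_moment\<close> over the
  coordinates turns the factors \<open>\<mu> i\<close> into the trace.\<close>

lemma energy_decrease:
  assumes j: "j < m" and t: "t < k"
  shows "(\<Sum>i<d. expectation (\<lambda>\<omega>. (err j (Suc t) \<omega> i)\<^sup>2)) \<le>
     (\<Sum>i<d. expectation (\<lambda>\<omega>. (err j t \<omega> i)\<^sup>2))
       - 2 * \<gamma> * (1 - \<gamma> * \<tau> * (\<Sum>i<d. \<mu> i)) * energy j t + 2 * \<gamma>\<^sup>2 * s * (\<Sum>i<d. \<mu> i)"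
proof -
  have "expectation (\<lambda>\<omega>. (err j (Suc t) \<omega> i)\<^sup>2) \<le> expectation (\<lambda>\<omega>. (err j t \<omega> i)\<^sup>2)
      - 2 * \<gamma> * (\<mu> i * expectation (\<lambda>\<omega>. (err j t \<omega> i)\<^sup>2)) + 2 * \<gamma>\<^sup>2 * (\<tau> * energy j t + s) * \<mu> i"
    if i: "i < d" for i
  proof -
    note sq = square_integrable_err_grad[OF j t i]
    have "expectation (\<lambda>\<omega>. (err j (Suc t) \<omega> i)\<^sup>2) = expectation (\<lambda>\<omega>. (err j t \<omega> i)\<^sup>2
        - 2 * \<gamma> * (err j t \<omega> i * grad j t \<omega> i) + \<gamma>\<^sup>2 * (grad j t \<omega> i)\<^sup>2)"
      unfolding err_Suc by (simp add: power2_eq_square algebra_simps)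
    also have "\<dots> = expectation (\<lambda>\<omega>. (err j t \<omega> i)\<^sup>2)
        - 2 * \<gamma> * expectation (\<lambda>\<omega>. err j t \<omega> i * grad j t \<omega> i) + \<gamma>\<^sup>2 * expectation (\<lambda>\<omega>. (grad j t \<omega> i)\<^sup>2)"
      using sq square_integrable_mult[OF sq] by (simp add: square_integrable_def)
    also have "expectation (\<lambda>\<omega>. err j t \<omega> i * grad j t \<omega> i) = \<mu> i * expectation (\<lambda>\<omega>. (err j t \<omega> i)\<^sup>2)"
      by (simp add: expectation_past_mult_grad[OF j t determined_err_grad(1)[OF i] sq(1) i] power2_eq_square)
    also have "\<gamma>\<^sup>2 * expectation (\<lambda>\<omega>. (grad j t \<omega> i)\<^sup>2) \<le> \<gamma>\<^sup>2 * (2 * \<mu> i * (\<tau> * energy j t + s))"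
      by (intro mult_left_mono grad_second_moment[OF j t i]) simp
    finally show ?thesis by (simp add: algebra_simps)
  qed
  hence "(\<Sum>i<d. expectation (\<lambda>\<omega>. (err j (Suc t) \<omega> i)\<^sup>2)) \<le> (\<Sum>i<d. expectation (\<lambda>\<omega>. (err j t \<omega> i)\<^sup>2)
      - 2 * \<gamma> * (\<mu> i * expectation (\<lambda>\<omega>. (err j t \<omega> i)\<^sup>2)) + 2 * \<gamma>\<^sup>2 * (\<tau> * energy j t + s) * \<mu> i)"
    by (intro sum_mono) auto
  also have "\<dots> = (\<Sum>i<d. expectation (\<lambda>\<omega>. (err j t \<omega> i)\<^sup>2))
      - 2 * \<gamma> * energy j t + 2 * \<gamma>\<^sup>2 * (\<tau> * energy j t + s) * (\<Sum>i<d. \<mu> i)"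
    by (simp add: sum.distrib sum_subtractf energy_def flip: sum_distrib_left)
  finally show ?thesis by (simp add: algebra_simps power2_eq_square)
qed

text \<open>The one-step inequality telescopes; the final squared error is carried through the
  induction and then dropped.\<close>

lemma sum_energy_le:
  assumes j: "j < m" and n: "n \<le> k"
  shows "2 * \<gamma> * (1 - \<gamma> * \<tau> * (\<Sum>i<d. \<mu> i)) * (\<Sum>t<n. energy j t)
     \<le> (\<Sum>i<d. (a0 i)\<^sup>2) + 2 * \<gamma>\<^sup>2 * s * (\<Sum>i<d. \<mu> i) * real n"
proof -
  have "(\<Sum>i<d. expectation (\<lambda>\<omega>. (err j n \<omega> i)\<^sup>2)) +
     2 * \<gamma> * (1 - \<gamma> * \<tau> * (\<Sum>i<d. \<mu> i)) * (\<Sum>t<n. energy j t)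
     \<le> (\<Sum>i<d. (a0 i)\<^sup>2) + 2 * \<gamma>\<^sup>2 * s * (\<Sum>i<d. \<mu> i) * real n"
    using n
  proof (induction n)
    case 0
    show ?case by (simp add: prob_space)
  next
    case (Suc n)
    show ?case using Suc.IH energy_decrease[OF j, of n] Suc.prems by (simp add: algebra_simps)
  qed
  moreover have "0 \<le> (\<Sum>i<d. expectation (\<lambda>\<omega>. (err j n \<omega> i)\<^sup>2))"
    by (intro sum_nonneg Bochner_Integration.integral_nonneg) auto
  ultimately show ?thesis by linarith
qed

section \<open>Martingale deviations from the mean trajectory\<close>

text \<open>The martingale difference of the recursion: conditional mean of the gradient minus the
  gradient.\<close>

definition noise :: "nat \<Rightarrow> nat \<Rightarrow> 'a \<Rightarrow> nat \<Rightarrow> real" where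
  "noise j t \<omega> i = \<mu> i * err j t \<omega> i - grad j t \<omega> i"

text \<open>The subtracted term is the noise-free trajectory, which is also the mean of the error
  (\<open>expectation_deviation\<close>).\<close>

definition deviation :: "nat \<Rightarrow> nat \<Rightarrow> 'a \<Rightarrow> nat \<Rightarrow> real" where
  "deviation j t \<omega> i = err j t \<omega> i - (1 - \<gamma> * \<mu> i) ^ t * a0 i"

lemma deviation_0: "deviation j 0 \<omega> i = 0"
  by (simp add: deviation_def)

lemma deviation_Suc:
  "deviation j (Suc t) \<omega> i = (1 - \<gamma> * \<mu> i) * deviation j t \<omega> i + \<gamma> * noise j t \<omega> i"
  unfolding deviation_def noise_def err_Suc by (simp add: algebra_simps)

lemma determined_noise_deviation:
  assumes "i < d"
  shows "determined ({j} \<times> {..<Suc t}) (\<lambda>\<omega>. noise j t \<omega> i)"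
    and "determined ({j} \<times> {..<t}) (\<lambda>\<omega>. deviation j t \<omega> i)"
proof -
  have "determined ({j} \<times> {..<Suc t}) (\<lambda>\<omega>. err j t \<omega> i)"
    by (rule determined_mono[OF determined_err_grad(1)[OF assms]]) auto
  thus "determined ({j} \<times> {..<Suc t}) (\<lambda>\<omega>. noise j t \<omega> i)"
    unfolding noise_def by (intro determined_diff determined_mult determined_err_grad assms) simp
  show "determined ({j} \<times> {..<t}) (\<lambda>\<omega>. deviation j t \<omega> i)"
    unfolding deviation_def by (intro determined_diff determined_err_grad assms) simp
qed

lemma square_integrable_deviation:
  assumes "j < m" "t \<le> k" "i < d"
  shows "square_integrable M (\<lambda>\<omega>. deviation j t \<omega> i)"
  unfolding deviation_def
  by (intro square_integrable_diff square_integrable_err square_integrable_const assms)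

context
  fixes j t i :: nat
  assumes j: "j < m" and t: "t < k" and i: "i < d"
begin

lemma square_integrable_noise: "square_integrable M (\<lambda>\<omega>. noise j t \<omega> i)"
  unfolding noise_def
  by (intro square_integrable_diff square_integrable_cmult square_integrable_err_grad j t i)

lemma expectation_past_mult_noise:
  assumes X: "determined ({j} \<times> {..<t}) X" "square_integrable M X"
  shows "expectation (\<lambda>\<omega>. X \<omega> * noise j t \<omega> i) = 0"
proof -
  note sq = square_integrable_err_grad[OF j t i]
  have "expectation (\<lambda>\<omega>. X \<omega> * noise j t \<omega> i)
      = expectation (\<lambda>\<omega>. \<mu> i * (X \<omega> * err j t \<omega> i) - X \<omega> * grad j t \<omega> i)"
    by (simp add: noise_def algebra_simps)
  also have "\<dots> = 0"
    using expectation_past_mult_grad[OF j t X i] square_integrable_mult[OF X(2) sq(1)]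
      square_integrable_mult[OF X(2) sq(2)] by simp
  finally show ?thesis .
qed

text \<open>Centering at the conditional mean can only lower the second moment, so the bound for the
  gradient carries over.\<close>

lemma noise_second_moment: "expectation (\<lambda>\<omega>. (noise j t \<omega> i)\<^sup>2) \<le> 2 * \<mu> i * (\<tau> * energy j t + s)"
proof -
  note sq = square_integrable_err_grad[OF j t i]
  have "expectation (\<lambda>\<omega>. (noise j t \<omega> i)\<^sup>2) = expectation (\<lambda>\<omega>. (\<mu> i)\<^sup>2 * (err j t \<omega> i)\<^sup>2
      - 2 * \<mu> i * (err j t \<omega> i * grad j t \<omega> i) + (grad j t \<omega> i)\<^sup>2)"
    by (simp add: noise_def power2_eq_square algebra_simps)
  also have "\<dots> = (\<mu> i)\<^sup>2 * expectation (\<lambda>\<omega>. (err j t \<omega> i)\<^sup>2)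
      - 2 * \<mu> i * expectation (\<lambda>\<omega>. err j t \<omega> i * grad j t \<omega> i) + expectation (\<lambda>\<omega>. (grad j t \<omega> i)\<^sup>2)"
    using sq square_integrable_mult[OF sq] by (simp add: square_integrable_def)
  also have "expectation (\<lambda>\<omega>. err j t \<omega> i * grad j t \<omega> i) = \<mu> i * expectation (\<lambda>\<omega>. (err j t \<omega> i)\<^sup>2)"
    by (simp add: expectation_past_mult_grad[OF j t determined_err_grad(1)[OF i] sq(1) i] power2_eq_square)
  finally have "expectation (\<lambda>\<omega>. (noise j t \<omega> i)\<^sup>2)
      = expectation (\<lambda>\<omega>. (grad j t \<omega> i)\<^sup>2) - (\<mu> i)\<^sup>2 * expectation (\<lambda>\<omega>. (err j t \<omega> i)\<^sup>2)"
    by (simp add: power2_eq_square)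
  moreover have "0 \<le> (\<mu> i)\<^sup>2 * expectation (\<lambda>\<omega>. (err j t \<omega> i)\<^sup>2)"
    by (intro mult_nonneg_nonneg Bochner_Integration.integral_nonneg) auto
  ultimately show ?thesis using grad_second_moment[OF j t i] by linarith
qed

lemma second_moment_past_plus_noise:
  assumes X: "determined ({j} \<times> {..<t}) X" "square_integrable M X"
  shows "expectation (\<lambda>\<omega>. (a * X \<omega> + b * noise j t \<omega> i)\<^sup>2) =
    a\<^sup>2 * expectation (\<lambda>\<omega>. (X \<omega>)\<^sup>2) + b\<^sup>2 * expectation (\<lambda>\<omega>. (noise j t \<omega> i)\<^sup>2)"
proof -
  have "expectation (\<lambda>\<omega>. (a * X \<omega> + b * noise j t \<omega> i)\<^sup>2) = expectation (\<lambda>\<omega>. a\<^sup>2 * (X \<omega>)\<^sup>2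
     + 2 * a * b * (X \<omega> * noise j t \<omega> i) + b\<^sup>2 * (noise j t \<omega> i)\<^sup>2)"
    by (simp add: power2_eq_square algebra_simps)
  also have "\<dots> = a\<^sup>2 * expectation (\<lambda>\<omega>. (X \<omega>)\<^sup>2)
     + 2 * a * b * expectation (\<lambda>\<omega>. X \<omega> * noise j t \<omega> i) + b\<^sup>2 * expectation (\<lambda>\<omega>. (noise j t \<omega> i)\<^sup>2)"
    using X(2) square_integrable_noise square_integrable_mult[OF X(2) square_integrable_noise]
    by (simp add: square_integrable_def)
  finally show ?thesis using expectation_past_mult_noise[OF X] by simp
qed

end

definition total_noise :: "nat \<Rightarrow> nat \<Rightarrow> nat \<Rightarrow> real" where
  "total_noise j t i = (\<Sum>r<t. expectation (\<lambda>\<omega>. (noise j r \<omega> i)\<^sup>2))"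

lemma total_noise_mono: "t \<le> t' \<Longrightarrow> total_noise j t i \<le> total_noise j t' i"
  unfolding total_noise_def by (intro sum_mono2 Bochner_Integration.integral_nonneg) auto

lemma expectation_deviation:
  assumes j: "j < m" and t: "t \<le> k" and i: "i < d"
  shows "expectation (\<lambda>\<omega>. deviation j t \<omega> i) = 0"
  using t
proof (induction t)
  case (Suc t)
  have "integrable M (\<lambda>\<omega>. noise j t \<omega> i)" "integrable M (\<lambda>\<omega>. deviation j t \<omega> i)"
    by (intro square_integrable_integrable square_integrable_noise square_integrable_deviation;
        use j i Suc in simp)+
  moreover have "expectation (\<lambda>\<omega>. noise j t \<omega> i) = 0"
    using expectation_past_mult_noise[OF j _ i determined_const, of t 1]
      square_integrable_const[of 1] Suc by simp
  ultimately show ?case using Suc by (simp add: deviation_Suc)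
qed (simp add: deviation_0)

text \<open>Each new noise term is orthogonal to the past, so second moments add up; the contraction
  factor is merely bounded by 1.\<close>

lemma deviation_second_moment:
  assumes j: "j < m" and t: "t \<le> k" and i: "i < d"
  shows "expectation (\<lambda>\<omega>. (deviation j t \<omega> i)\<^sup>2) \<le> \<gamma>\<^sup>2 * total_noise j t i"
  using t
proof (induction t)
  case (Suc t)
  have \<rho>: "(1 - \<gamma> * \<mu> i)\<^sup>2 \<le> 1"
    using \<gamma>\<mu>_le_1[OF i] \<gamma>_pos \<mu>_pos[OF i] by (intro power_le_one) auto
  have "expectation (\<lambda>\<omega>. (deviation j (Suc t) \<omega> i)\<^sup>2)
      = (1 - \<gamma> * \<mu> i)\<^sup>2 * expectation (\<lambda>\<omega>. (deviation j t \<omega> i)\<^sup>2) + \<gamma>\<^sup>2 * expectation (\<lambda>\<omega>. (noise j t \<omega> i)\<^sup>2)"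
    unfolding deviation_Suc
    by (rule second_moment_past_plus_noise)
       (use Suc.prems j i in \<open>auto intro: determined_noise_deviation square_integrable_deviation\<close>)
  also have "\<dots> \<le> 1 * expectation (\<lambda>\<omega>. (deviation j t \<omega> i)\<^sup>2) + \<gamma>\<^sup>2 * expectation (\<lambda>\<omega>. (noise j t \<omega> i)\<^sup>2)"
    by (intro add_right_mono mult_right_mono \<rho> Bochner_Integration.integral_nonneg) auto
  finally show ?case using Suc by (simp add: total_noise_def algebra_simps)
qed (simp add: deviation_0 total_noise_def)

lemma noise_sum_second_moment:
  assumes j: "j < m" and t: "t \<le> k" and i: "i < d"
  shows "expectation (\<lambda>\<omega>. (\<Sum>r<t. noise j r \<omega> i)\<^sup>2) = total_noise j t i"
  using t
proof (induction t)
  case (Suc t)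
  have "determined ({j} \<times> {..<t}) (\<lambda>\<omega>. noise j r \<omega> i)" if "r < t" for r
    by (rule determined_mono[OF determined_noise_deviation(1)[OF i]]) (use that in auto)
  hence "determined ({j} \<times> {..<t}) (\<lambda>\<omega>. \<Sum>r<t. noise j r \<omega> i)"
    by (intro determined_sum) auto
  moreover have "square_integrable M (\<lambda>\<omega>. \<Sum>r<t. noise j r \<omega> i)"
    by (intro square_integrable_sum square_integrable_noise) (use Suc.prems j i in auto)
  ultimately show ?case
    using second_moment_past_plus_noise[OF j _ i, of t _ 1 1] Suc by (simp add: total_noise_def)
qed (simp add: total_noise_def)

text \<open>The recursion says that \<open>\<gamma> * \<mu> i\<close> times a deviation is
  \<open>\<gamma>\<close> times the noise minus an increment of the deviation, and increments
  telescope. A sum of correlated deviations becomes a sum of orthogonal noises and one boundary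
  term.\<close>

lemma sum_deviation:
  "\<gamma> * \<mu> i * (\<Sum>r<t. deviation j r \<omega> i) = \<gamma> * (\<Sum>r<t. noise j r \<omega> i) - deviation j t \<omega> i"
  by (induction t) (auto simp: deviation_0 deviation_Suc algebra_simps)

lemma square_integrable_sum_deviation:
  assumes "j < m" "i < d"
  shows "square_integrable M (\<lambda>\<omega>. \<Sum>r<k. deviation j r \<omega> i)"
  by (intro square_integrable_sum square_integrable_deviation) (use assms in auto)

text \<open>The first bound comes from \<open>sum_deviation\<close>: noise sum and boundary term
  each contribute at most twice the squared stepsize times the total noise, which makes the 4. The
  second is Cauchy-Schwarz over the \<open>k\<close> steps and wins for small eigenvalues.\<close>

lemma sum_deviation_second_moment:
  assumes j: "j < m" and i: "i < d"
  shows "expectation (\<lambda>\<omega>. (\<Sum>r<k. deviation j r \<omega> i)\<^sup>2)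
     \<le> min (4 / (\<mu> i)\<^sup>2) (\<gamma>\<^sup>2 * (real k)\<^sup>2) * total_noise j k i"
proof -
  let ?S = "\<lambda>\<omega>. \<Sum>r<k. deviation j r \<omega> i" and ?V = "total_noise j k i"
  have S: "integrable M (\<lambda>\<omega>. (?S \<omega>)\<^sup>2)"
    using square_integrable_sum_deviation[OF assms] by (simp add: square_integrable_def)
  have D: "integrable M (\<lambda>\<omega>. (deviation j r \<omega> i)\<^sup>2)" if "r \<le> k" for r
    using square_integrable_deviation[OF j that i] by (simp add: square_integrable_def)
  have N: "integrable M (\<lambda>\<omega>. (\<Sum>r<k. noise j r \<omega> i)\<^sup>2)"
    using square_integrable_sum[of "{..<k}" M "\<lambda>r \<omega>. noise j r \<omega> i"] square_integrable_noise[OF j _ i]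
    by (simp add: square_integrable_def)
  have "(\<gamma> * \<mu> i)\<^sup>2 * expectation (\<lambda>\<omega>. (?S \<omega>)\<^sup>2) = expectation (\<lambda>\<omega>. (\<gamma> * \<mu> i * ?S \<omega>)\<^sup>2)"
    by (simp add: power_mult_distrib)
  also have "\<dots> \<le> expectation (\<lambda>\<omega>. 2 * (\<gamma>\<^sup>2 * (\<Sum>r<k. noise j r \<omega> i)\<^sup>2) + 2 * (deviation j k \<omega> i)\<^sup>2)"
  proof (rule integral_mono)
    show "integrable M (\<lambda>\<omega>. (\<gamma> * \<mu> i * ?S \<omega>)\<^sup>2)" using S by (simp add: power_mult_distrib)
    show "integrable M (\<lambda>\<omega>. 2 * (\<gamma>\<^sup>2 * (\<Sum>r<k. noise j r \<omega> i)\<^sup>2) + 2 * (deviation j k \<omega> i)\<^sup>2)"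
      using N D[of k] by simp
    show "(\<gamma> * \<mu> i * ?S \<omega>)\<^sup>2 \<le> 2 * (\<gamma>\<^sup>2 * (\<Sum>r<k. noise j r \<omega> i)\<^sup>2) + 2 * (deviation j k \<omega> i)\<^sup>2" for \<omega>
      unfolding sum_deviation
      using power2_diff_le[of "\<gamma> * (\<Sum>r<k. noise j r \<omega> i)"] by (simp add: power_mult_distrib)
  qed
  also have "\<dots> = 2 * (\<gamma>\<^sup>2 * ?V) + 2 * expectation (\<lambda>\<omega>. (deviation j k \<omega> i)\<^sup>2)"
    using N D[of k] noise_sum_second_moment[OF j _ i, of k] by simp
  also have "\<dots> \<le> 4 * \<gamma>\<^sup>2 * ?V"
    using deviation_second_moment[OF j _ i, of k] by simp
  finally have "expectation (\<lambda>\<omega>. (?S \<omega>)\<^sup>2) \<le> 4 / (\<mu> i)\<^sup>2 * ?V"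
    using \<gamma>_pos \<mu>_pos[OF i] by (simp add: field_simps)
  moreover have "expectation (\<lambda>\<omega>. (?S \<omega>)\<^sup>2) \<le> \<gamma>\<^sup>2 * (real k)\<^sup>2 * ?V"
  proof -
    have "expectation (\<lambda>\<omega>. (?S \<omega>)\<^sup>2) \<le> expectation (\<lambda>\<omega>. real k * (\<Sum>r<k. (deviation j r \<omega> i)\<^sup>2))"
    proof (rule integral_mono[OF S])
      show "integrable M (\<lambda>\<omega>. real k * (\<Sum>r<k. (deviation j r \<omega> i)\<^sup>2))"
        by (intro integrable_mult_right Bochner_Integration.integrable_sum D) auto
      show "(?S \<omega>)\<^sup>2 \<le> real k * (\<Sum>r<k. (deviation j r \<omega> i)\<^sup>2)" for \<omega>
        using sum_squared_le_sum_of_squares[of "\<lambda>r. deviation j r \<omega> i" "{..<k}"] by (simp add: mult.commute)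
    qed
    also have "\<dots> = real k * (\<Sum>r<k. expectation (\<lambda>\<omega>. (deviation j r \<omega> i)\<^sup>2))"
      by (simp, subst Bochner_Integration.integral_sum) (auto intro: D)
    also have "\<dots> \<le> real k * (\<Sum>r<k. \<gamma>\<^sup>2 * ?V)"
    proof (intro mult_left_mono sum_mono)
      fix r assume "r \<in> {..<k}"
      hence "expectation (\<lambda>\<omega>. (deviation j r \<omega> i)\<^sup>2) \<le> \<gamma>\<^sup>2 * total_noise j r i"
        by (intro deviation_second_moment j i) auto
      also have "\<dots> \<le> \<gamma>\<^sup>2 * ?V"
        using \<open>r \<in> {..<k}\<close> by (intro mult_left_mono total_noise_mono) auto
      finally show "expectation (\<lambda>\<omega>. (deviation j r \<omega> i)\<^sup>2) \<le> \<gamma>\<^sup>2 * ?V" .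
    qed simp
    finally show ?thesis by (simp add: power2_eq_square ac_simps)
  qed
  ultimately show ?thesis by (simp add: min_def)
qed

text \<open>Different nodes use disjoint samples and their deviations are centered, so mixed terms
  vanish. The sum grows like \<open>m\<close> instead of its square, which is the gain from
  distributing.\<close>

lemma node_sum_second_moment:
  assumes i: "i < d"
  shows "expectation (\<lambda>\<omega>. (\<Sum>j<m. \<Sum>r<k. deviation j r \<omega> i)\<^sup>2)
    = (\<Sum>j<m. expectation (\<lambda>\<omega>. (\<Sum>r<k. deviation j r \<omega> i)\<^sup>2))"
proof -
  let ?S = "\<lambda>j \<omega>. \<Sum>r<k. deviation j r \<omega> i"
  have det: "determined ({j} \<times> {..<k}) (?S j)" for j
  proof (rule determined_sum)
    fix r assume "r \<in> {..<k}"
    thus "determined ({j} \<times> {..<k}) (\<lambda>\<omega>. deviation j r \<omega> i)"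
      by (intro determined_mono[OF determined_noise_deviation(2)[OF i]]) auto
  qed
  have sq: "square_integrable M (?S j)" if "j < m" for j
    by (rule square_integrable_sum_deviation[OF that i])
  have mean: "expectation (?S j) = 0" if "j < m" for j
  proof -
    have "expectation (?S j) = (\<Sum>r<k. expectation (\<lambda>\<omega>. deviation j r \<omega> i))"
      by (intro Bochner_Integration.integral_sum square_integrable_integrable square_integrable_deviation)
         (use that i in auto)
    also have "\<dots> = 0"
      by (intro sum.neutral ballI expectation_deviation) (use that i in auto)
    finally show ?thesis .
  qed
  have off: "expectation (\<lambda>\<omega>. ?S j \<omega> * ?S j' \<omega>) = 0" if "j < m" "j' < m" "j \<noteq> j'" for j j'
    using determined_indep(2)[OF det det, of j j'] that mean sq
    by (auto intro: square_integrable_integrable)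
  have "expectation (\<lambda>\<omega>. (\<Sum>j<m. ?S j \<omega>)\<^sup>2) = (\<Sum>j<m. \<Sum>j'<m. expectation (\<lambda>\<omega>. ?S j \<omega> * ?S j' \<omega>))"
    using integral_double_sum[of m M "\<lambda>j j' \<omega>. ?S j \<omega> * ?S j' \<omega>" "\<lambda>_ _. 1"] square_integrable_mult[OF sq sq]
    by (simp add: power2_eq_square sum_product)
  also have "\<dots> = (\<Sum>j<m. \<Sum>j'<m. if j' = j then expectation (\<lambda>\<omega>. (?S j \<omega>)\<^sup>2) else 0)"
    by (intro sum.cong refl) (auto simp: off power2_eq_square)
  finally show ?thesis by simp
qed

text \<open>What \<open>sum_energy_le\<close> gives for \<open>\<tau>\<close> times the summed
  energy plus the residual noise \<open>s * real k\<close>; it is the same for every node.\<close>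

definition noise_bound :: real where
  "noise_bound = \<tau> * (((\<Sum>i<d. (a0 i)\<^sup>2) + 2 * \<gamma>\<^sup>2 * s * (\<Sum>i<d. \<mu> i) * real k)
      / (2 * \<gamma> * (1 - \<gamma> * \<tau> * (\<Sum>i<d. \<mu> i)))) + s * real k"

lemma total_noise_le:
  assumes j: "j < m" and i: "i < d"
  shows "total_noise j k i \<le> 2 * \<mu> i * noise_bound"
proof -
  have "total_noise j k i \<le> (\<Sum>t<k. 2 * \<mu> i * (\<tau> * energy j t + s))"
    unfolding total_noise_def by (intro sum_mono noise_second_moment j i) auto
  also have "\<dots> = 2 * \<mu> i * (\<tau> * (\<Sum>t<k. energy j t) + s * real k)"
    by (simp add: sum.distrib sum_distrib_left algebra_simps)
  also have "\<dots> \<le> 2 * \<mu> i * noise_bound"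
  proof -
    have pos: "0 < 2 * \<gamma> * (1 - \<gamma> * \<tau> * (\<Sum>i<d. \<mu> i))" using \<gamma>_pos stepsize by simp
    have "(\<Sum>t<k. energy j t) \<le> ((\<Sum>i<d. (a0 i)\<^sup>2) + 2 * \<gamma>\<^sup>2 * s * (\<Sum>i<d. \<mu> i) * real k)
      / (2 * \<gamma> * (1 - \<gamma> * \<tau> * (\<Sum>i<d. \<mu> i)))"
      unfolding pos_le_divide_eq[OF pos] using sum_energy_le[OF j, of k] by (simp add: mult.commute)
    thus ?thesis unfolding noise_bound_def using \<tau>_pos \<mu>_nonneg[OF i]
      by (intro mult_left_mono add_right_mono) auto
  qed
  finally show ?thesis .
qed

lemma geometric_sum_le:
  assumes i: "i < d"
  shows "0 \<le> (\<Sum>t<k. (1 - \<gamma> * \<mu> i) ^ t)" "(\<Sum>t<k. (1 - \<gamma> * \<mu> i) ^ t) \<le> min (real k) (1 / (\<gamma> * \<mu> i))"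
proof -
  let ?\<rho> = "1 - \<gamma> * \<mu> i"
  have pos: "0 < \<gamma> * \<mu> i" using \<gamma>_pos \<mu>_pos[OF i] by simp
  have \<rho>: "0 \<le> ?\<rho>" "?\<rho> \<le> 1" using \<gamma>\<mu>_le_1[OF i] pos by auto
  show "0 \<le> (\<Sum>t<k. ?\<rho> ^ t)" using \<rho> by (intro sum_nonneg) auto
  have "(\<Sum>t<k. ?\<rho> ^ t) \<le> (\<Sum>t<k. 1)" using \<rho> by (intro sum_mono power_le_one) auto
  moreover have "(\<Sum>t<k. ?\<rho> ^ t) \<le> 1 / (\<gamma> * \<mu> i)"
  proof -
    have "(\<Sum>t<k. ?\<rho> ^ t) = (1 - ?\<rho> ^ k) / (1 - ?\<rho>)"
      using pos by (subst sum_gp_strict) auto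
    also have "\<dots> \<le> 1 / (\<gamma> * \<mu> i)" using pos \<rho> by (simp add: divide_right_mono)
    finally show ?thesis .
  qed
  ultimately show "(\<Sum>t<k. ?\<rho> ^ t) \<le> min (real k) (1 / (\<gamma> * \<mu> i))" by simp
qed

lemma square_integrable_averaged_err:
  assumes "i < d"
  shows "square_integrable M (\<lambda>\<omega>. (\<Sum>j<m. \<Sum>t<k. err j t \<omega> i) / c)"
proof -
  have "square_integrable M (\<lambda>\<omega>. \<Sum>j<m. \<Sum>t<k. err j t \<omega> i)"
    by (intro square_integrable_sum square_integrable_err) (use assms in auto)
  from square_integrable_cmult[OF this, of "1 / c"] show ?thesis by simp
qed

theorem averaged_err_second_moment:
  assumes i: "i < d" and m: "0 < m" and k: "0 < k"
  shows "expectation (\<lambda>\<omega>. ((\<Sum>j<m. \<Sum>t<k. err j t \<omega> i) / (real m * real k))\<^sup>2)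
    \<le> (a0 i)\<^sup>2 * (min (real k) (1 / (\<gamma> * \<mu> i)) / real k)\<^sup>2
      + min (4 / (\<mu> i)\<^sup>2) (\<gamma>\<^sup>2 * (real k)\<^sup>2) * (2 * \<mu> i * noise_bound) / (real m * (real k)\<^sup>2)"
proof -
  let ?G = "\<Sum>t<k. (1 - \<gamma> * \<mu> i) ^ t" and ?S = "\<lambda>\<omega>. \<Sum>j<m. \<Sum>t<k. deviation j t \<omega> i"
  let ?B = "min (4 / (\<mu> i)\<^sup>2) (\<gamma>\<^sup>2 * (real k)\<^sup>2) * (2 * \<mu> i * noise_bound)"
  have S: "square_integrable M ?S"
    by (intro square_integrable_sum square_integrable_deviation) (use i in auto)
  have mean: "expectation ?S = 0"
  proof -
    have "expectation ?S = (\<Sum>j<m. expectation (\<lambda>\<omega>. \<Sum>t<k. deviation j t \<omega> i))"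
      by (intro Bochner_Integration.integral_sum square_integrable_integrable square_integrable_sum_deviation)
         (use i in auto)
    also have "\<dots> = (\<Sum>j<m. \<Sum>t<k. expectation (\<lambda>\<omega>. deviation j t \<omega> i))"
      by (intro sum.cong refl Bochner_Integration.integral_sum square_integrable_integrable
            square_integrable_deviation) (use i in auto)
    also have "\<dots> = 0"
      by (intro sum.neutral ballI expectation_deviation) (use i in auto)
    finally show ?thesis .
  qed
  \<comment> \<open>Bias and centered part. The bias is identical on all nodes, so it carries the
    full square of \<open>m\<close> and gains nothing from averaging over them.\<close>
  have "(\<Sum>j<m. \<Sum>t<k. err j t \<omega> i) = real m * (a0 i * ?G) + ?S \<omega>" for \<omega>
    by (simp add: deviation_def sum_subtractf mult.commute flip: sum_distrib_left sum_distrib_right)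
  hence "expectation (\<lambda>\<omega>. (\<Sum>j<m. \<Sum>t<k. err j t \<omega> i)\<^sup>2) = expectation (\<lambda>\<omega>. (real m * (a0 i * ?G))\<^sup>2
      + 2 * (real m * (a0 i * ?G)) * ?S \<omega> + (?S \<omega>)\<^sup>2)"
    by (simp add: power2_sum ac_simps)
  also have "\<dots> = (real m * (a0 i * ?G))\<^sup>2 + expectation (\<lambda>\<omega>. (?S \<omega>)\<^sup>2)"
    using S square_integrable_integrable[OF S] mean by (simp add: square_integrable_def prob_space)
  finally have eq: "expectation (\<lambda>\<omega>. (\<Sum>j<m. \<Sum>t<k. err j t \<omega> i)\<^sup>2)
      = (real m * (a0 i * ?G))\<^sup>2 + expectation (\<lambda>\<omega>. (?S \<omega>)\<^sup>2)" .
  have variance: "expectation (\<lambda>\<omega>. (?S \<omega>)\<^sup>2) \<le> (\<Sum>j<m. ?B)"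
    unfolding node_sum_second_moment[OF i]
  proof (intro sum_mono)
    fix j assume "j \<in> {..<m}"
    hence j: "j < m" by simp
    show "expectation (\<lambda>\<omega>. (\<Sum>r<k. deviation j r \<omega> i)\<^sup>2) \<le> ?B"
      by (rule order_trans[OF sum_deviation_second_moment[OF j i]])
         (intro mult_left_mono total_noise_le j i, simp)
  qed
  have bias: "(real m * (a0 i * ?G))\<^sup>2 \<le> (real m)\<^sup>2 * ((a0 i)\<^sup>2 * (min (real k) (1 / (\<gamma> * \<mu> i)))\<^sup>2)"
    unfolding power_mult_distrib
    by (intro mult_left_mono power_mono geometric_sum_le[OF i]) auto
  have "expectation (\<lambda>\<omega>. (\<Sum>j<m. \<Sum>t<k. err j t \<omega> i)\<^sup>2)
     \<le> (real m)\<^sup>2 * ((a0 i)\<^sup>2 * (min (real k) (1 / (\<gamma> * \<mu> i)))\<^sup>2) + real m * ?B"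
    unfolding eq using add_mono[OF bias variance] by simp
  from divide_right_mono[OF this, of "(real m * real k)\<^sup>2"]
  have "expectation (\<lambda>\<omega>. (\<Sum>j<m. \<Sum>t<k. err j t \<omega> i)\<^sup>2) / (real m * real k)\<^sup>2 \<le>
    ((real m)\<^sup>2 * ((a0 i)\<^sup>2 * (min (real k) (1 / (\<gamma> * \<mu> i)))\<^sup>2) + real m * ?B) / (real m * real k)\<^sup>2"
    by simp
  also have "\<dots> = (a0 i)\<^sup>2 * (min (real k) (1 / (\<gamma> * \<mu> i)) / real k)\<^sup>2 + ?B / (real m * (real k)\<^sup>2)"
    unfolding add_divide_distrib power_divide power_mult_distrib
    using m k by (simp add: power2_eq_square)
  finally show ?thesis by (simp add: power_divide)
qed

end

section \<open>Moments of the data and the excess risk\<close>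

lemma square_integrable_cong:
  "(\<And>x. x \<in> space M \<Longrightarrow> X x = Y x) \<Longrightarrow> square_integrable M X = square_integrable M Y"
  unfolding square_integrable_def
  by (intro conj_cong measurable_cong Bochner_Integration.integrable_cong) auto

text \<open>A derivative test at 0 done with a single test point; \<open>h + 1\<close> rather than
  \<open>h\<close> avoids a zero denominator.\<close>

lemma linear_le_quadratic_imp_zero:
  fixes c h :: real
  assumes le: "\<And>s. 2 * s * c \<le> s\<^sup>2 * h" and h: "0 \<le> h"
  shows "c = 0"
proof -
  define s where "s = c / (h + 1)"
  have c: "c = s * (h + 1)" using h by (simp add: s_def)
  have "2 * s * (s * (h + 1)) \<le> s\<^sup>2 * h" using le[of s] c by simp
  hence "s\<^sup>2 * (h + 2) \<le> 0" by (simp add: power2_eq_square algebra_simps)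
  hence "s = 0" using h by (simp add: mult_le_0_iff)
  thus ?thesis using c by simp
qed

lemma second_moment_carrier: "second_moment d D \<in> carrier_mat d d"
  by (simp add: second_moment_def)

lemma second_moment_symmetric: "(second_moment d D)\<^sup>T = second_moment d D"
  by (rule eq_matI) (auto simp: second_moment_def mult.commute)

section \<open>Moment matrices as quadratic forms\<close>

locale data_law = prob_space D for D :: "(rvec \<times> real) measure" +
  fixes d :: nat
  assumes sets_D: "sets D = sets (pair_borel d)"
    and norm4_integrable: "integrable D (\<lambda>z. euclid_norm (fst z) ^ 4)"
begin

lemma fst_carrier: "z \<in> space D \<Longrightarrow> fst z \<in> carrier_vec d"
  using sets_eq_imp_space_eq[OF sets_D]
  by (auto simp: pair_borel_def space_pair_measure vec_borel_def)

lemma entry_measurable [measurable]: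
  assumes "i < d"
  shows "(\<lambda>z. fst z $ i) \<in> borel_measurable D"
proof -
  have "(\<lambda>v. restrict (($) v) {..<d}) \<in> measurable (vec_borel d) (Pi\<^sub>M {..<d} (\<lambda>_. borel))"
    unfolding vec_borel_def by (rule measurable_vimage_algebra1) (auto simp: space_PiM)
  hence "(\<lambda>v. restrict (($) v) {..<d} i) \<in> borel_measurable (vec_borel d)"
    by (rule measurable_compose) (use assms in \<open>auto intro: measurable_component_singleton\<close>)
  hence 1: "(\<lambda>v. v $ i) \<in> borel_measurable (vec_borel d)" using assms by simp
  have "fst \<in> measurable D (vec_borel d)"
    using sets_D measurable_cong_sets[OF sets_D refl] by (auto simp: pair_borel_def)
  from measurable_compose[OF this 1] show ?thesis .
qed

lemma snd_measurable [measurable]: "snd \<in> borel_measurable D"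
  using measurable_cong_sets[OF sets_D refl] by (auto simp: pair_borel_def)

lemma linear_eq:
  "z \<in> space D \<Longrightarrow> a \<bullet> fst z = (\<Sum>l<d. a $ l * fst z $ l)"
  using fst_carrier[of z] by (simp add: scalar_prod_lessThan)

lemma linear_measurable [measurable]: "(\<lambda>z. a \<bullet> fst z) \<in> borel_measurable D"
proof -
  have "(\<lambda>z. \<Sum>l<d. a $ l * fst z $ l) \<in> borel_measurable D"
    by (intro borel_measurable_sum borel_measurable_times entry_measurable) auto
  thus ?thesis by (simp add: linear_eq cong: measurable_cong)
qed

lemma entries_square_integrable:
  assumes ij: "i < d" "j < d"
  shows "square_integrable D (\<lambda>z. fst z $ i * fst z $ j)"
  unfolding square_integrable_def
proof (intro conjI)
  show "(\<lambda>z. fst z $ i * fst z $ j) \<in> borel_measurable D"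
    using ij by (intro borel_measurable_times entry_measurable)
  show "integrable D (\<lambda>z. (fst z $ i * fst z $ j)\<^sup>2)"
  proof (rule Bochner_Integration.integrable_bound[OF norm4_integrable])
    show "(\<lambda>z. (fst z $ i * fst z $ j)\<^sup>2) \<in> borel_measurable D"
      using ij by (intro borel_measurable_power borel_measurable_times entry_measurable)
    show "AE z in D. norm ((fst z $ i * fst z $ j)\<^sup>2) \<le> norm (euclid_norm (fst z) ^ 4)"
    proof (rule AE_I2)
      fix z assume z: "z \<in> space D"
      have le: "(fst z $ i)\<^sup>2 \<le> fst z \<bullet> fst z" if "i < d" for i
        unfolding linear_eq[OF z] power2_eq_square
        using that member_le_sum[of i "{..<d}" "\<lambda>l. fst z $ l * fst z $ l"] by simp
      have "(fst z $ i)\<^sup>2 * (fst z $ j)\<^sup>2 \<le> (fst z \<bullet> fst z) * (fst z \<bullet> fst z)"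
        using ij by (intro mult_mono le) (auto simp flip: euclid_norm_power2)
      also have "\<dots> = euclid_norm (fst z) ^ 4"
        by (simp flip: euclid_norm_power2 power_add)
      finally show "norm ((fst z $ i * fst z $ j)\<^sup>2) \<le> norm (euclid_norm (fst z) ^ 4)"
        by (simp add: power_mult_distrib)
    qed
  qed
qed

lemma linear_mult_eq:
  assumes z: "z \<in> space D"
  shows "(a \<bullet> fst z) * (b \<bullet> fst z) = (\<Sum>i<d. \<Sum>j<d. a $ i * b $ j * (fst z $ i * fst z $ j))"
  unfolding linear_eq[OF z] sum_product by (simp add: ac_simps)

lemma linear_square_integrable:
  shows "square_integrable D (\<lambda>z. (a \<bullet> fst z) * (b \<bullet> fst z))"
proof -
  have "square_integrable D (\<lambda>z. \<Sum>i<d. \<Sum>j<d. a $ i * b $ j * (fst z $ i * fst z $ j))"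
    by (intro square_integrable_sum square_integrable_cmult entries_square_integrable) auto
  thus ?thesis by (simp add: linear_mult_eq cong: square_integrable_cong)
qed

text \<open>The weight \<open>g\<close> is left open to cover three matrices at once: the constant 1
  gives H, a squared linear form gives M(A), and the squared residual gives the noise
  covariance.\<close>

lemma
  assumes ab: "a \<in> carrier_vec d" "b \<in> carrier_vec d"
    and g: "\<And>i j. i < d \<Longrightarrow> j < d \<Longrightarrow> integrable D (\<lambda>z. g z * (fst z $ i * fst z $ j))"
  shows quadratic_form_integrable: "integrable D (\<lambda>z. g z * ((a \<bullet> fst z) * (b \<bullet> fst z)))"
    and quadratic_form_integral:
      "a \<bullet> (Matrix.mat d d (\<lambda>(i, j). \<integral>z. g z * (fst z $ i * fst z $ j) \<partial>D) *\<^sub>v b)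
         = (\<integral>z. g z * ((a \<bullet> fst z) * (b \<bullet> fst z)) \<partial>D)"
proof -
  have eq: "g z * ((a \<bullet> fst z) * (b \<bullet> fst z))
      = (\<Sum>i<d. \<Sum>j<d. a $ i * b $ j * (g z * (fst z $ i * fst z $ j)))" if "z \<in> space D" for z
    unfolding linear_mult_eq[OF that] by (simp add: sum_distrib_left ac_simps)
  have "integrable D (\<lambda>z. \<Sum>i<d. \<Sum>j<d. a $ i * b $ j * (g z * (fst z $ i * fst z $ j)))"
    by (rule integrable_double_sum) (rule g)
  thus "integrable D (\<lambda>z. g z * ((a \<bullet> fst z) * (b \<bullet> fst z)))"
    by (simp add: eq cong: Bochner_Integration.integrable_cong)
  have "(\<integral>z. g z * ((a \<bullet> fst z) * (b \<bullet> fst z)) \<partial>D)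
      = (\<integral>z. (\<Sum>i<d. \<Sum>j<d. a $ i * b $ j * (g z * (fst z $ i * fst z $ j))) \<partial>D)"
    by (rule Bochner_Integration.integral_cong) (auto simp: eq)
  also have "\<dots> = (\<Sum>i<d. \<Sum>j<d. a $ i * b $ j * (\<integral>z. g z * (fst z $ i * fst z $ j) \<partial>D))"
    by (rule integral_double_sum) (rule g)
  finally show "a \<bullet> (Matrix.mat d d (\<lambda>(i, j). \<integral>z. g z * (fst z $ i * fst z $ j) \<partial>D) *\<^sub>v b)
         = (\<integral>z. g z * ((a \<bullet> fst z) * (b \<bullet> fst z)) \<partial>D)"
    using ab by (simp add: scalar_prod_lessThan sum_distrib_left ac_simps)
qed

abbreviation H :: rmat where "H \<equiv> second_moment d D"

lemmas H_carrier = second_moment_carrier[of d D]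

lemma H_form:
  assumes "a \<in> carrier_vec d" "b \<in> carrier_vec d"
  shows "a \<bullet> (H *\<^sub>v b) = (\<integral>z. (a \<bullet> fst z) * (b \<bullet> fst z) \<partial>D)"
  using quadratic_form_integral[OF assms, of "\<lambda>_. 1"]
    square_integrable_integrable[OF entries_square_integrable]
  by (simp add: second_moment_def)

text \<open>The operator bound for the rank-one matrix of \<open>a\<close>, evaluated at
  \<open>b\<close>; the trace then collapses to the quadratic form of H at \<open>a\<close>.\<close>

lemma fourth_moment_le:
  assumes bound: "fourth_moment_bound d D \<tau>" and a: "a \<in> carrier_vec d" and b: "b \<in> carrier_vec d"
  shows "(\<integral>z. ((a \<bullet> fst z) * (b \<bullet> fst z))\<^sup>2 \<partial>D) \<le> \<tau> * (a \<bullet> (H *\<^sub>v a)) * (b \<bullet> (H *\<^sub>v b))"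
proof -
  define A where "A = Matrix.mat d d (\<lambda>(i, j). a $ i * a $ j)"
  have A: "A \<in> carrier_mat d d" by (simp add: A_def)
  have A_form: "v \<bullet> (A *\<^sub>v v) = (a \<bullet> v)\<^sup>2" if "v \<in> carrier_vec d" for v
    using that a by (simp add: A_def scalar_prod_lessThan power2_eq_square sum_product sum_distrib_left ac_simps)
  have "psd d A"
    unfolding psd_def using A A_form by (auto simp: A_def intro!: eq_matI)
  hence le: "psd d ((\<tau> * mat_trace (H * A)) \<cdot>\<^sub>m H - fourth_moment_op d D A)"
    using bound by (simp add: fourth_moment_bound_def loewner_le_def)
  let ?M = "fourth_moment_op d D A"
  have M_eq: "?M = Matrix.mat d d (\<lambda>(i, j). \<integral>z. (a \<bullet> fst z)\<^sup>2 * (fst z $ i * fst z $ j) \<partial>D)"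
    unfolding fourth_moment_op_def
  proof (rule cong_mat, simp, simp)
    fix i j
    show "(case (i, j) of (i, j) \<Rightarrow> \<integral>z. fst z \<bullet> (A *\<^sub>v fst z) * fst z $ j * fst z $ i \<partial>D) =
        (case (i, j) of (i, j) \<Rightarrow> \<integral>z. (a \<bullet> fst z)\<^sup>2 * (fst z $ i * fst z $ j) \<partial>D)"
      unfolding prod.case
      by (rule Bochner_Integration.integral_cong[OF refl]) (simp add: A_form fst_carrier)
  qed
  have M: "?M \<in> carrier_mat d d" by (simp add: fourth_moment_op_def)
  have lin: "a \<bullet> fst z * (unit_vec d i \<bullet> fst z) = a \<bullet> fst z * fst z $ i" if "i < d" "z \<in> space D" for i z
    using fst_carrier[OF that(2)] that(1) by simp
  have "integrable D (\<lambda>z. (a \<bullet> fst z)\<^sup>2 * (fst z $ i * fst z $ j))" if "i < d" "j < d" for i j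
  proof -
    have "integrable D (\<lambda>z. (a \<bullet> fst z * (unit_vec d i \<bullet> fst z)) * (a \<bullet> fst z * (unit_vec d j \<bullet> fst z)))"
      by (intro square_integrable_mult linear_square_integrable)
    thus ?thesis using that
      by (simp add: lin power2_eq_square ac_simps cong: Bochner_Integration.integrable_cong)
  qed
  from quadratic_form_integral[OF b b this]
  have M_form: "b \<bullet> (?M *\<^sub>v b) = (\<integral>z. ((a \<bullet> fst z) * (b \<bullet> fst z))\<^sup>2 \<partial>D)"
    unfolding M_eq by (simp add: power2_eq_square ac_simps)
  have trace: "mat_trace (H * A) = a \<bullet> (H *\<^sub>v a)"
    using H_carrier A a
    by (simp add: mat_trace_def scalar_prod_lessThan A_def sum_distrib_left ac_simps)
  have "0 \<le> b \<bullet> (((\<tau> * mat_trace (H * A)) \<cdot>\<^sub>m H - ?M) *\<^sub>v b)"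
    using le b by (simp add: psd_def)
  also have "((\<tau> * mat_trace (H * A)) \<cdot>\<^sub>m H - ?M) *\<^sub>v b
      = (\<tau> * mat_trace (H * A)) \<cdot>\<^sub>v (H *\<^sub>v b) - ?M *\<^sub>v b"
    using H_carrier M b
    by (intro eq_vecI) (auto simp: scalar_prod_lessThan sum_subtractf sum_distrib_left algebra_simps)
  also have "b \<bullet> \<dots> = \<tau> * (a \<bullet> (H *\<^sub>v a)) * (b \<bullet> (H *\<^sub>v b)) - b \<bullet> (?M *\<^sub>v b)"
    using H_carrier M b
    by (subst scalar_prod_minus_distrib[of _ d]) (auto simp: trace)
  finally show ?thesis by (simp add: M_form)
qed

lemma noise_form:
  assumes int: "integrable D (\<lambda>z. (scalar_prod w (fst z) - snd z)\<^sup>2 * (euclid_norm (fst z))\<^sup>2)"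
    and b: "b \<in> carrier_vec d"
  shows "integrable D (\<lambda>z. ((snd z - w \<bullet> fst z) * (b \<bullet> fst z))\<^sup>2)"
    and "b \<bullet> (noise_cov d D w *\<^sub>v b) = (\<integral>z. ((snd z - w \<bullet> fst z) * (b \<bullet> fst z))\<^sup>2 \<partial>D)"
proof -
  let ?g = "\<lambda>z. (w \<bullet> fst z - snd z)\<^sup>2"
  have g: "integrable D (\<lambda>z. ?g z * (fst z $ i * fst z $ j))" if ij: "i < d" "j < d" for i j
  proof (rule Bochner_Integration.integrable_bound[OF int])
    show "(\<lambda>z. ?g z * (fst z $ i * fst z $ j)) \<in> borel_measurable D"
      using ij by (intro borel_measurable_times borel_measurable_power borel_measurable_diff
          linear_measurable snd_measurable entry_measurable)
    show "AE z in D. norm (?g z * (fst z $ i * fst z $ j)) \<le> norm (?g z * (euclid_norm (fst z))\<^sup>2)"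
    proof (rule AE_I2)
      fix z assume z: "z \<in> space D"
      have le: "\<bar>fst z $ i\<bar> \<le> euclid_norm (fst z)" if "i < d" for i
      proof (rule power2_le_imp_le[OF _ euclid_norm_nonneg])
        show "\<bar>fst z $ i\<bar>\<^sup>2 \<le> (euclid_norm (fst z))\<^sup>2"
          unfolding euclid_norm_power2 linear_eq[OF z]
          using that member_le_sum[of i "{..<d}" "\<lambda>l. fst z $ l * fst z $ l"] by (simp add: power2_eq_square)
      qed
      have "\<bar>fst z $ i\<bar> * \<bar>fst z $ j\<bar> \<le> euclid_norm (fst z) * euclid_norm (fst z)"
        using ij by (intro mult_mono le) (auto simp: euclid_norm_nonneg)
      thus "norm (?g z * (fst z $ i * fst z $ j)) \<le> norm (?g z * (euclid_norm (fst z))\<^sup>2)"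
        by (simp add: abs_mult power2_eq_square mult_left_mono)
    qed
  qed
  have eq: "?g z * ((b \<bullet> fst z) * (b \<bullet> fst z)) = ((snd z - w \<bullet> fst z) * (b \<bullet> fst z))\<^sup>2" for z
    by (simp add: power2_eq_square algebra_simps)
  show "integrable D (\<lambda>z. ((snd z - w \<bullet> fst z) * (b \<bullet> fst z))\<^sup>2)"
    using quadratic_form_integrable[OF b b g] unfolding eq .
  show "b \<bullet> (noise_cov d D w *\<^sub>v b) = (\<integral>z. ((snd z - w \<bullet> fst z) * (b \<bullet> fst z))\<^sup>2 \<partial>D)"
    using quadratic_form_integral[OF b b g] unfolding eq noise_cov_def .
qed

section \<open>Excess risk over a minimizer\<close>

context
  fixes w :: rvec
  assumes w: "w \<in> carrier_vec d" and finite_risk: "risk D w < \<infinity>"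
begin

abbreviation residual :: "rvec \<times> real \<Rightarrow> real" where
  "residual z \<equiv> snd z - w \<bullet> fst z"

lemma residual_square_integrable: "square_integrable D residual"
  unfolding square_integrable_def
proof (intro conjI)
  have "(\<integral>\<^sup>+ z. ennreal ((residual z)\<^sup>2) \<partial>D) < \<infinity>"
    using finite_risk unfolding risk_def by (auto simp: ennreal_mult_less_top)
  thus "integrable D (\<lambda>z. (residual z)\<^sup>2)"
    by (intro integrableI_nonneg) auto
qed measurable

lemma linear_form_square_integrable: "square_integrable D (\<lambda>z. v \<bullet> fst z)"
  using square_integrable_integrable[OF linear_square_integrable[of v v]]
  by (simp add: square_integrable_def power2_eq_square)

text \<open>Finite risk at \<open>w\<close> puts the residual in L2, and the moment assumption does
  so for linear forms, so the square can be expanded in the reals.\<close>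

lemma risk_expansion:
  assumes v: "v \<in> carrier_vec d"
  shows "risk D (w + v) = ennreal (((\<integral>z. (residual z)\<^sup>2 \<partial>D) - 2 * (\<integral>z. residual z * (v \<bullet> fst z) \<partial>D)
     + v \<bullet> (H *\<^sub>v v)) / 2)"
proof -
  note sq = residual_square_integrable linear_form_square_integrable[of v]
  have eq: "snd z - (w + v) \<bullet> fst z = residual z - v \<bullet> fst z" if "z \<in> space D" for z
    using add_scalar_prod_distrib[OF w v fst_carrier[OF that]] by simp
  have diff: "square_integrable D (\<lambda>z. residual z - v \<bullet> fst z)"
    by (rule square_integrable_diff[OF sq])
  have "(\<integral>\<^sup>+ z. ennreal ((snd z - (w + v) \<bullet> fst z)\<^sup>2) \<partial>D) = (\<integral>\<^sup>+ z. ennreal ((residual z - v \<bullet> fst z)\<^sup>2) \<partial>D)"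
    by (rule nn_integral_cong) (simp add: eq)
  also have "\<dots> = ennreal (\<integral>z. (residual z - v \<bullet> fst z)\<^sup>2 \<partial>D)"
    using diff by (intro nn_integral_eq_integral) (auto simp: square_integrable_def)
  also have "(\<integral>z. (residual z - v \<bullet> fst z)\<^sup>2 \<partial>D)
      = (\<integral>z. (residual z)\<^sup>2 - 2 * (residual z * (v \<bullet> fst z)) + (v \<bullet> fst z) * (v \<bullet> fst z) \<partial>D)"
    by (rule Bochner_Integration.integral_cong) (auto simp: power2_eq_square algebra_simps)
  also have "\<dots> = (\<integral>z. (residual z)\<^sup>2 \<partial>D) - 2 * (\<integral>z. residual z * (v \<bullet> fst z) \<partial>D) + v \<bullet> (H *\<^sub>v v)"
    using sq square_integrable_mult[OF sq] by (simp add: square_integrable_def H_form[OF v v] power2_eq_square)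
  moreover have "(1 / 2 :: ennreal) = ennreal (1 / 2)" using divide_ennreal[of 1 2] by simp
  ultimately have "risk D (w + v) = ennreal (1 / 2) * ennreal ((\<integral>z. (residual z)\<^sup>2 \<partial>D)
     - 2 * (\<integral>z. residual z * (v \<bullet> fst z) \<partial>D) + v \<bullet> (H *\<^sub>v v))"
    by (simp only: risk_def)
  also have "\<dots> = ennreal (1 / 2 * ((\<integral>z. (residual z)\<^sup>2 \<partial>D)
     - 2 * (\<integral>z. residual z * (v \<bullet> fst z) \<partial>D) + v \<bullet> (H *\<^sub>v v)))"
    by (rule ennreal_mult'[symmetric]) simp
  finally show ?thesis by simp
qed

lemma H_nonneg: "v \<in> carrier_vec d \<Longrightarrow> 0 \<le> v \<bullet> (H *\<^sub>v v)"
  by (simp add: H_form)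

context
  assumes minimal: "\<And>v. v \<in> carrier_vec d \<Longrightarrow> risk D w \<le> risk D v"
begin

text \<open>The normal equations, obtained by comparing the risk at \<open>w\<close> with the risk
  along the line in direction \<open>v\<close>.\<close>

lemma residual_orthogonal:
  assumes v: "v \<in> carrier_vec d"
  shows "(\<integral>z. residual z * (v \<bullet> fst z) \<partial>D) = 0"
proof -
  let ?c = "\<integral>z. residual z * (v \<bullet> fst z) \<partial>D" and ?h = "v \<bullet> (H *\<^sub>v v)" and ?r = "\<integral>z. (residual z)\<^sup>2 \<partial>D"
  have h: "0 \<le> ?h" by (rule H_nonneg[OF v])
  have r: "0 \<le> ?r" by simp
  have "2 * s * ?c \<le> s\<^sup>2 * ?h" for s
  proof -
    have sv: "s \<cdot>\<^sub>v v \<in> carrier_vec d" using v by simp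
    have c: "(\<integral>z. residual z * ((s \<cdot>\<^sub>v v) \<bullet> fst z) \<partial>D) = s * ?c"
    proof -
      have "(\<integral>z. residual z * ((s \<cdot>\<^sub>v v) \<bullet> fst z) \<partial>D) = (\<integral>z. s * (residual z * (v \<bullet> fst z)) \<partial>D)"
        by (rule Bochner_Integration.integral_cong)
           (use v fst_carrier in \<open>auto simp: smult_scalar_prod_distrib[of _ d]\<close>)
      thus ?thesis by simp
    qed
    have hs: "(s \<cdot>\<^sub>v v) \<bullet> (H *\<^sub>v (s \<cdot>\<^sub>v v)) = s\<^sup>2 * ?h"
      using v H_carrier by (simp add: mult_mat_vec power2_eq_square)
    have "risk D w = ennreal (?r / 2)"
      using risk_expansion[of "0\<^sub>v d"] w H_carrier by (simp add: linear_eq cong: Bochner_Integration.integral_cong)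
    moreover have "risk D w \<le> risk D (w + s \<cdot>\<^sub>v v)" by (rule minimal) (use w v in simp)
    ultimately have le: "ennreal (?r / 2) \<le> ennreal ((?r - 2 * (s * ?c) + s\<^sup>2 * ?h) / 2)"
      using risk_expansion[OF sv] by (simp add: c hs)
    show ?thesis
    proof (cases "0 \<le> ?r - 2 * (s * ?c) + s\<^sup>2 * ?h")
      case True
      thus ?thesis using le r by (simp add: ennreal_le_iff)
    next
      \<comment> \<open>\<open>ennreal\<close> sends negative numbers to 0, so the comparison yields
        only that the residual has zero second moment. It then vanishes almost everywhere, and so
        does the integral in question.\<close>
      case False
      hence "?r \<le> 0" using le r by (simp add: ennreal_neg)
      hence "?r = 0" using r by simp
      hence "ennreal (?r) = 0" by simp
      have "AE z in D. (residual z)\<^sup>2 = 0"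
        using \<open>?r = 0\<close> residual_square_integrable
        by (subst integral_nonneg_eq_0_iff_AE[symmetric]) (auto simp: square_integrable_def)
      hence "?c = (\<integral>z. 0 \<partial>D)"
        using residual_square_integrable by (intro integral_cong_AE) (auto simp: square_integrable_def)
      thus ?thesis using h by simp
    qed
  qed
  from linear_le_quadratic_imp_zero[OF this h] show ?thesis .
qed

text \<open>Pythagoras: orthogonality removes the mixed term. The form as a sum avoids subtraction
  of extended reals.\<close>

lemma excess_risk:
  assumes v: "v \<in> carrier_vec d"
  shows "risk D v = risk D w + ennreal ((v - w) \<bullet> (H *\<^sub>v (v - w)) / 2)"
proof -
  have vw: "v - w \<in> carrier_vec d" and eq: "w + (v - w) = v"
    using v w by (auto intro!: eq_vecI)
  let ?r = "\<integral>z. (residual z)\<^sup>2 \<partial>D"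
  have "risk D w = ennreal (?r / 2)"
    using risk_expansion[of "0\<^sub>v d"] w H_carrier by (simp add: linear_eq cong: Bochner_Integration.integral_cong)
  moreover have "risk D v = ennreal ((?r + (v - w) \<bullet> (H *\<^sub>v (v - w))) / 2)"
    using risk_expansion[OF vw] by (simp add: eq residual_orthogonal[OF vw])
  ultimately show ?thesis
    using H_nonneg[OF vw] by (simp add: add_divide_distrib flip: ennreal_plus)
qed

end

end

end

section \<open>Distributed averaging and the two-level spectrum\<close>

lemma sgd_carrier:
  assumes "w1 \<in> carrier_vec d" "\<And>t. t < n \<Longrightarrow> fst (z t) \<in> carrier_vec d"
  shows "sgd \<gamma> w1 z n \<in> carrier_vec d"
  using assms(2) by (induction n) (auto simp: assms(1))

text \<open>Measuring the prediction error relative to \<open>w\<close> brings the update into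
  exactly the shape of the recursion for \<open>err\<close>.\<close>

lemma (in eigenbasis) coord_sgd_Suc:
  fixes z :: "nat \<Rightarrow> rvec \<times> real"
  assumes w: "w \<in> carrier_vec d" and v: "sgd \<gamma> w1 z t \<in> carrier_vec d"
    and x: "fst (z t) \<in> carrier_vec d" and i: "i < d"
  shows "col U i \<bullet> (sgd \<gamma> w1 z (Suc t) - w) = col U i \<bullet> (sgd \<gamma> w1 z t - w)
    - \<gamma> * (((\<Sum>l<d. (col U l \<bullet> (sgd \<gamma> w1 z t - w)) * (col U l \<bullet> fst (z t)))
         - (snd (z t) - w \<bullet> fst (z t))) * (col U i \<bullet> fst (z t)))"
proof -
  let ?v = "sgd \<gamma> w1 z t" and ?x = "fst (z t)"
  define c where "c = \<gamma> * (?v \<bullet> ?x - snd (z t))"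
  have "sgd \<gamma> w1 z (Suc t) - w = (?v - w) - c \<cdot>\<^sub>v ?x"
    using w v x by (intro eq_vecI) (auto simp: c_def)
  hence 1: "col U i \<bullet> (sgd \<gamma> w1 z (Suc t) - w) = col U i \<bullet> (?v - w) - c * (col U i \<bullet> ?x)"
    using w v x col_U[OF i] by (simp add: scalar_prod_minus_distrib[of _ d])
  have 2: "?v \<bullet> ?x - snd (z t) = (?v - w) \<bullet> ?x - (snd (z t) - w \<bullet> ?x)"
    using w v x by (simp add: minus_scalar_prod_distrib[of _ d])
  have 3: "(?v - w) \<bullet> ?x = (\<Sum>l<d. (col U l \<bullet> (?v - w)) * (col U l \<bullet> ?x))"
    using w v x by (subst parseval) (auto simp: coord_eq intro!: sum.cong)
  show ?thesis unfolding 1 c_def 2 3 by (simp only: mult.assoc)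
qed

lemma scalar_prod_dist_sgd:
  assumes a: "a \<in> carrier_vec d" and w: "w \<in> carrier_vec d" and m: "0 < m" and k: "0 < k"
    and s: "\<And>j t. j < m \<Longrightarrow> t < k \<Longrightarrow> sgd \<gamma> w1 (z j) t \<in> carrier_vec d"
  shows "a \<bullet> (dist_sgd d m k \<gamma> w1 z - w)
    = (\<Sum>j<m. \<Sum>t<k. a \<bullet> (sgd \<gamma> w1 (z j) t - w)) / (real m * real k)"
proof -
  let ?s = "\<lambda>j t l. sgd \<gamma> w1 (z j) t $ l - w $ l"
  have entry: "dist_sgd d m k \<gamma> w1 z $ l - w $ l = (\<Sum>j<m. \<Sum>t<k. ?s j t l) / (real m * real k)" if "l < d" for l
  proof -
    have "dist_sgd d m k \<gamma> w1 z $ l = (\<Sum>j<m. \<Sum>t<k. sgd \<gamma> w1 (z j) t $ l) / (real m * real k)"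
      using that by (simp add: dist_sgd_def vec_average_def mult.commute flip: sum_divide_distrib)
    moreover have "(\<Sum>j<m. \<Sum>t<k. ?s j t l) = (\<Sum>j<m. \<Sum>t<k. sgd \<gamma> w1 (z j) t $ l) - real m * real k * w $ l"
      by (simp add: sum_subtractf)
    ultimately show ?thesis using m k by (simp add: field_simps)
  qed
  have "a \<bullet> (dist_sgd d m k \<gamma> w1 z - w) = (\<Sum>l<d. a $ l * (dist_sgd d m k \<gamma> w1 z $ l - w $ l))"
    using w by (simp add: scalar_prod_lessThan)
  also have "\<dots> = (\<Sum>l<d. \<Sum>j<m. \<Sum>t<k. a $ l * ?s j t l) / (real m * real k)"
    by (simp add: entry sum_divide_distrib sum_distrib_left)
  also have "(\<Sum>l<d. \<Sum>j<m. \<Sum>t<k. a $ l * ?s j t l) = (\<Sum>j<m. \<Sum>l<d. \<Sum>t<k. a $ l * ?s j t l)"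
    by (rule sum.swap)
  also have "\<dots> = (\<Sum>j<m. \<Sum>t<k. \<Sum>l<d. a $ l * ?s j t l)"
    by (intro sum.cong refl sum.swap)
  also have "\<dots> = (\<Sum>j<m. \<Sum>t<k. a \<bullet> (sgd \<gamma> w1 (z j) t - w))"
    using w s by (intro sum.cong refl) (auto simp: scalar_prod_lessThan)
  finally show ?thesis .
qed

text \<open>Valid for any positive spectrum. The eigenbasis is chosen inside the proof, so the
  coordinates \<open>a0\<close> of the initial error are existential; only their total square is
  needed later.\<close>

theorem dist_sgd_excess_risk:
  fixes D :: "(rvec \<times> real) measure" and P :: "'w measure"
    and Z :: "nat \<Rightarrow> nat \<Rightarrow> 'w \<Rightarrow> rvec \<times> real"
  assumes D: "prob_space D" "sets D = sets (pair_borel d)"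
    and iid: "iid_samples d m k D P Z"
    and w: "min_norm_minimizer d D w"
    and spec: "has_spectrum d (second_moment d D) l" and l: "\<And>j. 1 \<le> j \<Longrightarrow> j \<le> d \<Longrightarrow> 0 < l j"
    and fourth: "fourth_moment_bound d D \<tau>" and noise: "noise_level d D w \<sigma>"
    and \<gamma>: "0 < \<gamma>" "\<gamma> < 1 / (\<tau> * mat_trace (second_moment d D))" and \<tau>: "0 < \<tau>"
    and m: "0 < m" and k: "0 < k"
  shows "\<exists>a0. (\<Sum>i<d. (a0 i)\<^sup>2) = (euclid_norm w)\<^sup>2 \<and>
    (\<integral>\<^sup>+ \<omega>. risk D (dist_sgd d m k \<gamma> (0\<^sub>v d) (\<lambda>j t. Z j t \<omega>)) \<partial>P) \<le> risk D w + ennreal ((\<Sum>i<d. l (Suc i) *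
      ((a0 i)\<^sup>2 * (min (real k) (1 / (\<gamma> * l (Suc i))) / real k)\<^sup>2
        + min (4 / (l (Suc i))\<^sup>2) (\<gamma>\<^sup>2 * (real k)\<^sup>2) * (2 * l (Suc i) *
            (\<tau> * (((\<Sum>i<d. (a0 i)\<^sup>2) + 2 * \<gamma>\<^sup>2 * \<sigma>\<^sup>2 * (\<Sum>i<d. l (Suc i)) * real k)
              / (2 * \<gamma> * (1 - \<gamma> * \<tau> * (\<Sum>i<d. l (Suc i))))) + \<sigma>\<^sup>2 * real k))
          / (real m * (real k)\<^sup>2))) / 2)"
proof -
  interpret data_law D d
    using D fourth by (auto simp: data_law_def data_law_axioms_def fourth_moment_bound_def)
  let ?\<mu> = "\<lambda>i. l (Suc i)"
  obtain U where "eigenbasis d H U ?\<mu>"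
    using eigenbasis_exists[OF H_carrier second_moment_symmetric spec] by blast
  then interpret E: eigenbasis d H U ?\<mu> .
  have w_carrier: "w \<in> carrier_vec d" and minimal: "\<And>v. v \<in> carrier_vec d \<Longrightarrow> risk D w \<le> risk D v"
    using w by (auto simp: min_norm_minimizer_def is_arg_min_def not_less)
  \<comment> \<open>The iteration starts at 0, so the initial error is the negative of
    \<open>w\<close>.\<close>
  define a0 where "a0 = (\<lambda>i. - (col U i \<bullet> w))"
  have a0: "(\<Sum>i<d. (a0 i)\<^sup>2) = (euclid_norm w)\<^sup>2"
    unfolding euclid_norm_power2 E.parseval[OF w_carrier w_carrier]
    by (intro sum.cong) (auto simp: a0_def E.coord_eq power2_eq_square)
  show ?thesis
  proof (cases "risk D w < \<infinity>")
    \<comment> \<open>With infinite minimal risk the right-hand side is infinite.\<close>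
    case False
    hence "risk D w = \<top>" by (metis infinity_ennreal_def less_top)
    thus ?thesis using a0 by (intro exI[of _ a0]) simp
  next
    case finite: True
    interpret P: prob_space P using iid by (simp add: iid_samples_def)
    have indep: "P.indep_vars (\<lambda>_. D) (\<lambda>(j, t). Z j t) ({..<m} \<times> {..<k})"
      using iid by (simp add: iid_samples_def P.indep_vars_def D(2) measurable_cong_sets[OF refl D(2)])
    have distr: "distr P D (Z j t) = D" if "j < m" "t < k" for j t
    proof -
      have "distr P D (Z j t) = distr P (pair_borel d) (Z j t)"
        by (rule distr_cong) (auto simp: D(2))
      thus ?thesis using iid that by (simp add: iid_samples_def)
    qed
    have u_form: "(\<integral>z. (col U i \<bullet> fst z) * (col U j \<bullet> fst z) \<partial>D) = (if i = j then ?\<mu> i else 0)"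
      if "i < d" "j < d" for i j
    proof -
      have "(\<integral>z. (col U i \<bullet> fst z) * (col U j \<bullet> fst z) \<partial>D) = col U i \<bullet> (H *\<^sub>v col U j)"
        using that by (intro H_form[symmetric] E.col_U)
      also have "\<dots> = (\<Sum>l<d. ?\<mu> l * ((if l = i then 1 else 0) * (if l = j then 1 else 0)))"
        using that by (subst E.quadratic_form_H) (auto intro!: sum.cong E.col_U simp: E.coord_col simp del: index_mult_mat_vec)
      also have "\<dots> = (\<Sum>l<d. if l = i then if i = j then ?\<mu> i else 0 else 0)"
        by (rule sum.cong) auto
      finally show ?thesis using that by simp
    qed
    have \<mu>_pos: "0 < ?\<mu> i" if "i < d" for i using l[of "Suc i"] that by simp
    have stepsize: "\<gamma> * \<tau> * (\<Sum>i<d. ?\<mu> i) < 1"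
    proof (cases "d = 0")
      case False
      hence "0 < (\<Sum>i<d. ?\<mu> i)" by (intro sum_pos) (auto intro: \<mu>_pos)
      thus ?thesis using \<gamma>(2) \<tau> by (simp add: E.mat_trace_H field_simps)
    qed simp
    note noise' = noise[unfolded noise_level_def]
    interpret S: sgd_coordinates P D "\<lambda>(j, t). Z j t" m k d "\<lambda>i z. col U i \<bullet> fst z"
      "\<lambda>z. snd z - w \<bullet> fst z" ?\<mu> a0 \<gamma> \<tau> "\<sigma>\<^sup>2"
    proof
      show "P.indep_vars (\<lambda>_. D) (\<lambda>(j, t). Z j t) ({..<m} \<times> {..<k})" by (rule indep)
      show "distr P D ((\<lambda>(j, t). Z j t) p) = D" if "p \<in> {..<m} \<times> {..<k}" for p
        using that distr by auto
      show "(\<lambda>z. col U i \<bullet> fst z) \<in> borel_measurable D" for i by (rule linear_measurable)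
      show "(\<lambda>z. snd z - w \<bullet> fst z) \<in> borel_measurable D"
        by (intro borel_measurable_diff linear_measurable snd_measurable)
      show "integrable D (\<lambda>z. (col U i \<bullet> fst z) ^ 4)" for i
        using linear_square_integrable[of "col U i" "col U i"]
        by (simp add: square_integrable_def flip: power2_eq_square power_mult)
      show "integrable D (\<lambda>z. ((snd z - w \<bullet> fst z) * (col U i \<bullet> fst z))\<^sup>2)" if "i < d" for i
        using noise' by (intro noise_form(1) E.col_U[OF that]) auto
      show "(\<integral>z. (col U i \<bullet> fst z) * (col U j \<bullet> fst z) \<partial>D) = (if i = j then ?\<mu> i else 0)"
        if "i < d" "j < d" for i j using that by (rule u_form)
      show "(\<integral>z. (snd z - w \<bullet> fst z) * (col U i \<bullet> fst z) \<partial>D) = 0" if "i < d" for i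
        by (rule residual_orthogonal[OF w_carrier finite minimal E.col_U[OF that]])
      show "(\<integral>z. ((snd z - w \<bullet> fst z) * (col U i \<bullet> fst z))\<^sup>2 \<partial>D) \<le> \<sigma>\<^sup>2 * ?\<mu> i" if "i < d" for i
      proof -
        have "(\<integral>z. ((snd z - w \<bullet> fst z) * (col U i \<bullet> fst z))\<^sup>2 \<partial>D) = col U i \<bullet> (noise_cov d D w *\<^sub>v col U i)"
          using noise' by (intro noise_form(2)[symmetric] E.col_U[OF that]) auto
        also have "\<dots> \<le> op_norm d (inv_sqrt_mat d H * noise_cov d D w * inv_sqrt_mat d H) * (col U i \<bullet> (H *\<^sub>v col U i))"
          by (rule E.quadratic_form_le_op_norm_whitened[OF \<mu>_pos _ E.col_U[OF that]]) (auto simp: noise_cov_def)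
        also have "\<dots> = \<sigma>\<^sup>2 * (col U i \<bullet> (H *\<^sub>v col U i))" using noise' by simp
        also have "col U i \<bullet> (H *\<^sub>v col U i) = ?\<mu> i"
          using u_form[OF that that] by (subst H_form) (auto intro: E.col_U that)
        finally show ?thesis .
      qed
      show "(\<integral>z. ((\<Sum>l<d. \<alpha> l * (col U l \<bullet> fst z)) * (col U i \<bullet> fst z))\<^sup>2 \<partial>D)
          \<le> \<tau> * (\<Sum>l<d. ?\<mu> l * (\<alpha> l)\<^sup>2) * ?\<mu> i" if i: "i < d" for \<alpha> i
      proof -
        \<comment> \<open>The vector whose eigen-coordinates are \<open>\<alpha>\<close>, which
          makes the linear combination of coordinates a linear form in x.\<close>
        define a where "a = U *\<^sub>v Matrix.vec d \<alpha>"
        have a: "a \<in> carrier_vec d" using E.U by (simp add: a_def)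
        have coord_a: "E.coord l a = \<alpha> l" if "l < d" for l
          unfolding a_def using that by (subst E.coord_linear) auto
        have "a \<bullet> fst z = (\<Sum>l<d. \<alpha> l * (col U l \<bullet> fst z))" if "z \<in> space D" for z
          using that by (subst E.parseval[OF a fst_carrier])
            (auto intro!: sum.cong simp: coord_a E.coord_eq[symmetric] simp del: index_mult_mat_vec)
        hence "(\<integral>z. ((\<Sum>l<d. \<alpha> l * (col U l \<bullet> fst z)) * (col U i \<bullet> fst z))\<^sup>2 \<partial>D)
            = (\<integral>z. ((a \<bullet> fst z) * (col U i \<bullet> fst z))\<^sup>2 \<partial>D)"
          by (intro Bochner_Integration.integral_cong) auto
        also have "\<dots> \<le> \<tau> * (a \<bullet> (H *\<^sub>v a)) * (col U i \<bullet> (H *\<^sub>v col U i))"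
          by (rule fourth_moment_le[OF fourth a E.col_U[OF i]])
        also have "a \<bullet> (H *\<^sub>v a) = (\<Sum>l<d. ?\<mu> l * (\<alpha> l)\<^sup>2)"
          by (subst E.quadratic_form_H[OF a a])
             (auto intro!: sum.cong simp: coord_a power2_eq_square simp del: index_mult_mat_vec)
        also have "col U i \<bullet> (H *\<^sub>v col U i) = ?\<mu> i"
          using u_form[OF i i] by (subst H_form) (auto intro: E.col_U i)
        finally show ?thesis .
      qed
    qed (use \<gamma> \<tau> \<mu>_pos stepsize in auto)
    let ?avg = "\<lambda>i \<omega>. (\<Sum>j<m. \<Sum>t<k. S.err j t \<omega> i) / (real m * real k)"
    \<comment> \<open>An identity for each outcome: the vector iteration and the abstract recursion
      \<open>err\<close> agree sample by sample, so the expectation is taken only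
      afterwards.\<close>
    have risk_eq: "risk D (dist_sgd d m k \<gamma> (0\<^sub>v d) (\<lambda>j t. Z j t \<omega>))
        = risk D w + ennreal ((\<Sum>i<d. ?\<mu> i * (?avg i \<omega>)\<^sup>2) / 2)" if \<omega>: "\<omega> \<in> space P" for \<omega>
    proof -
      let ?z = "\<lambda>j t. Z j t \<omega>" and ?v = "dist_sgd d m k \<gamma> (0\<^sub>v d) (\<lambda>j t. Z j t \<omega>)"
      have x: "fst (?z j t) \<in> carrier_vec d" if "j < m" "t < k" for j t
        using measurable_space[OF S.Z_measurable \<omega>, of "(j, t)"] that by (auto intro: fst_carrier)
      have v: "sgd \<gamma> (0\<^sub>v d) (?z j) t \<in> carrier_vec d" if "j < m" "t \<le> k" for j t
        by (rule sgd_carrier) (use x that in auto)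
      have err: "col U i \<bullet> (sgd \<gamma> (0\<^sub>v d) (?z j) t - w) = S.err j t \<omega> i" if "j < m" "t \<le> k" "i < d" for j t i
        using that(2,3)
      proof (induction t arbitrary: i)
        case 0
        have "col U i \<bullet> (0\<^sub>v d - w) = col U i \<bullet> 0\<^sub>v d - col U i \<bullet> w"
          by (rule scalar_prod_minus_distrib) (use w_carrier E.col_U[OF 0(2)] in auto)
        also have "\<dots> = a0 i" using E.col_U[OF 0(2)] by (simp add: a0_def)
        finally show ?case by (simp only: sgd.simps S.err.simps)
      next
        case (Suc t)
        show ?case
          using Suc that(1) by (subst E.coord_sgd_Suc) (auto simp: w_carrier v x)
      qed
      have dv: "?v - w \<in> carrier_vec d" and vd: "?v \<in> carrier_vec d"
        using w_carrier by (auto simp: dist_sgd_def vec_average_def)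
      have avg: "col U i \<bullet> (?v - w) = ?avg i \<omega>" if "i < d" for i
        by (subst scalar_prod_dist_sgd[OF E.col_U[OF that] w_carrier m k])
           (use that v err in auto)
      have "(?v - w) \<bullet> (H *\<^sub>v (?v - w)) = (\<Sum>i<d. ?\<mu> i * (?avg i \<omega>)\<^sup>2)"
        unfolding E.quadratic_form_H[OF dv dv]
        by (intro sum.cong) (auto simp: E.coord_eq avg power2_eq_square simp del: index_mult_mat_vec)
      thus ?thesis using excess_risk[OF w_carrier finite minimal vd] by simp
    qed
    have avg_int: "integrable P (\<lambda>\<omega>. (?avg i \<omega>)\<^sup>2)" if "i < d" for i
      using S.square_integrable_averaged_err[OF that] by (simp add: square_integrable_def)
    have sum_int: "integrable P (\<lambda>\<omega>. (\<Sum>i<d. ?\<mu> i * (?avg i \<omega>)\<^sup>2) / 2)"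
      by (intro integrable_divide Bochner_Integration.integrable_sum integrable_mult_right avg_int) auto
    have "(\<integral>\<^sup>+ \<omega>. risk D (dist_sgd d m k \<gamma> (0\<^sub>v d) (\<lambda>j t. Z j t \<omega>)) \<partial>P)
        = (\<integral>\<^sup>+ \<omega>. risk D w + ennreal ((\<Sum>i<d. ?\<mu> i * (?avg i \<omega>)\<^sup>2) / 2) \<partial>P)"
      by (rule nn_integral_cong) (rule risk_eq)
    also have "\<dots> = risk D w + (\<integral>\<^sup>+ \<omega>. ennreal ((\<Sum>i<d. ?\<mu> i * (?avg i \<omega>)\<^sup>2) / 2) \<partial>P)"
      using borel_measurable_integrable[OF sum_int]
      by (subst nn_integral_add) (auto simp: P.emeasure_space_1)
    also have "(\<integral>\<^sup>+ \<omega>. ennreal ((\<Sum>i<d. ?\<mu> i * (?avg i \<omega>)\<^sup>2) / 2) \<partial>P)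
        = ennreal (\<integral>\<omega>. (\<Sum>i<d. ?\<mu> i * (?avg i \<omega>)\<^sup>2) / 2 \<partial>P)"
      using sum_int by (intro nn_integral_eq_integral)
        (auto intro!: sum_nonneg mult_nonneg_nonneg less_imp_le[OF \<mu>_pos])
    also have "(\<integral>\<omega>. (\<Sum>i<d. ?\<mu> i * (?avg i \<omega>)\<^sup>2) / 2 \<partial>P) = (\<Sum>i<d. ?\<mu> i * (\<integral>\<omega>. (?avg i \<omega>)\<^sup>2 \<partial>P)) / 2"
    proof -
      have "(\<integral>\<omega>. (\<Sum>i<d. ?\<mu> i * (?avg i \<omega>)\<^sup>2) \<partial>P) = (\<Sum>i<d. \<integral>\<omega>. ?\<mu> i * (?avg i \<omega>)\<^sup>2 \<partial>P)"
        by (intro Bochner_Integration.integral_sum integrable_mult_right avg_int) auto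
      thus ?thesis by simp
    qed
    finally have eq: "(\<integral>\<^sup>+ \<omega>. risk D (dist_sgd d m k \<gamma> (0\<^sub>v d) (\<lambda>j t. Z j t \<omega>)) \<partial>P)
        = risk D w + ennreal ((\<Sum>i<d. ?\<mu> i * (\<integral>\<omega>. (?avg i \<omega>)\<^sup>2 \<partial>P)) / 2)" .
    show ?thesis
    proof (intro exI[of _ a0] conjI a0, unfold eq, intro add_left_mono ennreal_leI divide_right_mono sum_mono mult_left_mono)
      fix i assume "i \<in> {..<d}"
      thus "0 \<le> ?\<mu> i" using \<mu>_pos[of i] by simp
      show "(\<integral>\<omega>. (?avg i \<omega>)\<^sup>2 \<partial>P) \<le> (a0 i)\<^sup>2 * (min (real k) (1 / (\<gamma> * ?\<mu> i)) / real k)\<^sup>2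
        + min (4 / (?\<mu> i)\<^sup>2) (\<gamma>\<^sup>2 * (real k)\<^sup>2) * (2 * ?\<mu> i *
            (\<tau> * (((\<Sum>i<d. (a0 i)\<^sup>2) + 2 * \<gamma>\<^sup>2 * \<sigma>\<^sup>2 * (\<Sum>i<d. ?\<mu> i) * real k)
              / (2 * \<gamma> * (1 - \<gamma> * \<tau> * (\<Sum>i<d. ?\<mu> i)))) + \<sigma>\<^sup>2 * real k))
          / (real m * (real k)\<^sup>2)"
        using S.averaged_err_second_moment[OF _ m k, of i] \<open>i \<in> {..<d}\<close> unfolding S.noise_bound_def by simp
    qed simp
  qed
qed

section \<open>Rates for the two-level spectrum\<close>

lemma sum_two_level_spectrum:
  assumes "0 < d'" "d' < d"
  shows "(\<Sum>i<d. f i (two_level_spectrum d d' (Suc i)))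
    = (\<Sum>i<d'. f i (1 / real d')) + (\<Sum>i\<in>{d'..<d}. f i (1 / (real d - real d')))"
proof -
  have split: "{..<d} = {..<d'} \<union> {d'..<d}" using assms by auto
  have "(\<Sum>i<d. f i (two_level_spectrum d d' (Suc i))) = (\<Sum>i<d'. f i (two_level_spectrum d d' (Suc i)))
      + (\<Sum>i\<in>{d'..<d}. f i (two_level_spectrum d d' (Suc i)))"
    unfolding split by (rule sum.union_disjoint) auto
  thus ?thesis by (simp add: two_level_spectrum_def)
qed

text \<open>Each block contributes 1, whatever its size. This is the origin of the 2 in
  \<open>1 - 2 * \<gamma> * \<tau>\<close>.\<close>

lemma two_level_spectrum_trace:
  assumes "0 < d'" "d' < d"
  shows "(\<Sum>i<d. two_level_spectrum d d' (Suc i)) = 2"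
  using sum_two_level_spectrum[OF assms, of "\<lambda>_ x. x"] assms by (simp add: of_nat_diff)

text \<open>On the \<open>d'\<close> large eigenvalues the bounds that improve with the eigenvalue
  are used, on the others those that grow with \<open>k\<close>. A small eigenvalue contributes a
  variance of order one over the squared block size, and the number of such coordinates restores one
  factor.\<close>

lemma two_level_risk_bound:
  fixes \<gamma> NB :: real
  assumes d: "0 < d'" "d' < d" and \<gamma>: "0 < \<gamma>" and NB: "0 \<le> NB" and m: "0 < m" and k: "0 < k"
  shows "(\<Sum>i<d. two_level_spectrum d d' (Suc i) *
      ((a i)\<^sup>2 * (min (real k) (1 / (\<gamma> * two_level_spectrum d d' (Suc i))) / real k)\<^sup>2
        + min (4 / (two_level_spectrum d d' (Suc i))\<^sup>2) (\<gamma>\<^sup>2 * (real k)\<^sup>2)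
            * (2 * two_level_spectrum d d' (Suc i) * NB) / (real m * (real k)\<^sup>2)))
    \<le> (\<Sum>i<d. (a i)\<^sup>2) * (real d' / (\<gamma>\<^sup>2 * (real k)\<^sup>2) + 1 / (real d - real d'))
      + NB / real m * (8 * real d' / (real k)\<^sup>2 + 2 * \<gamma>\<^sup>2 / (real d - real d'))"
proof -
  define e where "e = real d - real d'"
  have e: "0 < e" using d by (simp add: e_def)
  let ?f = "\<lambda>i x. x * ((a i)\<^sup>2 * (min (real k) (1 / (\<gamma> * x)) / real k)\<^sup>2
        + min (4 / x\<^sup>2) (\<gamma>\<^sup>2 * (real k)\<^sup>2) * (2 * x * NB) / (real m * (real k)\<^sup>2))"
  have head: "?f i (1 / real d') \<le> (a i)\<^sup>2 * (real d' / (\<gamma>\<^sup>2 * (real k)\<^sup>2)) + 8 * NB / (real m * (real k)\<^sup>2)" for i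
  proof -
    let ?x = "1 / real d'"
    have x: "0 < ?x" using d by simp
    have "?f i ?x \<le> ?x * ((a i)\<^sup>2 * ((1 / (\<gamma> * ?x)) / real k)\<^sup>2
        + (4 / ?x\<^sup>2) * (2 * ?x * NB) / (real m * (real k)\<^sup>2))"
      using x NB \<gamma> by (intro mult_left_mono add_mono power_mono divide_right_mono mult_right_mono) auto
    also have "\<dots> = (a i)\<^sup>2 * (real d' / (\<gamma>\<^sup>2 * (real k)\<^sup>2)) + 8 * NB / (real m * (real k)\<^sup>2)"
      using d \<gamma> m k by (simp add: field_simps power2_eq_square)
    finally show ?thesis .
  qed
  have tail: "?f i (1 / e) \<le> (a i)\<^sup>2 * (1 / e) + 2 * \<gamma>\<^sup>2 * NB / (real m * e\<^sup>2)" for i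
  proof -
    let ?x = "1 / e"
    have x: "0 < ?x" using e by simp
    have "?f i ?x \<le> ?x * ((a i)\<^sup>2 * (real k / real k)\<^sup>2
        + (\<gamma>\<^sup>2 * (real k)\<^sup>2) * (2 * ?x * NB) / (real m * (real k)\<^sup>2))"
      using x NB \<gamma> e by (intro mult_left_mono add_mono power_mono divide_right_mono mult_right_mono) auto
    also have "\<dots> = (a i)\<^sup>2 * (1 / e) + 2 * \<gamma>\<^sup>2 * NB / (real m * e\<^sup>2)"
      using e \<gamma> m k by (simp add: field_simps power2_eq_square)
    finally show ?thesis .
  qed
  have "(\<Sum>i<d. ?f i (two_level_spectrum d d' (Suc i)))
      = (\<Sum>i<d'. ?f i (1 / real d')) + (\<Sum>i\<in>{d'..<d}. ?f i (1 / e))"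
    unfolding e_def by (rule sum_two_level_spectrum[OF d])
  also have "\<dots> \<le> (\<Sum>i<d'. (a i)\<^sup>2 * (real d' / (\<gamma>\<^sup>2 * (real k)\<^sup>2)) + 8 * NB / (real m * (real k)\<^sup>2))
      + (\<Sum>i\<in>{d'..<d}. (a i)\<^sup>2 * (1 / e) + 2 * \<gamma>\<^sup>2 * NB / (real m * e\<^sup>2))"
    by (intro add_mono sum_mono head tail)
  also have "\<dots> = (\<Sum>i<d'. (a i)\<^sup>2) * (real d' / (\<gamma>\<^sup>2 * (real k)\<^sup>2)) + (\<Sum>i\<in>{d'..<d}. (a i)\<^sup>2) * (1 / e)
      + NB / real m * (8 * real d' / (real k)\<^sup>2 + 2 * \<gamma>\<^sup>2 / e)"
  proof -
    have "real (card {d'..<d}) = e" using d by (simp add: e_def of_nat_diff)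
    thus ?thesis using e m k unfolding sum.distrib sum_distrib_right
      by (simp add: field_simps power2_eq_square)
  qed
  also have "\<dots> \<le> (\<Sum>i<d. (a i)\<^sup>2) * (real d' / (\<gamma>\<^sup>2 * (real k)\<^sup>2)) + (\<Sum>i<d. (a i)\<^sup>2) * (1 / e)
      + NB / real m * (8 * real d' / (real k)\<^sup>2 + 2 * \<gamma>\<^sup>2 / e)"
    using d e by (intro add_mono mult_right_mono sum_mono2) auto
  finally show ?thesis by (simp add: e_def algebra_simps)
qed

text \<open>
  Here \<open>k\<close> is the local sample size and \<open>S\<close> is the squared norm of \<open>w\<^sup>*\<close>. The restriction on the
  number \<open>m\<close> of nodes enters as \<open>m S \<le> G k\<close>: it turns the bias, which averaging over nodes
  does not reduce, into a quantity of order \<open>1/m\<close>.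
\<close>

lemma two_level_rate:
  fixes \<gamma> \<tau> \<sigma> S e d' \<kappa> :: real
  defines "G \<equiv> \<gamma> * (1 - 2 * \<gamma> * \<tau>)"
  assumes \<gamma>: "0 < \<gamma>" and \<tau>: "0 < \<tau>" and G: "0 < G" and S: "0 \<le> S"
    and m: "1 \<le> m" and k: "0 < k" and mS: "m * S \<le> G * k"
    and d': "0 \<le> d'" "d' / k \<le> \<kappa>" and e: "0 < e" "k / e \<le> 2 * \<kappa>"
  shows "(S * (d' / (\<gamma>\<^sup>2 * k\<^sup>2) + 1 / e)
      + (\<tau> * ((S + 2 * \<gamma>\<^sup>2 * \<sigma>\<^sup>2 * 2 * k) / (2 * \<gamma> * (1 - \<gamma> * \<tau> * 2))) + \<sigma>\<^sup>2 * k) / m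
          * (8 * d' / k\<^sup>2 + 2 * \<gamma>\<^sup>2 / e)) / 2
    \<le> (1 / (2 * \<gamma>) + \<gamma> + (\<tau> * (1 / 2 + 2 * \<gamma>\<^sup>2 * \<sigma>\<^sup>2 / G) + \<sigma>\<^sup>2) * (4 + 2 * \<gamma>\<^sup>2)) * (\<kappa> / m)"
proof -
  define C where "C = \<tau> * (1 / 2 + 2 * \<gamma>\<^sup>2 * \<sigma>\<^sup>2 / G) + \<sigma>\<^sup>2"
  \<comment> \<open>The two ratios that carry the rate: \<open>x\<close> for the head of the
    spectrum, \<open>y\<close> for the tail.\<close>
  define x y where "x = d' / k" and "y = k / e"
  have C: "0 \<le> C" unfolding C_def using \<tau> G by (intro add_nonneg_nonneg mult_nonneg_nonneg) auto
  have xy: "0 \<le> x" "x \<le> \<kappa>" "0 \<le> y" "y \<le> 2 * \<kappa>" using d' e k by (auto simp: x_def y_def)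
  \<comment> \<open>The restriction is used in two strengths: without \<open>m\<close> it bounds the
    initial error inside the noise term, with \<open>m\<close> it gives the bias its factor
    \<open>1/m\<close>.\<close>
  have "S \<le> m * S" using m S mult_right_mono[of 1 m S] by simp
  hence SG: "S \<le> G * k" using mS by simp
  have "G \<le> \<gamma>" unfolding G_def using \<gamma> \<tau> by (simp add: mult_le_cancel_left2)
  hence "G * k \<le> \<gamma> * k" using k by (intro mult_right_mono) auto
  hence "m * S \<le> \<gamma> * k" using mS by linarith
  hence S\<gamma>: "S \<le> \<gamma> * k / m" using m by (simp add: field_simps)
  have NB: "\<tau> * ((S + 2 * \<gamma>\<^sup>2 * \<sigma>\<^sup>2 * 2 * k) / (2 * \<gamma> * (1 - \<gamma> * \<tau> * 2))) + \<sigma>\<^sup>2 * k \<le> C * k"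
  proof -
    \<comment> \<open>The denominator is \<open>2 * G\<close>, so the share of \<open>S\<close> is
      at most \<open>k / 2\<close> and no trace of R remains in the constant.\<close>
    have "(S + 2 * \<gamma>\<^sup>2 * \<sigma>\<^sup>2 * 2 * k) / (2 * G) \<le> (G * k + 2 * \<gamma>\<^sup>2 * \<sigma>\<^sup>2 * 2 * k) / (2 * G)"
      using SG G by (intro divide_right_mono) auto
    also have "\<dots> = (1 / 2 + 2 * \<gamma>\<^sup>2 * \<sigma>\<^sup>2 / G) * k" using G by (simp add: field_simps)
    finally have "\<tau> * ((S + 2 * \<gamma>\<^sup>2 * \<sigma>\<^sup>2 * 2 * k) / (2 * G)) \<le> \<tau> * ((1 / 2 + 2 * \<gamma>\<^sup>2 * \<sigma>\<^sup>2 / G) * k)"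
      using \<tau> by (intro mult_left_mono) auto
    moreover have "2 * \<gamma> * (1 - \<gamma> * \<tau> * 2) = 2 * G" by (simp add: G_def ac_simps)
    ultimately show ?thesis unfolding C_def by (simp only: distrib_right mult.assoc)
  qed
  have "S * (d' / (\<gamma>\<^sup>2 * k\<^sup>2) + 1 / e) \<le> \<gamma> * k / m * (d' / (\<gamma>\<^sup>2 * k\<^sup>2) + 1 / e)"
    using S\<gamma> d' e by (intro mult_right_mono) auto
  also have "\<dots> = (x / \<gamma> + \<gamma> * y) / m"
    using \<gamma> k e m by (simp add: x_def y_def field_simps power2_eq_square)
  finally have bias: "S * (d' / (\<gamma>\<^sup>2 * k\<^sup>2) + 1 / e) \<le> (x / \<gamma> + \<gamma> * y) / m" .
  have "(\<tau> * ((S + 2 * \<gamma>\<^sup>2 * \<sigma>\<^sup>2 * 2 * k) / (2 * \<gamma> * (1 - \<gamma> * \<tau> * 2))) + \<sigma>\<^sup>2 * k) / m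
          * (8 * d' / k\<^sup>2 + 2 * \<gamma>\<^sup>2 / e) \<le> C * k / m * (8 * d' / k\<^sup>2 + 2 * \<gamma>\<^sup>2 / e)"
    using NB m d' e by (intro mult_right_mono divide_right_mono) auto
  also have "\<dots> = C * (8 * x + 2 * \<gamma>\<^sup>2 * y) / m"
    using k e m by (simp add: x_def y_def field_simps power2_eq_square)
  finally have variance: "(\<tau> * ((S + 2 * \<gamma>\<^sup>2 * \<sigma>\<^sup>2 * 2 * k) / (2 * \<gamma> * (1 - \<gamma> * \<tau> * 2))) + \<sigma>\<^sup>2 * k) / m
          * (8 * d' / k\<^sup>2 + 2 * \<gamma>\<^sup>2 / e) \<le> C * (8 * x + 2 * \<gamma>\<^sup>2 * y) / m" .
  have "((x / \<gamma> + \<gamma> * y) / m + C * (8 * x + 2 * \<gamma>\<^sup>2 * y) / m) / 2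
      \<le> ((\<kappa> / \<gamma> + \<gamma> * (2 * \<kappa>)) / m + C * (8 * \<kappa> + 2 * \<gamma>\<^sup>2 * (2 * \<kappa>)) / m) / 2"
    using xy C \<gamma> m by (intro divide_right_mono add_mono mult_left_mono) auto
  also have "\<dots> = (1 / (2 * \<gamma>) + \<gamma> + C * (4 + 2 * \<gamma>\<^sup>2)) * (\<kappa> / m)"
    using \<gamma> m by (simp add: field_simps)
  finally have rate: "((x / \<gamma> + \<gamma> * y) / m + C * (8 * x + 2 * \<gamma>\<^sup>2 * y) / m) / 2
      \<le> (1 / (2 * \<gamma>) + \<gamma> + C * (4 + 2 * \<gamma>\<^sup>2)) * (\<kappa> / m)" .
  show ?thesis unfolding C_def[symmetric]
    by (rule order_trans[OF divide_right_mono[OF add_mono[OF bias variance]] rate]) simp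
qed

text \<open>The constant is chosen before R, q, r and the distributions; the threshold on n depends
  on R, q, \<open>\<gamma>\<close> and \<open>\<tau>\<close> only.\<close>

theorem corollary3p9:
  fixes \<tau> \<gamma> \<sigma> :: real
  assumes "\<tau> > 0" and "\<gamma> > 0" and "\<sigma> \<ge> 0"
  shows "\<exists>c::real. \<forall>(R::real) (q::real) (r::real) (M :: nat \<Rightarrow> nat) (d :: nat \<Rightarrow> nat) (d' :: nat \<Rightarrow> nat)
      (D :: nat \<Rightarrow> (rvec \<times> real) measure) (wstar :: nat \<Rightarrow> rvec)
      (P :: nat \<Rightarrow> 'w measure) (Z :: nat \<Rightarrow> nat \<Rightarrow> nat \<Rightarrow> 'w \<Rightarrow> rvec \<times> real).
    R > 0 \<longrightarrow> q > 1 \<longrightarrow> 0 < r \<longrightarrow> r \<le> 1 \<longrightarrow>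
    (\<forall>\<^sub>F n in sequentially.
       M n > 0 \<longrightarrow> M n dvd n \<longrightarrow>
       real (d n) = (real n / real (M n)) powr q \<longrightarrow>
       real (d' n) = (real n / real (M n)) powr r \<longrightarrow>
       d' n < d n \<longrightarrow>
       prob_space (D n) \<longrightarrow> sets (D n) = sets (pair_borel (d n)) \<longrightarrow>
       iid_samples (d n) (M n) (n div M n) (D n) (P n) (Z n) \<longrightarrow>
       min_norm_minimizer (d n) (D n) (wstar n) \<longrightarrow>
       has_spectrum (d n) (second_moment (d n) (D n)) (two_level_spectrum (d n) (d' n)) \<longrightarrow>
       cond_second_moment_finite (d n) (D n) \<longrightarrow>
       fourth_moment_bound (d n) (D n) \<tau> \<longrightarrow>
       noise_level (d n) (D n) (wstar n) \<sigma> \<longrightarrow>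
       \<gamma> < 1 / (\<tau> * mat_trace (second_moment (d n) (D n))) \<longrightarrow>
       euclid_norm (wstar n) \<le> R \<longrightarrow>
       real (M n) \<le> sqrt (\<gamma> * (1 - 2 * \<gamma> * \<tau>) * real n / R\<^sup>2) \<longrightarrow>
       (\<integral>\<^sup>+ \<omega>. risk (D n) (dist_sgd (d n) (M n) (n div M n) \<gamma> (0\<^sub>v (d n)) (\<lambda>j t. Z n j t \<omega>)) \<partial>P n)
         \<le> risk (D n) (wstar n)
           + ennreal (c * (1 / (\<gamma> * real (M n))) * (real (M n) / real n) powr (min (1 - r) (q - 1))))"
proof -
  define G where "G = \<gamma> * (1 - 2 * \<gamma> * \<tau>)"
  define c0 where "c0 = 1 / (2 * \<gamma>) + \<gamma> + (\<tau> * (1 / 2 + 2 * \<gamma>\<^sup>2 * \<sigma>\<^sup>2 / G) + \<sigma>\<^sup>2) * (4 + 2 * \<gamma>\<^sup>2)"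
  show ?thesis
  \<comment> \<open>The factor \<open>\<gamma>\<close> cancels the \<open>1/\<gamma>\<close> of the
    stated rate.\<close>
  proof (rule exI[of _ "\<gamma> * c0"], intro allI impI, goal_cases)
    case (1 R q r M d d' D wstar P Z)
    note R = 1(1) and q = 1(2) and r = 1(3,4)
    \<comment> \<open>From this local sample size on, \<open>k powr (q - 1)\<close> is at least 2,
      so d is at least twice \<open>k\<close>, and \<open>k\<close> is at least d'.\<close>
    define K where "K = 2 powr (1 / (q - 1))"
    have K: "0 < K" by (simp add: K_def)
    \<comment> \<open>The node restriction gives that n times the square of R is at most
      \<open>G\<close> times the square of \<open>k\<close>, so this threshold forces
      \<open>K \<le> k\<close>. The 1 keeps n and \<open>k\<close> positive.\<close>
    define N where "N = nat \<lceil>max 1 (K\<^sup>2 * G / R\<^sup>2)\<rceil>"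
    show ?case
      unfolding eventually_sequentially
    proof (rule exI[of _ N], intro allI impI, goal_cases)
      case (1 n)
      note M = 1(2) and dvd = 1(3) and d = 1(4) and d' = 1(5) and d'd = 1(6) and D = 1(7,8)
        and iid = 1(9) and w = 1(10) and spec = 1(11) and fourth = 1(13) and noise = 1(14)
        and step = 1(15) and wR = 1(16) and MR = 1(17)
      have "max 1 (K\<^sup>2 * G / R\<^sup>2) \<le> real n" using 1(1) unfolding N_def by linarith
      hence n: "1 \<le> real n" "K\<^sup>2 * G / R\<^sup>2 \<le> real n" by auto
      define m k where "m = M n" and "k = n div M n"
      have n_eq: "n = m * k" using dvd by (simp add: m_def k_def)
      have m: "0 < m" using M by (simp add: m_def)
      have k: "0 < k" using n n_eq by (cases k) auto
      have ratio: "real n / real m = real k" using m by (simp add: n_eq)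
      have dk: "real (d n) = real k powr q" and d'k: "real (d' n) = real k powr r"
        using d d' ratio by (simp_all add: m_def)
      have d'0: "0 < d' n" using d'k k by (cases "d' n") auto
      have tr: "mat_trace (second_moment (d n) (D n)) = 2"
        using eigenbasis_exists[OF second_moment_carrier second_moment_symmetric spec]
          eigenbasis.mat_trace_H two_level_spectrum_trace[OF d'0 d'd] by metis
      \<comment> \<open>Only here does \<open>G\<close>, by which \<open>c0\<close> divides, become
        positive: the stepsize condition is read with trace 2.\<close>
      have "2 * \<gamma> * \<tau> < 1" using step assms unfolding tr by (simp add: field_simps)
      hence G: "0 < G" using assms by (simp add: G_def)
      have mR: "real m * R\<^sup>2 \<le> G * real k"
      proof -
        have "(real m)\<^sup>2 \<le> G * real n / R\<^sup>2"
          using MR G R power_mono[OF MR, of 2] by (simp add: m_def G_def)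
        hence "real m * (real m * R\<^sup>2) \<le> real m * (G * real k)"
          using R by (simp add: n_eq field_simps power2_eq_square)
        thus ?thesis using m by simp
      qed
      have kK: "K \<le> real k"
      proof -
        have "K\<^sup>2 * G \<le> real n * R\<^sup>2" using n(2) R by (simp add: field_simps)
        also have "\<dots> = real k * (real m * R\<^sup>2)" by (simp add: n_eq)
        also have "\<dots> \<le> real k * (G * real k)" by (intro mult_left_mono mR) simp
        finally have "K\<^sup>2 * G \<le> (real k)\<^sup>2 * G" by (simp add: power2_eq_square ac_simps)
        thus ?thesis using G by (intro power2_le_imp_le[of K "real k"]) auto
      qed
      \<comment> \<open>The target rate as a power of \<open>k\<close>. It dominates the head ratio
        with exponent \<open>r - 1\<close> and the tail ratio with exponent \<open>1 - q\<close>,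
        since the minimum is at most either of \<open>1 - r\<close> and
        \<open>q - 1\<close>.\<close>
      define \<kappa> where "\<kappa> = real k powr (- min (1 - r) (q - 1))"
      have k1: "1 \<le> real k" using k by simp
      have x: "real (d' n) / real k \<le> \<kappa>"
      proof -
        have "real (d' n) / real k = real k powr (r - 1)" using k by (simp add: d'k powr_diff)
        also have "\<dots> \<le> \<kappa>" unfolding \<kappa>_def by (rule powr_mono[OF _ k1]) simp
        finally show ?thesis .
      qed
      have y: "real k / (real (d n) - real (d' n)) \<le> 2 * \<kappa>"
      proof -
        have "2 = K powr (q - 1)" using q by (simp add: K_def powr_powr)
        also have "\<dots> \<le> real k powr (q - 1)" using K kK q by (intro powr_mono2) auto
        finally have "2 * real k \<le> real k powr q" using k by (simp add: powr_diff field_simps)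
        moreover have "real k powr r \<le> real k" using powr_mono[OF r(2) k1] k by simp
        ultimately have "real k powr q / 2 \<le> real (d n) - real (d' n)" by (simp add: dk d'k)
        hence "real k / (real (d n) - real (d' n)) \<le> real k / (real k powr q / 2)"
          using k d'd by (intro divide_left_mono mult_pos_pos) auto
        also have "\<dots> = 2 * real k powr (1 - q)" using k by (simp add: powr_diff)
        also have "\<dots> \<le> 2 * \<kappa>" unfolding \<kappa>_def by (intro mult_left_mono powr_mono[OF _ k1]) auto
        finally show ?thesis .
      qed
      obtain a0 where a0: "(\<Sum>i<d n. (a0 i)\<^sup>2) = (euclid_norm (wstar n))\<^sup>2"
        and le: "(\<integral>\<^sup>+ \<omega>. risk (D n) (dist_sgd (d n) m k \<gamma> (0\<^sub>v (d n)) (\<lambda>j t. Z n j t \<omega>)) \<partial>P n)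
          \<le> risk (D n) (wstar n) + ennreal ((\<Sum>i<d n. two_level_spectrum (d n) (d' n) (Suc i) *
      ((a0 i)\<^sup>2 * (min (real k) (1 / (\<gamma> * two_level_spectrum (d n) (d' n) (Suc i))) / real k)\<^sup>2
        + min (4 / (two_level_spectrum (d n) (d' n) (Suc i))\<^sup>2) (\<gamma>\<^sup>2 * (real k)\<^sup>2)
          * (2 * two_level_spectrum (d n) (d' n) (Suc i) *
            (\<tau> * (((euclid_norm (wstar n))\<^sup>2 + 2 * \<gamma>\<^sup>2 * \<sigma>\<^sup>2 * 2 * real k)
              / (2 * \<gamma> * (1 - \<gamma> * \<tau> * 2))) + \<sigma>\<^sup>2 * real k)) / (real m * (real k)\<^sup>2))) / 2)"
        (is "_ \<le> _ + ennreal (?B / 2)")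
      proof -
        have pos: "0 < two_level_spectrum (d n) (d' n) j" for j
          using d'0 d'd by (simp add: two_level_spectrum_def)
        from dist_sgd_excess_risk[OF D iid w spec pos fourth noise assms(2) step assms(1) M]
        show ?thesis
          using k that two_level_spectrum_trace[OF d'0 d'd] unfolding m_def k_def by auto
      qed
      let ?S = "(euclid_norm (wstar n))\<^sup>2"
      let ?NB = "\<tau> * ((?S + 2 * \<gamma>\<^sup>2 * \<sigma>\<^sup>2 * 2 * real k) / (2 * \<gamma> * (1 - \<gamma> * \<tau> * 2))) + \<sigma>\<^sup>2 * real k"
      have NB: "0 \<le> ?NB"
        using assms \<open>2 * \<gamma> * \<tau> < 1\<close>
        by (intro add_nonneg_nonneg mult_nonneg_nonneg divide_nonneg_nonneg) (auto simp: ac_simps)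
      have "?S \<le> R\<^sup>2" using wR euclid_norm_nonneg by (intro power_mono)
      hence "real m * ?S \<le> real m * R\<^sup>2" by (intro mult_left_mono) auto
      hence mS: "real m * ?S \<le> G * real k" using mR by simp
      have "?B / 2 \<le> (?S * (real (d' n) / (\<gamma>\<^sup>2 * (real k)\<^sup>2) + 1 / (real (d n) - real (d' n)))
          + ?NB / real m * (8 * real (d' n) / (real k)\<^sup>2 + 2 * \<gamma>\<^sup>2 / (real (d n) - real (d' n)))) / 2"
        using two_level_risk_bound[OF d'0 d'd assms(2) NB m k, of a0] unfolding a0
        by (intro divide_right_mono) simp_all
      also have "\<dots> \<le> c0 * (\<kappa> / real m)"
        unfolding c0_def G_def
        by (rule two_level_rate) (use assms G mS m k x y d'd in \<open>auto simp: G_def\<close>)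
      also have "\<dots> = \<gamma> * c0 * (1 / (\<gamma> * real m)) * (real m / real n) powr (min (1 - r) (q - 1))"
      proof -
        have "(real m / real n) powr (min (1 - r) (q - 1)) = \<kappa>"
          unfolding \<kappa>_def powr_minus using k m by (simp add: n_eq powr_divide inverse_eq_divide)
        thus ?thesis using assms(2) by simp
      qed
      finally have "ennreal (?B / 2) \<le> ennreal (\<gamma> * c0 * (1 / (\<gamma> * real (M n)))
          * (real (M n) / real n) powr (min (1 - r) (q - 1)))"
        unfolding m_def by (rule ennreal_leI)
      with le show ?case
        unfolding m_def k_def by (meson add_left_mono order_trans)
    qed
  qed
qed

end
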